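(* Consider the branching random walk on $\mathbb{Z}^d$ described in the context, with $\beta^*>0$. Let $\beta^*>\beta_c$ and $\lambda_{\mathcal{E}}=0$. Then for all $n\in\mathbb{N}$ and $x,y\in\mathbb{Z}^d$ there are constants $J_n(x,y)$ and $J_n(x)$ (not depending on $t$) such that, as $t\to\infty$, $$m_n(t,x,y)\sim J_n(x,y)\,t^{n-1},\qquad m_n(t,x)\sim J_n(x)\,t^{n-1}.$$
   Context: **Random walk.** Let $d\in\mathbb{N}$. The underlying continuous-time random walk on $\mathbb{Z}^d$ has transition intensity matrix $A=(a(x,y))_{x,y\in\mathbb{Z}^d}$ with $a(x,y)\ge0$ for $x\ne y$, $a(x,x)<0$, and is regular ($\sum_y a(x,y)=0$), symmetric ($a(x,y)=a(y,x)$), spatially homogeneous ($a(x,y)=a(y-x)$, regarded as a function of one argument), time homogeneous and irreducible (every lattice point can be reached from every other). No condition on the variance of jumps is imposed. Its transition probabilities are $p(t,x,y)$; $p(h,x,y)=a(x,y)h+o(h)$ for $x\neq y$ and $p(h,x,x)=1+a(x,x)h+o(h)$ as $h\to0$. The Green's function is $G_\lambda(x,y)=\int_0^\infty e^{-\lambda t}p(t,x,y)\,dt$, $\lambda\ge0$, and $\beta_c:=1/G_0(0,0)$ (with $\beta_c=0$ if $G_0(0,0)=\infty$). **Branching and absorption.** Let $f(u)=\sum_{n\ge0}b_nu^n$, $0\le u\le1$, with $b_n\ge0$ for $n\ne1$, $b_1<0$, $\sum_nb_n=0$. A particle at $x$ during a short time $dt$ jumps to $y\ne x$ with probability $a(x,y)dt+o(dt)$,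 dies with probability $b_0dt+o(dt)$ (at every lattice point $x$), and, only if $x=0$, is replaced by $n>1$ particles at $0$ (itself included) with probability $b_ndt+o(dt)$; otherwise it stays unchanged. Particles evolve independently of each other and of the past. Put $\beta^*:=\sum_{n>1}(n-1)b_n$; throughout $\beta^*>0$. The derivatives $\beta^{(r)}:=f^{(r)}(1)$ are assumed finite for all $r\in\mathbb{N}$. **Moments.** $\mu(t,y)$ is the number of particles at $y\in\mathbb{Z}^d$ at time $t$, and $\mu(t)=\sum_y\mu(t,y)$. $\mathsf{E}_x$ is expectation when the process starts at time $0$ with one particle at $x$. $m_n(t,x,y):=\mathsf{E}_x\mu^n(t,y)$, $m_n(t,x):=\mathsf{E}_x\mu^n(t)$, $n\in\mathbb{N}$. **Evolution operator.** $(\mathcal{A}\varphi)(x)=\sum_ya(x-y)\varphi(y)$, $\Delta_0=\delta_0\delta_0^T$ (so $(\Delta_0\varphi)(x)=\varphi(0)$ if $x=0$ and $0$ otherwise), $\mathcal{E}=\mathcal{A}+\beta^*\Delta_0-b_0I$. When $\beta^*>\beta_c$, $\lambda_0>0$ denotes the unique isolated positive eigenvalue of $\mathcal{A}+\beta^*\Delta_0$ on $l^2(\mathbb{Z}^d)$, i.e. the solution of $\beta^*G_\lambda(0,0)=1$, and $\lambda_{\mathcal{E}}:=\lambda_0-b_0$ is the corresponding eigenvalue of $\mathcal{E}$. The symbol $\sim$ denotes asymptotic equivalence (the ratio tends to $1$). *)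

theory Defs
  imports "HOL-Probability.Probability"
begin

section \<open>The underlying random walk\<close>

text \<open>The lattice is \<open>int ^ 'd\<close>. The one-argument form \<open>a(z)\<close> of the intensity is \<open>a 0 z\<close>.\<close>

definition walk_intensity :: "(int ^ 'd \<Rightarrow> int ^ 'd \<Rightarrow> real) \<Rightarrow> bool" where
  "walk_intensity a \<longleftrightarrow>
     (\<forall>x y. x \<noteq> y \<longrightarrow> a x y \<ge> 0) \<and>
     (\<forall>x. a x x < 0) \<and>
     (\<forall>x. (a x has_sum 0) UNIV) \<and>
     (\<forall>x y. a x y = a y x) \<and>
     (\<forall>x y. a x y = a 0 (y - x)) \<and>
     (\<forall>x y. (\<lambda>u v. a u v > 0)\<^sup>*\<^sup>* x y)"

text \<open>Honest (time homogeneous) transition functions with intensity matrix \<open>a\<close>; only times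
  \<open>t \<ge> 0\<close> are constrained. As the entries of \<open>a\<close> are bounded, there is exactly one.\<close>

definition walk_transition ::
  "(int ^ 'd \<Rightarrow> int ^ 'd \<Rightarrow> real) \<Rightarrow> (real \<Rightarrow> int ^ 'd \<Rightarrow> int ^ 'd \<Rightarrow> real) \<Rightarrow> bool" where
  "walk_transition a p \<longleftrightarrow>
     (\<forall>t\<ge>0. \<forall>x y. p t x y \<ge> 0) \<and>
     (\<forall>t\<ge>0. \<forall>x. (p t x has_sum 1) UNIV) \<and>
     (\<forall>x y. p 0 x y = (if x = y then 1 else 0)) \<and>
     (\<forall>s\<ge>0. \<forall>t\<ge>0. \<forall>x y. ((\<lambda>z. p s x z * p t z y) has_sum p (s + t) x y) UNIV) \<and>
     (\<forall>x y. x \<noteq> y \<longrightarrow> (\<lambda>h. p h x y - a x y * h) \<in> o[at_right 0](\<lambda>h. h)) \<and>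
     (\<forall>x. (\<lambda>h. p h x x - (1 + a x x * h)) \<in> o[at_right 0](\<lambda>h. h))"

definition green ::
  "(real \<Rightarrow> int ^ 'd \<Rightarrow> int ^ 'd \<Rightarrow> real) \<Rightarrow> real \<Rightarrow> int ^ 'd \<Rightarrow> int ^ 'd \<Rightarrow> ennreal" where
  "green p l x y = (\<integral>\<^sup>+t\<in>{0..}. ennreal (exp (- l * t) * p t x y) \<partial>lborel)"

definition beta_c :: "(real \<Rightarrow> int ^ 'd \<Rightarrow> int ^ 'd \<Rightarrow> real) \<Rightarrow> real" where
  "beta_c p = (if green p 0 0 0 = \<infinity> then 0 else 1 / enn2real (green p 0 0 0))"


section \<open>The branching mechanism\<close>

definition branching_intensity :: "(nat \<Rightarrow> real) \<Rightarrow> bool" where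
  "branching_intensity b \<longleftrightarrow> (\<forall>n. n \<noteq> 1 \<longrightarrow> b n \<ge> 0) \<and> b 1 < 0 \<and> b sums 0"

definition branching_gf :: "(nat \<Rightarrow> real) \<Rightarrow> real \<Rightarrow> real" where
  "branching_gf b u = (\<Sum>n. b n * u ^ n)"

text \<open>All derivatives of \<open>f\<close>, regarded as a function on \<open>[0,1]\<close> (so one-sided at \<open>1\<close>), exist and
  are finite: \<open>F r\<close> is the \<open>r\<close>-th derivative.\<close>

definition all_derivatives_finite :: "(real \<Rightarrow> real) \<Rightarrow> bool" where
  "all_derivatives_finite f \<longleftrightarrow>
     (\<exists>F :: nat \<Rightarrow> real \<Rightarrow> real. F 0 = f \<and>
        (\<forall>r. \<forall>u\<in>{0..1}. (F r has_real_derivative F (Suc r) u) (at u within {0..1})))"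

definition beta_star :: "(nat \<Rightarrow> real) \<Rightarrow> real" where
  "beta_star b = (\<Sum>\<^sub>\<infinity>n\<in>{1<..}. (real n - 1) * b n)"


section \<open>The branching random walk\<close>

text \<open>A population is a finite multiset of lattice points, \<open>X t\<close> is the population at time
  \<open>t \<ge> 0\<close>, and \<open>Pr \<eta>\<close> is the law of the process started from the population \<open>\<eta>\<close>.
  The fourth clause is the (time homogeneous) Markov property, stated for events depending on
  finitely many past times; the fifth one says that disjoint subpopulations evolve independently.
  The remaining clauses give the behaviour of a single particle in a short time \<open>h\<close>; the last one
  expresses that a particle which neither jumps nor dies nor branches stays unchanged.\<close>

definition exit_rate ::
  "(int ^ 'd \<Rightarrow> int ^ 'd \<Rightarrow> real) \<Rightarrow> (nat \<Rightarrow> real) \<Rightarrow> int ^ 'd \<Rightarrow> real" where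
  "exit_rate a b x =
     (\<Sum>\<^sub>\<infinity>y\<in>-{x}. a x y) + b 0 + (if x = 0 then (\<Sum>\<^sub>\<infinity>n\<in>{1<..}. b n) else 0)"

definition branching_random_walk ::
  "(int ^ 'd \<Rightarrow> int ^ 'd \<Rightarrow> real) \<Rightarrow> (nat \<Rightarrow> real) \<Rightarrow>
   ((int ^ 'd) multiset \<Rightarrow> 'w measure) \<Rightarrow> (real \<Rightarrow> 'w \<Rightarrow> (int ^ 'd) multiset) \<Rightarrow> bool" where
  "branching_random_walk a b Pr X \<longleftrightarrow>
     (\<forall>\<eta>. prob_space (Pr \<eta>)) \<and>
     (\<forall>\<eta>. \<forall>t\<ge>0. X t \<in> measurable (Pr \<eta>) (count_space UNIV)) \<and>
     (\<forall>\<eta>. AE \<omega> in Pr \<eta>. X 0 \<omega> = \<eta>) \<and>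
     (\<forall>\<eta> t s I c \<xi> \<zeta>. t \<ge> 0 \<longrightarrow> s \<ge> 0 \<longrightarrow> finite I \<longrightarrow> I \<subseteq> {0..t} \<longrightarrow>
        \<P>(\<omega> in Pr \<eta>. (\<forall>r\<in>I. X r \<omega> = c r) \<and> X t \<omega> = \<xi> \<and> X (t + s) \<omega> = \<zeta>) =
        \<P>(\<omega> in Pr \<eta>. (\<forall>r\<in>I. X r \<omega> = c r) \<and> X t \<omega> = \<xi>) * \<P>(\<omega> in Pr \<xi>. X s \<omega> = \<zeta>)) \<and>
     (\<forall>\<eta> \<xi>. \<forall>t\<ge>0.
        distr (Pr (\<eta> + \<xi>)) (count_space UNIV) (X t) =
        distr (Pr \<eta> \<Otimes>\<^sub>M Pr \<xi>) (count_space UNIV) (\<lambda>(\<omega>, \<omega>'). X t \<omega> + X t \<omega>')) \<and>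
     (\<forall>x y. x \<noteq> y \<longrightarrow>
        (\<lambda>h. \<P>(\<omega> in Pr {#x#}. X h \<omega> = {#y#}) - a x y * h) \<in> o[at_right 0](\<lambda>h. h)) \<and>
     (\<forall>x. (\<lambda>h. \<P>(\<omega> in Pr {#x#}. X h \<omega> = {#}) - b 0 * h) \<in> o[at_right 0](\<lambda>h. h)) \<and>
     (\<forall>n>1. (\<lambda>h. \<P>(\<omega> in Pr {#0#}. X h \<omega> = replicate_mset n 0) - b n * h)
        \<in> o[at_right 0](\<lambda>h. h)) \<and>
     (\<forall>x. (\<lambda>h. \<P>(\<omega> in Pr {#x#}. X h \<omega> = {#x#}) - (1 - exit_rate a b x * h))
        \<in> o[at_right 0](\<lambda>h. h))"

definition local_moment ::
  "((int ^ 'd) multiset \<Rightarrow> 'w measure) \<Rightarrow> (real \<Rightarrow> 'w \<Rightarrow> (int ^ 'd) multiset) \<Rightarrow>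
   nat \<Rightarrow> real \<Rightarrow> int ^ 'd \<Rightarrow> int ^ 'd \<Rightarrow> real" where
  "local_moment Pr X n t x y = (\<integral>\<omega>. real (count (X t \<omega>) y) ^ n \<partial>Pr {#x#})"

definition total_moment ::
  "((int ^ 'd) multiset \<Rightarrow> 'w measure) \<Rightarrow> (real \<Rightarrow> 'w \<Rightarrow> (int ^ 'd) multiset) \<Rightarrow>
   nat \<Rightarrow> real \<Rightarrow> int ^ 'd \<Rightarrow> real" where
  "total_moment Pr X n t x = (\<integral>\<omega>. real (size (X t \<omega>)) ^ n \<partial>Pr {#x#})"


section \<open>The operator \<open>\<A> + \<beta> \<Delta>\<^sub>0\<close> on \<open>l\<^sup>2\<close>\<close>

definition l2 :: "(int ^ 'd \<Rightarrow> real) set" where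
  "l2 = {\<phi>. (\<lambda>x. (\<phi> x)\<^sup>2) summable_on UNIV}"

definition walk_op ::
  "(int ^ 'd \<Rightarrow> int ^ 'd \<Rightarrow> real) \<Rightarrow> (int ^ 'd \<Rightarrow> real) \<Rightarrow> int ^ 'd \<Rightarrow> real" where
  "walk_op a \<phi> x = (\<Sum>\<^sub>\<infinity>y. a 0 (x - y) * \<phi> y)"

definition Delta0 :: "(int ^ 'd \<Rightarrow> real) \<Rightarrow> int ^ 'd \<Rightarrow> real" where
  "Delta0 \<phi> x = (if x = 0 then \<phi> 0 else 0)"

definition l2_eigenvalue ::
  "((int ^ 'd \<Rightarrow> real) \<Rightarrow> int ^ 'd \<Rightarrow> real) \<Rightarrow> real \<Rightarrow> bool" where
  "l2_eigenvalue T l \<longleftrightarrow> (\<exists>\<phi>\<in>l2. \<phi> \<noteq> (\<lambda>x. 0) \<and> T \<phi> = (\<lambda>x. l * \<phi> x))"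

text \<open>For a bounded operator bijectivity of \<open>T - l\<close> already gives a bounded inverse, and for the
  self-adjoint operators considered here the spectrum is real.\<close>

definition l2_spectrum ::
  "((int ^ 'd \<Rightarrow> real) \<Rightarrow> int ^ 'd \<Rightarrow> real) \<Rightarrow> real set" where
  "l2_spectrum T = {l. \<not> bij_betw (\<lambda>\<phi> x. T \<phi> x - l * \<phi> x) l2 l2}"

definition isolated_positive_eigenvalue ::
  "((int ^ 'd \<Rightarrow> real) \<Rightarrow> int ^ 'd \<Rightarrow> real) \<Rightarrow> real \<Rightarrow> bool" where
  "isolated_positive_eigenvalue T l \<longleftrightarrow>
     l > 0 \<and> l2_eigenvalue T l \<and> l isolated_in l2_spectrum T"

end

theory Submission
  imports Defs
begin

text \<open>
  Why the moments grow polynomially: write \<open>m n t x\<close> for the \<open>n\<close>-th moment, started from one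
  particle at \<open>x\<close>, of the number of particles at a fixed point, or of the total number of
  particles. Conditioning on the first short time step gives the moment equation
  \<open>m n' = E (m n) + \<delta>\<^sub>0 r n\<close>, where \<open>E\<close> is the evolution operator and \<open>r n\<close> is a positive
  combination of products of at least two lower moments at the origin whose orders add up to \<open>n\<close>.
  By Duhamel's formula \<open>m n\<close> is therefore the initial value transported by the semigroup of \<open>E\<close>,
  plus the convolution of \<open>r n\<close> with the kernel \<open>s t x 0\<close> of this semigroup
  (\<open>moment_eq_duhamel\<close>). The hypothesis that the leading eigenvalue of \<open>E\<close> is \<open>0\<close> makes
  \<open>s t x y\<close> converge to a positive limit. So \<open>m 1\<close> converges to a positive constant. If the lower
  moments satisfy \<open>m j \<sim> J j * t ^ (j - 1)\<close>, a product of \<open>k\<close> of them is of order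
  \<open>t ^ (n - k)\<close>; the terms with two factors dominate, \<open>r n \<sim> R * t ^ (n - 2)\<close> with \<open>R > 0\<close>, and integration
  against a kernel with a positive limit raises the exponent by one (\<open>real_moment_tendsto\<close>).

  Convergence of \<open>s t x y\<close> follows from symmetry and the existence of the eigenvector \<open>\<phi>\<close>. A minimum principle shows
  that the eigenvector can be taken strictly positive (\<open>ground_state_exists\<close>). Then \<open>\<phi>\<close> is invariant
  under the semigroup, and the Cauchy-Schwarz inequality with weight \<open>\<phi>\<close> makes the semigroup a
  contraction of \<open>l\<^sup>2\<close> (\<open>flow_contraction\<close>). Hence, with \<open>f = \<delta>\<^sub>x + \<delta>\<^sub>y\<close>, the quadratic form
  \<open>\<langle>f, s t f\<rangle> = \<parallel>s (t / 2) f\<parallel>\<^sup>2\<close> decreases in \<open>t\<close>, and polarisation gives the limit of every entry.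
  The limit is positive because \<open>s t x x * \<parallel>\<phi>\<parallel>\<^sup>2 \<ge> (\<phi> x)\<^sup>2\<close>, again by Cauchy-Schwarz, and because
  irreducibility carries positivity from the diagonal to all entries.

  The moment equation has to be derived for unbounded functions of a process that is only given by
  its Markov and branching properties and its behaviour in short times. For bounded
  functions the short-time behaviour, summed over all targets, yields a differentiable backward
  equation (\<open>mean_deriv\<close>). In integrated form all its terms are nonnegative, so it extends by
  monotone convergence to all nonnegative functions, with values in \<open>[0, \<infinity>]\<close> (\<open>backward_mild\<close>).
  Finiteness of the moments then follows by comparing the moments of the truncated counts
  \<open>min h N\<close>, which are bounded subsolutions, with the explicit Duhamel solution
  (\<open>mild_comparison\<close>). Semigroup and moments take values in the extended nonnegative reals, where
  sums and integrals may be interchanged freely.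
\<close>

section \<open>Sums over countable types\<close>

abbreviation count_space_sum :: "('a \<Rightarrow> ennreal) \<Rightarrow> ennreal" (binder \<open>\<Sum>\<^sup>+\<close> [61] 61) where
  "\<Sum>\<^sup>+x. f x \<equiv> nn_integral (count_space UNIV) f"

instance multiset :: (countable) countable
proof
  have "surj (mset :: 'a list \<Rightarrow> 'a multiset)" by (metis surjI ex_mset)
  then have "inj (\<lambda>M. to_nat (inv mset M :: 'a list))"
    by (metis (no_types, lifting) injI surj_f_inv_f to_nat_split)
  then show "\<exists>f :: 'a multiset \<Rightarrow> nat. inj f" by blast
qed

lemma has_sum_imp_nn_integral_count_space:
  fixes f :: "'a \<Rightarrow> real"
  assumes "(f has_sum s) A" and nonneg: "\<And>x. x \<in> A \<Longrightarrow> 0 \<le> f x"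
  shows "(\<integral>\<^sup>+x. ennreal (f x) \<partial>count_space A) = ennreal s"
proof -
  have "f summable_on A" using assms by (auto simp: summable_on_def)
  then have "Infinite_Sum.abs_summable_on f A"
    using nonneg summable_on_cong[of A f "\<lambda>x. norm (f x)"] by simp
  then have "Infinite_Set_Sum.abs_summable_on f A" by (simp only: abs_summable_equivalent)
  then have "integrable (count_space A) f" and "infsetsum f A = infsum f A"
    by (simp_all only: infsetsum_infsum Infinite_Set_Sum.abs_summable_on_def)
  then show ?thesis
    using assms nonneg by (subst nn_integral_eq_integral)
      (auto simp: AE_count_space infsetsum_def infsumI)
qed

lemma suminf_ennreal_sums:
  fixes f :: "nat \<Rightarrow> real"
  assumes "f sums s" "\<And>n. 0 \<le> f n" shows "(\<Sum>n. ennreal (f n)) = ennreal s"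
  using assms by (subst suminf_ennreal2) (auto simp: sums_iff)

lemma borel_measurable_nn_integral_countable:
  fixes f :: "'s \<Rightarrow> 'a::countable \<Rightarrow> ennreal"
  assumes "\<And>y. (\<lambda>s. f s y) \<in> borel_measurable N"
  shows "(\<lambda>s. \<Sum>\<^sup>+y. f s y) \<in> borel_measurable N"
proof -
  interpret sigma_finite_measure "count_space (UNIV::'a set)"
    by (rule sigma_finite_measure_count_space)
  have "(\<lambda>(y, s). f s y) \<in> borel_measurable (count_space UNIV \<Otimes>\<^sub>M N)"
    by (rule measurable_pair_measure_countable1) (use assms in auto)
  from measurable_pair_swap[OF this]
  have "(\<lambda>(s, y). f s y) \<in> borel_measurable (N \<Otimes>\<^sub>M count_space UNIV)"
    by (simp add: case_prod_beta)
  then show ?thesis by (rule borel_measurable_nn_integral)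
qed

lemma nn_integral_count_space_swap:
  fixes f :: "'a \<Rightarrow> 'b \<Rightarrow> ennreal"
  shows "(\<Sum>\<^sup>+x. \<Sum>\<^sup>+y. f x y) =
         (\<Sum>\<^sup>+y. \<Sum>\<^sup>+x. f x y)"
  using nn_integral_snd_count_space[of "\<lambda>(x, y). f x y"]
    nn_integral_fst_count_space[of "\<lambda>(x, y). f x y"] by simp

lemma nn_integral_swap_count_space_lborel:
  fixes f :: "real \<Rightarrow> 'a::countable \<Rightarrow> ennreal"
  assumes "\<And>y. (\<lambda>s. f s y) \<in> borel_measurable borel"
  shows "(\<integral>\<^sup>+s. \<Sum>\<^sup>+y. f s y \<partial>lborel) =
         (\<Sum>\<^sup>+y. \<integral>\<^sup>+s. f s y \<partial>lborel)"
proof -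
  interpret pair_sigma_finite lborel "count_space (UNIV::'a set)"
    by (intro pair_sigma_finite.intro sigma_finite_measure_count_space lborel.sigma_finite_measure_axioms)
  have "(\<lambda>(y, s). f s y) \<in> borel_measurable (count_space UNIV \<Otimes>\<^sub>M lborel)"
    by (rule measurable_pair_measure_countable1) (use assms in auto)
  from measurable_pair_swap[OF this]
  have "(\<lambda>(s, y). f s y) \<in> borel_measurable (lborel \<Otimes>\<^sub>M count_space UNIV)"
    by (simp add: case_prod_beta)
  then show ?thesis using Fubini[of "\<lambda>(s, y). f s y"] by simp
qed

lemma nn_integral_count_space_single:
  "(\<Sum>\<^sup>+y. f y * indicator {a} y) = f a"
  "(\<Sum>\<^sup>+y. indicator {a} y * f y) = f a"
  by (simp_all add: nn_integral_count_space_indicator[symmetric] mult.commute[of "indicator {a} _"]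
      nn_integral_count_space_finite) 

text \<open>
  The Cauchy product, by rearranging the double series along the diagonals.
\<close>

lemma suminf_triangle_ennreal:
  fixes F :: "nat \<Rightarrow> nat \<Rightarrow> ennreal"
  shows "(\<Sum>k. \<Sum>j. F k j) = (\<Sum>n. \<Sum>k\<le>n. F k (n - k))"
proof -
  have shift: "(\<Sum>j. F k j) = (\<Sum>n. if k \<le> n then F k (n - k) else 0)" for k
    by (subst suminf_offset[of "\<lambda>n. if k \<le> n then F k (n - k) else 0" k]) auto
  have "(\<Sum>k. \<Sum>j. F k j) = (\<Sum>k. \<Sum>n. if k \<le> n then F k (n - k) else 0)"
    by (simp add: shift)
  also have "\<dots> = (\<Sum>n. \<Sum>k. if k \<le> n then F k (n - k) else 0)"
    unfolding nn_integral_count_space_nat[symmetric] by (rule nn_integral_count_space_swap)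
  also have "\<dots> = (\<Sum>n. \<Sum>k\<le>n. F k (n - k))"
  proof (rule suminf_cong)
    fix n show "(\<Sum>k. if k \<le> n then F k (n - k) else 0) = (\<Sum>k\<le>n. F k (n - k))"
      by (subst suminf_finite[of "{..n}"]) auto
  qed
  finally show ?thesis .
qed

section \<open>The semigroup generated by a bounded nonnegative kernel\<close>

text \<open>
  A nonnegative matrix \<open>B\<close> with row sums at most \<open>M\<close>. The semigroup studied below is the one
  generated by \<open>B - c\<close>: splitting off the constant \<open>c\<close> leaves an exponential series with nonnegative
  terms only.
\<close>

locale bounded_kernel =
  fixes B :: "'a::countable \<Rightarrow> 'a \<Rightarrow> real" and c M :: real
  assumes B_nonneg: "0 \<le> B x y"
    and B_row_sum: "(\<Sum>\<^sup>+y. ennreal (B x y)) \<le> ennreal M"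
    and M_nonneg: "0 \<le> M"
    and c_nonneg: "0 \<le> c"
begin

definition app :: "('a \<Rightarrow> ennreal) \<Rightarrow> 'a \<Rightarrow> ennreal" where
  "app f x = (\<Sum>\<^sup>+y. ennreal (B x y) * f y)"

definition weight :: "real \<Rightarrow> nat \<Rightarrow> ennreal" where
  "weight t n = ennreal (exp (- c * t) * t ^ n / fact n)"

text \<open>
  The exponential series of \<open>t (B - c)\<close>, for \<open>t \<ge> 0\<close>.
\<close>

definition flow :: "real \<Rightarrow> ('a \<Rightarrow> ennreal) \<Rightarrow> 'a \<Rightarrow> ennreal" where
  "flow t f x = (\<Sum>n. weight t n * (app ^^ n) f x)"

definition kernel :: "real \<Rightarrow> 'a \<Rightarrow> 'a \<Rightarrow> ennreal" where
  "kernel t x y = flow t (indicator {y}) x"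

lemma weight_measurable [measurable]: "(\<lambda>t. weight t n) \<in> borel_measurable borel"
  unfolding weight_def by measurable

lemma flow_measurable [measurable]: "(\<lambda>t. flow t f x) \<in> borel_measurable borel"
  unfolding flow_def by measurable

lemma kernel_measurable [measurable]: "(\<lambda>t. kernel t x y) \<in> borel_measurable borel"
  unfolding kernel_def by measurable

lemma app_measurable [measurable]:
  "(\<And>y. (\<lambda>s. f s y) \<in> borel_measurable N) \<Longrightarrow> (\<lambda>s. app (f s) x) \<in> borel_measurable N"
  unfolding app_def by (rule borel_measurable_nn_integral_countable) auto

lemma app_mono: "(\<And>y. f y \<le> g y) \<Longrightarrow> app f x \<le> app g x"
  unfolding app_def by (intro nn_integral_mono mult_left_mono) auto

lemma app_add: "app (\<lambda>y. f y + g y) x = app f x + app g x"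
  unfolding app_def by (simp add: distrib_left nn_integral_add)

lemma app_cmult: "app (\<lambda>y. a * f y) x = a * app f x"
  unfolding app_def by (subst nn_integral_cmult[symmetric]) (auto simp: ac_simps)

lemma app_multc: "app (\<lambda>y. f y * a) x = app f x * a"
  unfolding app_def by (simp add: nn_integral_multc flip: mult.assoc)

lemma app_suminf: "app (\<lambda>y. \<Sum>n. f n y) x = (\<Sum>n::nat. app (f n) x)"
  unfolding app_def by (subst nn_integral_suminf[symmetric]) (auto simp: ennreal_suminf_cmult)

lemma app_const_le: "app (\<lambda>y. K) x \<le> ennreal M * K"
  unfolding app_def by (subst nn_integral_multc) (auto intro!: mult_right_mono B_row_sum)

lemma app_integral:
  fixes f :: "real \<Rightarrow> 'a \<Rightarrow> ennreal"
  assumes "\<And>y. (\<lambda>s. f s y) \<in> borel_measurable borel"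
  shows "app (\<lambda>y. \<integral>\<^sup>+s. f s y \<partial>lborel) x = (\<integral>\<^sup>+s. app (f s) x \<partial>lborel)"
proof -
  have "app (\<lambda>y. \<integral>\<^sup>+s. f s y \<partial>lborel) x = (\<Sum>\<^sup>+y. \<integral>\<^sup>+s. ennreal (B x y) * f s y \<partial>lborel)"
    unfolding app_def using assms by (simp add: nn_integral_cmult)
  also have "\<dots> = (\<integral>\<^sup>+s. app (f s) x \<partial>lborel)"
    unfolding app_def by (rule nn_integral_swap_count_space_lborel[symmetric]) (use assms in measurable)
  finally show ?thesis .
qed

lemma app_suminf_weighted: "app (\<lambda>y. \<Sum>n. a n * f n y) x = (\<Sum>n::nat. a n * app (f n) x)"
  by (simp add: app_suminf app_cmult)

lemma iter_suminf_weighted: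
  "(app ^^ k) (\<lambda>y. \<Sum>n. a n * f n y) = (\<lambda>x. \<Sum>n::nat. a n * (app ^^ k) (f n) x)"
  by (induction k) (auto simp: app_suminf_weighted)

lemma app_flow: "app (flow t f) x = (\<Sum>n. weight t n * (app ^^ Suc n) f x)"
  unfolding flow_def by (simp add: app_suminf_weighted)

text \<open>
  The Poisson weights arise from each other by the time integral occurring in the integrated
  equation; this is what makes the exponential series a solution of it.
\<close>

lemma weight_step:
  assumes "0 \<le> t"
  shows "(\<integral>\<^sup>+s\<in>{0..t}. ennreal (exp (- c * (t - s))) * weight s n \<partial>lborel) = weight t (Suc n)"
proof -
  have "(\<integral>\<^sup>+s\<in>{0..t}. ennreal (exp (- c * (t - s))) * weight s n \<partial>lborel) =
        (\<integral>\<^sup>+s\<in>{0..t}. ennreal (exp (- c * t) * s ^ n / fact n) \<partial>lborel)"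
  proof (rule nn_integral_cong)
    fix s
    have "exp (- c * (t - s)) * (exp (- c * s) * s ^ n / fact n) = exp (- c * t) * s ^ n / fact n"
      by (simp add: mult_exp_exp algebra_simps flip: mult.assoc)
    then show "ennreal (exp (- c * (t - s))) * weight s n * indicator {0..t} s =
      ennreal (exp (- c * t) * s ^ n / fact n) * indicator {0..t} s"
      by (auto simp: weight_def ennreal_mult[symmetric] split: split_indicator)
  qed
  also have "\<dots> = ennreal (exp (- c * t) * t ^ Suc n / fact (Suc n) - exp (- c * t) * 0 ^ Suc n / fact (Suc n))"
  proof (rule nn_integral_FTC_Icc)
    fix s assume "s \<in> {0..t}"
    show "((\<lambda>s. exp (- c * t) * s ^ Suc n / fact (Suc n)) has_real_derivative
        exp (- c * t) * s ^ n / fact n) (at s)"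
      by (rule derivative_eq_intros refl | simp add: field_simps del: of_nat_Suc)+
  qed (use assms in auto)
  also have "\<dots> = weight t (Suc n)"
    by (simp add: weight_def)
  finally show ?thesis .
qed

text \<open>
  The integrated form of \<open>u' = (B - c) u\<close>, obtained termwise from \<open>weight_step\<close>.
\<close>

lemma flow_mild:
  assumes "0 \<le> t"
  shows "flow t f x = ennreal (exp (- c * t)) * f x +
    (\<integral>\<^sup>+s\<in>{0..t}. ennreal (exp (- c * (t - s))) * app (flow s f) x \<partial>lborel)"
proof -
  have "(\<integral>\<^sup>+s\<in>{0..t}. ennreal (exp (- c * (t - s))) * app (flow s f) x \<partial>lborel) =
    (\<integral>\<^sup>+s. (\<Sum>n. (app ^^ Suc n) f x * ((ennreal (exp (- c * (t - s))) * weight s n) * indicator {0..t} s)) \<partial>lborel)"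
    unfolding app_flow by (simp add: ac_simps flip: ennreal_suminf_cmult)
  also have "\<dots> = (\<Sum>n. (app ^^ Suc n) f x * weight t (Suc n))"
    by (subst nn_integral_suminf, measurable, subst nn_integral_cmult, measurable)
      (simp only: weight_step[OF assms])
  also have "ennreal (exp (- c * t)) * f x + \<dots> = flow t f x"
    unfolding flow_def
    by (subst (2) suminf_offset[of _ 1]) (auto simp: weight_def ac_simps)
  finally show ?thesis by simp
qed

lemma app_le_const:
  assumes "\<And>y. f y \<le> K" shows "app f x \<le> ennreal M * K"
  using app_mono[of f "\<lambda>_. K" x] app_const_le[of K x] assms by (auto intro: order_trans)

lemma iter_bounded:
  assumes "\<And>y. f y \<le> ennreal K" "0 \<le> K"
  shows "(app ^^ n) f x \<le> ennreal (K * M ^ n)"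
proof (induction n arbitrary: x)
  case (Suc n)
  then show ?case using app_le_const[of "(app ^^ n) f" "ennreal (K * M ^ n)" x] M_nonneg assms
    by (auto simp: ennreal_mult[symmetric] ac_simps)
qed (use assms in auto)

lemma flow_bounded:
  assumes "\<And>y. f y \<le> ennreal K" "0 \<le> K" "0 \<le> t"
  shows "flow t f x \<le> ennreal (K * exp (M * t))"
proof -
  have it: "(app ^^ n) f x \<le> ennreal (K * M ^ n)" for n
    by (rule iter_bounded[of f K, OF assms(1,2)])
  have sums: "(\<lambda>n. K * exp (- c * t) * ((M * t) ^ n / fact n)) sums (K * exp (- c * t) * exp (M * t))"
    using exp_converges[of "M * t"] by (intro sums_mult) (simp add: field_simps)
  have "flow t f x \<le> (\<Sum>n. ennreal (K * exp (- c * t) * ((M * t) ^ n / fact n)))"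
    unfolding flow_def
  proof (intro suminf_le allI)
    fix n
    have "weight t n * (app ^^ n) f x \<le> weight t n * ennreal (K * M ^ n)"
      by (intro mult_left_mono it) auto
    also have "\<dots> = ennreal (K * exp (- c * t) * ((M * t) ^ n / fact n))"
      using assms M_nonneg by (simp add: weight_def ennreal_mult[symmetric] field_simps power_mult_distrib)
    finally show "weight t n * (app ^^ n) f x \<le> ennreal (K * exp (- c * t) * ((M * t) ^ n / fact n))" .
  qed auto
  also have "\<dots> = ennreal (K * exp (- c * t) * exp (M * t))"
    using sums assms M_nonneg by (subst suminf_ennreal2) (auto simp: sums_iff)
  also have "\<dots> \<le> ennreal (K * exp (M * t))"
    using assms c_nonneg by (intro ennreal_leI mult_right_mono mult_left_le) auto
  finally show ?thesis .
qed

lemma kernel_bounded: "0 \<le> t \<Longrightarrow> kernel t x y \<le> ennreal (exp (M * t))"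
  unfolding kernel_def using flow_bounded[of "indicator {y}" 1 t x] by (auto simp: indicator_def)

lemma iter_kernel:
  "(app ^^ n) f x = (\<Sum>\<^sup>+y. (app ^^ n) (indicator {y}) x * f y)"
proof (induction n arbitrary: x)
  case 0
  show ?case
    using nn_integral_count_space_single(2)[of x f] by (simp add: indicator_def eq_commute)
next
  case (Suc n)
  have "(app ^^ Suc n) f x = (\<Sum>\<^sup>+z. \<Sum>\<^sup>+y. ennreal (B x z) * (app ^^ n) (indicator {y}) z * f y)"
    by (simp add: app_def[of "(app ^^ n) f"] Suc flip: nn_integral_cmult) (simp add: ac_simps)
  also have "\<dots> = (\<Sum>\<^sup>+y. \<Sum>\<^sup>+z. ennreal (B x z) * (app ^^ n) (indicator {y}) z * f y)"
    by (rule nn_integral_count_space_swap)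
  also have "\<dots> = (\<Sum>\<^sup>+y. (app ^^ Suc n) (indicator {y}) x * f y)"
    by (simp add: app_def[of "(app ^^ n) _"] nn_integral_multc)
  finally show ?case .
qed

lemma flow_kernel: "flow t f x = (\<Sum>\<^sup>+y. kernel t x y * f y)"
proof -
  have "flow t f x = (\<Sum>n. \<Sum>\<^sup>+y. weight t n * (app ^^ n) (indicator {y}) x * f y)"
    unfolding flow_def
    by (subst iter_kernel[of _ f]) (simp add: mult.assoc flip: nn_integral_cmult)
  also have "\<dots> = (\<Sum>\<^sup>+y. (\<Sum>n. weight t n * (app ^^ n) (indicator {y}) x * f y))"
    by (subst nn_integral_suminf) auto
  also have "\<dots> = (\<Sum>\<^sup>+y. kernel t x y * f y)"
    by (simp add: kernel_def flow_def ennreal_suminf_multc)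
  finally show ?thesis .
qed

lemma weight_convolution:
  assumes "0 \<le> t" "0 \<le> u"
  shows "(\<Sum>k\<le>n. weight t k * weight u (n - k)) = weight (t + u) n"
proof -
  have "(\<Sum>k\<le>n. weight t k * weight u (n - k)) =
    ennreal (\<Sum>k\<le>n. (exp (- c * t) * t ^ k / fact k) * (exp (- c * u) * u ^ (n - k) / fact (n - k)))"
    using assms by (simp add: weight_def ennreal_mult[symmetric])
  also have "(\<Sum>k\<le>n. (exp (- c * t) * t ^ k / fact k) * (exp (- c * u) * u ^ (n - k) / fact (n - k))) =
    exp (- c * (t + u)) / fact n * (\<Sum>k\<le>n. of_nat (n choose k) * t ^ k * u ^ (n - k))"
    unfolding sum_distrib_left
  proof (intro sum.cong refl)
    fix k assume "k \<in> {..n}"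
    have "exp (- c * (t + u)) = exp (- c * t) * exp (- c * u)"
      by (simp add: mult_exp_exp algebra_simps)
    moreover have "real (n choose k) = fact n / (fact k * fact (n - k))"
      using \<open>k \<in> {..n}\<close> by (simp add: binomial_fact)
    ultimately show "(exp (- c * t) * t ^ k / fact k) * (exp (- c * u) * u ^ (n - k) / fact (n - k)) =
      exp (- c * (t + u)) / fact n * (of_nat (n choose k) * t ^ k * u ^ (n - k))"
      by simp
  qed
  also have "\<dots> = exp (- c * (t + u)) * (t + u) ^ n / fact n"
    by (simp add: binomial_ring)
  finally show ?thesis by (simp add: weight_def)
qed

lemma iter_iter: "(app ^^ k) ((app ^^ n) f) x = (app ^^ (k + n)) f x"
  by (simp add: funpow_add)

text \<open>
  Both sides are rearrangements of the same double series; the binomial theorem collects the weights.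
\<close>

lemma flow_flow:
  assumes "0 \<le> t" "0 \<le> u"
  shows "flow t (flow u f) x = flow (t + u) f x"
proof -
  have "flow t (flow u f) x =
    (\<Sum>k. \<Sum>n. weight t k * (weight u n * (app ^^ k) ((app ^^ n) f) x))"
    unfolding flow_def[of t] flow_def[of u, abs_def] iter_suminf_weighted
    by (simp flip: ennreal_suminf_cmult)
  also have "\<dots> = (\<Sum>n. \<Sum>k\<le>n. weight t k * (weight u (n - k) * (app ^^ n) f x))"
    unfolding iter_iter by (subst suminf_triangle_ennreal) simp
  also have "\<dots> = (\<Sum>n. weight (t + u) n * (app ^^ n) f x)"
    by (simp add: weight_convolution[OF assms, symmetric] sum_distrib_right mult.assoc)
  finally show ?thesis by (simp add: flow_def)
qed

lemma kernel_chapman_kolmogorov: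
  assumes "0 \<le> t" "0 \<le> u"
  shows "kernel (t + u) x y = (\<Sum>\<^sup>+z. kernel t x z * kernel u z y)"
  unfolding kernel_def[of "t + u"] flow_flow[OF assms, symmetric] flow_kernel[of t]
  by (simp add: kernel_def[of u])

lemma kernel_ge_kernel_mult:
  assumes "0 \<le> t" "0 \<le> u" shows "kernel t x z * kernel u z y \<le> kernel (t + u) x y"
proof -
  have "kernel t x z * kernel u z y = (\<Sum>\<^sup>+w. (kernel t x w * kernel u w y) * indicator {z} w)"
    by (simp only: nn_integral_count_space_single)
  also have "\<dots> \<le> kernel (t + u) x y"
    unfolding kernel_chapman_kolmogorov[OF assms] by (intro nn_integral_mono) (auto simp: indicator_def)
  finally show ?thesis .
qed

text \<open>
  A bounded subsolution of the integrated equation lies below every supersolution. If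
  \<open>m \<le> v + D exp (L s)\<close> holds on \<open>[0, T]\<close>, inserting this bound into the equation improves
  \<open>D\<close> to \<open>D / 2\<close> as soon as \<open>L\<close> exceeds \<open>2 M\<close>; iteration gives \<open>m \<le> v\<close>. The statement serves twice:
  it bounds the truncated moments, and it identifies the moments with the Duhamel solution.
\<close>

lemma mild_comparison:
  fixes m v g :: "real \<Rightarrow> 'a \<Rightarrow> ennreal"
  assumes sub: "\<And>t x. 0 \<le> t \<Longrightarrow> t \<le> T \<Longrightarrow> m t x \<le> g t x +
      (\<integral>\<^sup>+s\<in>{0..t}. ennreal (exp (- c * (t - s))) * app (m s) x \<partial>lborel)"
    and super: "\<And>t x. 0 \<le> t \<Longrightarrow> t \<le> T \<Longrightarrow> g t x +
      (\<integral>\<^sup>+s\<in>{0..t}. ennreal (exp (- c * (t - s))) * app (v s) x \<partial>lborel) \<le> v t x"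
    and [measurable]: "\<And>x. (\<lambda>t. v t x) \<in> borel_measurable borel"
    and bound: "\<And>t x. 0 \<le> t \<Longrightarrow> t \<le> T \<Longrightarrow> m t x \<le> ennreal K"
    and t: "0 \<le> t" "t \<le> T"
  shows "m t x \<le> v t x"
proof -
  \<comment> \<open>With this exponent one application of the integral operator halves the error.\<close>
  define L where "L = 2 * M + 1"
  define K' where "K' = max K 0"
  have L: "L > 0" "M / L \<le> 1 / 2" using M_nonneg by (auto simp: L_def field_simps)
  have K': "0 \<le> K'" "ennreal K = ennreal K'"
    by (auto simp: K'_def max_def ennreal_neg)
  have step: "m t x \<le> v t x + ennreal (K' * (1/2) ^ n * exp (L * t))" if "0 \<le> t" "t \<le> T" for n t x
    using that
  proof (induction n arbitrary: t x)
    case 0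
    have "m t x \<le> ennreal K'" using bound[OF 0] K' by simp
    also have "\<dots> \<le> ennreal (K' * exp (L * t))"
      using 0 L K' by (intro ennreal_leI) (simp add: mult_le_cancel_left1)
    finally show ?case by (simp add: add_increasing)
  next
    case (Suc n)
    let ?e = "\<lambda>s. ennreal (exp (- c * (t - s)))"
    let ?R = "\<lambda>s. K' * (1/2) ^ n * exp (L * s)"
    have "(\<integral>\<^sup>+s\<in>{0..t}. ?e s * app (m s) x \<partial>lborel) \<le>
      (\<integral>\<^sup>+s. (?e s * app (v s) x) * indicator {0..t} s + ennreal (M * ?R s) * indicator {0..t} s \<partial>lborel)"
    proof (intro nn_integral_mono)
      fix s
      show "?e s * app (m s) x * indicator {0..t} s
        \<le> (?e s * app (v s) x) * indicator {0..t} s + ennreal (M * ?R s) * indicator {0..t} s"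
      proof (cases "s \<in> {0..t}")
        case True
        have "app (m s) x \<le> app (\<lambda>y. v s y + ennreal (?R s)) x"
          using True Suc by (intro app_mono) auto
        also have "\<dots> \<le> app (v s) x + ennreal (M * ?R s)"
          using app_const_le[of "ennreal (?R s)" x] M_nonneg K'
          by (simp add: app_add ennreal_mult)
        finally have "?e s * app (m s) x \<le> ?e s * (app (v s) x + ennreal (M * ?R s))"
          by (intro mult_left_mono) auto
        also have "\<dots> = ?e s * app (v s) x + ?e s * ennreal (M * ?R s)"
          by (simp add: distrib_left)
        also have "?e s * ennreal (M * ?R s) \<le> 1 * ennreal (M * ?R s)"
          using True c_nonneg by (intro mult_right_mono) (auto simp: mult_nonneg_nonneg)
        finally show ?thesis using True by (simp add: add_left_mono)
      qed auto
    qed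
    also have "\<dots> = (\<integral>\<^sup>+s\<in>{0..t}. ?e s * app (v s) x \<partial>lborel) + (\<integral>\<^sup>+s\<in>{0..t}. ennreal (M * ?R s) \<partial>lborel)"
      by (subst nn_integral_add) auto
    also have "(\<integral>\<^sup>+s\<in>{0..t}. ennreal (M * ?R s) \<partial>lborel) = ennreal (M / L * ?R t - M / L * ?R 0)"
      by (rule nn_integral_FTC_Icc)
        (use L M_nonneg K' Suc.prems in \<open>auto intro!: derivative_eq_intros\<close>)
    also have "\<dots> \<le> ennreal (K' * (1/2) ^ Suc n * exp (L * t))"
    proof (intro ennreal_leI)
      have "M / L * ?R t - M / L * ?R 0 \<le> M / L * ?R t" using L M_nonneg K' by simp
      also have "\<dots> \<le> 1/2 * ?R t" by (intro mult_right_mono L) (use K' in auto)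
      finally show "M / L * ?R t - M / L * ?R 0 \<le> K' * (1/2) ^ Suc n * exp (L * t)" by simp
    qed
    finally have *: "(\<integral>\<^sup>+s\<in>{0..t}. ?e s * app (m s) x \<partial>lborel) \<le>
      (\<integral>\<^sup>+s\<in>{0..t}. ?e s * app (v s) x \<partial>lborel) + ennreal (K' * (1/2) ^ Suc n * exp (L * t))"
      by (simp add: add_left_mono)
    have "m t x \<le> g t x + (\<integral>\<^sup>+s\<in>{0..t}. ?e s * app (m s) x \<partial>lborel)"
      using sub Suc.prems by blast
    also have "\<dots> \<le> g t x + ((\<integral>\<^sup>+s\<in>{0..t}. ?e s * app (v s) x \<partial>lborel) + ennreal (K' * (1/2) ^ Suc n * exp (L * t)))"
      by (intro add_left_mono *)
    also have "\<dots> \<le> v t x + ennreal (K' * (1/2) ^ Suc n * exp (L * t))"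
      using super[OF Suc.prems, of x] by (simp add: add_right_mono flip: add.assoc)
    finally show ?case .
  qed
  have "(\<lambda>n. K' * (1/2) ^ n * exp (L * t)) \<longlonglongrightarrow> K' * 0 * exp (L * t)"
    by (intro tendsto_intros) simp
  then have "(\<lambda>n. v t x + ennreal (K' * (1/2) ^ n * exp (L * t))) \<longlonglongrightarrow> v t x + ennreal (K' * 0 * exp (L * t))"
    by (intro tendsto_add tendsto_const tendsto_ennrealI)
  then show ?thesis
    by (intro LIMSEQ_le_const[of _ "v t x" "m t x"]) (use step t in auto)
qed

text \<open>
  The solution with initial value \<open>f\<close> and a source of strength \<open>r\<close> concentrated at \<open>z\<close>.
\<close>

definition duhamel :: "'a \<Rightarrow> ('a \<Rightarrow> ennreal) \<Rightarrow> (real \<Rightarrow> ennreal) \<Rightarrow> real \<Rightarrow> 'a \<Rightarrow> ennreal" where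
  "duhamel z f r t x = flow t f x + (\<integral>\<^sup>+u\<in>{0..t}. kernel (t - u) x z * r u \<partial>lborel)"

lemma duhamel_measurable [measurable]:
  assumes [measurable]: "r \<in> borel_measurable borel"
  shows "(\<lambda>t. duhamel z f r t x) \<in> borel_measurable borel"
proof -
  have [measurable]: "Measurable.pred (borel \<Otimes>\<^sub>M lborel) (\<lambda>x. snd x \<in> {0..fst x::real})"
    unfolding atLeastAtMost_iff by measurable
  show ?thesis unfolding duhamel_def by measurable
qed

text \<open>
  By Tonelli the contribution of the source emitted at time \<open>u\<close> can be followed separately; it is the
  flow started at time \<open>u\<close> from the point mass at \<open>z\<close>, which satisfies \<open>flow_mild\<close>.
\<close>

lemma duhamel_mild:
  assumes r [measurable]: "r \<in> borel_measurable borel" and t: "0 \<le> t"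
  shows "duhamel z f r t x =
    ennreal (exp (- c * t)) * f x +
      (\<integral>\<^sup>+s\<in>{0..t}. ennreal (exp (- c * (t - s))) * (indicator {z} x * r s) \<partial>lborel) +
    (\<integral>\<^sup>+s\<in>{0..t}. ennreal (exp (- c * (t - s))) * app (duhamel z f r s) x \<partial>lborel)"
proof -
  let ?e = "\<lambda>s. ennreal (exp (- c * (t - s)))"
  have [measurable]: "Measurable.pred (borel \<Otimes>\<^sub>M lborel) (\<lambda>x. snd x \<in> {0..fst x::real})"
    unfolding atLeastAtMost_iff by measurable
  have [measurable]: "Measurable.pred (lborel \<Otimes>\<^sub>M lborel) (\<lambda>x. snd x \<in> {0..fst x::real})"
    unfolding atLeastAtMost_iff by measurable
  have [measurable]: "Measurable.pred (lborel \<Otimes>\<^sub>M lborel) (\<lambda>x. fst x \<in> {0..snd x::real})"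
    unfolding atLeastAtMost_iff by measurable
  have app_split: "app (duhamel z f r s) x = app (flow s f) x +
     (\<integral>\<^sup>+u\<in>{0..s}. app (\<lambda>y. kernel (s - u) y z) x * r u \<partial>lborel)" for s
  proof -
    have "app (\<lambda>y. \<integral>\<^sup>+u\<in>{0..s}. kernel (s - u) y z * r u \<partial>lborel) x =
       (\<integral>\<^sup>+u. app (\<lambda>y. kernel (s - u) y z * r u * indicator {0..s} u) x \<partial>lborel)"
      by (rule app_integral) measurable
    also have "\<dots> = (\<integral>\<^sup>+u\<in>{0..s}. app (\<lambda>y. kernel (s - u) y z) x * r u \<partial>lborel)"
      by (simp only: app_multc)
    finally show ?thesis unfolding duhamel_def by (simp add: app_add)
  qed
  let ?I = "\<lambda>u. \<integral>\<^sup>+s. ?e s * app (\<lambda>y. kernel (s - u) y z) x * r u * indicator {0..s} u * indicator {0..t} s \<partial>lborel"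
  \<comment> \<open>The contribution of the source emitted at the fixed time \<open>u\<close>.\<close>
  have inner: "?I u
      + ?e u * (indicator {z} x * r u) * indicator {0..t} u = kernel (t - u) x z * r u * indicator {0..t} u" for u
  proof (cases "u \<in> {0..t}")
    case True
    have "(\<integral>\<^sup>+s. ?e s * app (\<lambda>y. kernel (s - u) y z) x * r u * indicator {0..s} u * indicator {0..t} s \<partial>lborel)
       = (\<integral>\<^sup>+s. r u * ((ennreal (exp (- c * (t - u - s))) * app (flow s (indicator {z})) x) * indicator {0..t - u} s) \<partial>lborel)"
    proof (subst nn_integral_real_affine[where c = 1 and t = u])
      have [measurable]: "Measurable.pred borel (\<lambda>s. u \<in> {0..s})"
        unfolding atLeastAtMost_iff by measurable
      show "(\<lambda>s. ?e s * app (\<lambda>y. kernel (s - u) y z) x * r u * indicator {0..s} u * indicator {0..t} s) \<in> borel_measurable borel"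
        by measurable
    qed (use True in \<open>auto intro!: nn_integral_cong simp: kernel_def algebra_simps split: split_indicator\<close>)
    also have "\<dots> = r u * (\<integral>\<^sup>+s\<in>{0..t - u}. ennreal (exp (- c * (t - u - s))) * app (flow s (indicator {z})) x \<partial>lborel)"
      by (rule nn_integral_cmult) measurable
    finally show ?thesis using flow_mild[of "t - u" "indicator {z}" x] True
      by (simp add: kernel_def distrib_left distrib_right ac_simps)
  next
    case False
    then have *: "?e s * app (\<lambda>y. kernel (s - u) y z) x * r u * indicator {0..s} u * indicator {0..t} s = 0" for s
      by (auto split: split_indicator)
    show ?thesis unfolding * using False by simp
  qed
  have "(\<integral>\<^sup>+s\<in>{0..t}. ?e s * app (duhamel z f r s) x \<partial>lborel) =
     (\<integral>\<^sup>+s\<in>{0..t}. ?e s * app (flow s f) x \<partial>lborel) +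
     (\<integral>\<^sup>+s\<in>{0..t}. ?e s * (\<integral>\<^sup>+u\<in>{0..s}. app (\<lambda>y. kernel (s - u) y z) x * r u \<partial>lborel) \<partial>lborel)"
    unfolding app_split distrib_left distrib_right
    by (rule nn_integral_add) measurable
  also have "(\<integral>\<^sup>+s\<in>{0..t}. ?e s * (\<integral>\<^sup>+u\<in>{0..s}. app (\<lambda>y. kernel (s - u) y z) x * r u \<partial>lborel) \<partial>lborel) =
     (\<integral>\<^sup>+s. \<integral>\<^sup>+u. ?e s * app (\<lambda>y. kernel (s - u) y z) x * r u * indicator {0..s} u * indicator {0..t} s \<partial>lborel \<partial>lborel)"
    by (intro nn_integral_cong) (simp add: ac_simps flip: nn_integral_cmult)
  also have "\<dots> = (\<integral>\<^sup>+u. \<integral>\<^sup>+s. ?e s * app (\<lambda>y. kernel (s - u) y z) x * r u * indicator {0..s} u * indicator {0..t} s \<partial>lborel \<partial>lborel)"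
    by (rule lborel_pair.Fubini') measurable
  finally have split: "(\<integral>\<^sup>+s\<in>{0..t}. ?e s * app (duhamel z f r s) x \<partial>lborel) =
     (\<integral>\<^sup>+s\<in>{0..t}. ?e s * app (flow s f) x \<partial>lborel) + (\<integral>\<^sup>+u. ?I u \<partial>lborel)" .
  have "(\<integral>\<^sup>+u. ?I u + ?e u * (indicator {z} x * r u) * indicator {0..t} u \<partial>lborel) =
     (\<integral>\<^sup>+u. ?I u \<partial>lborel) + (\<integral>\<^sup>+u\<in>{0..t}. ?e u * (indicator {z} x * r u) \<partial>lborel)"
    by (rule nn_integral_add) measurable
  then show ?thesis
    unfolding inner split duhamel_def[of z f r t] flow_mild[OF t, of f]
    by (simp only: ac_simps)
qed

lemma duhamel_bounded:
  assumes "\<And>y. f y \<le> ennreal K" "0 \<le> K" and r: "\<And>s. 0 \<le> s \<Longrightarrow> s \<le> T \<Longrightarrow> r s \<le> ennreal R" "0 \<le> R"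
    and t: "0 \<le> t" "t \<le> T"
  shows "duhamel z f r t x \<le> ennreal (K * exp (M * T) + T * exp (M * T) * R)"
proof -
  have "(\<integral>\<^sup>+u\<in>{0..t}. kernel (t - u) x z * r u \<partial>lborel) \<le> (\<integral>\<^sup>+u\<in>{0..t}. ennreal (exp (M * T) * R) \<partial>lborel)"
  proof (intro nn_integral_mono)
    fix u show "kernel (t - u) x z * r u * indicator {0..t} u \<le> ennreal (exp (M * T) * R) * indicator {0..t} u"
    proof (cases "u \<in> {0..t}")
      case True
      have "kernel (t - u) x z \<le> ennreal (exp (M * T))"
        using kernel_bounded[of "t - u" x z] True t M_nonneg
        by (auto elim!: order_trans intro!: ennreal_leI mult_left_mono)
      then have "kernel (t - u) x z * r u \<le> ennreal (exp (M * T)) * ennreal R"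
        using True t by (intro mult_mono r) auto
      then show ?thesis using True r by (simp add: ennreal_mult)
    qed auto
  qed
  also have "\<dots> = ennreal (t * (exp (M * T) * R))"
    using t r by (subst nn_integral_cmult_indicator) (auto simp: ennreal_mult ac_simps)
  also have "\<dots> \<le> ennreal (T * exp (M * T) * R)"
    using t r by (auto intro!: ennreal_leI mult_right_mono simp: mult.assoc)
  finally have 1: "(\<integral>\<^sup>+u\<in>{0..t}. kernel (t - u) x z * r u \<partial>lborel) \<le> ennreal (T * exp (M * T) * R)" .
  have "flow t f x \<le> ennreal (K * exp (M * t))" by (rule flow_bounded) (use assms in auto)
  also have "\<dots> \<le> ennreal (K * exp (M * T))"
    using t M_nonneg assms by (intro ennreal_leI mult_left_mono) (auto intro!: mult_left_mono)
  finally show ?thesis using 1 t r assms unfolding duhamel_def by (subst ennreal_plus) (auto intro: add_mono)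
qed

end

context bounded_kernel
begin

lemma kernel_finite [simp]: "0 \<le> t \<Longrightarrow> kernel t x y < top"
  using kernel_bounded[of t x y] by (rule le_less_trans) auto

lemma flow_add: "flow t (\<lambda>y. f y + g y) x = flow t f x + flow t g x"
  unfolding flow_kernel by (simp add: distrib_left nn_integral_add)

lemma flow_cmult: "flow t (\<lambda>y. a * f y) x = a * flow t f x"
  unfolding flow_kernel by (subst nn_integral_cmult[symmetric]) (auto simp: ac_simps)

text \<open>
  For bounded \<open>f\<close> the flow is \<open>exp (- c t)\<close> times an everywhere convergent power series, which may be
  differentiated termwise. Here the generator is applied to \<open>f\<close>, not to the flow; this is the form in
  which the generator is evaluated on constants below.
\<close>

lemma flow_deriv:
  fixes f :: "'a \<Rightarrow> ennreal"
  assumes f: "\<And>y. f y \<le> ennreal K" "0 \<le> K" and t: "0 < t"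
  shows "((\<lambda>t. enn2real (flow t f x)) has_real_derivative
    enn2real (flow t (app f) x) - c * enn2real (flow t f x)) (at t)"
proof -
  have series: "summable (\<lambda>n. enn2real ((app ^^ n) h x) / fact n * u ^ n)"
    "0 \<le> u \<Longrightarrow> enn2real (flow u h x) = exp (- c * u) * (\<Sum>n. enn2real ((app ^^ n) h x) / fact n * u ^ n)"
    if h: "\<And>y. h y \<le> ennreal C" "0 \<le> C" for h C and u :: real
  proof -
    have le: "enn2real ((app ^^ n) h x) \<le> C * M ^ n" for n
      using iter_bounded[of h C n x, OF h] h M_nonneg by (intro enn2real_leI) auto
    show s: "summable (\<lambda>n. enn2real ((app ^^ n) h x) / fact n * u ^ n)" for u :: real
    proof (rule summable_comparison_test)
      show "summable (\<lambda>n. C * ((M * \<bar>u\<bar>) ^ n / fact n))"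
        using summable_exp[of "M * \<bar>u\<bar>"] by (intro summable_mult) (simp add: field_simps)
      have "norm (enn2real ((app ^^ n) h x) / fact n * u ^ n) \<le> C * ((M * \<bar>u\<bar>) ^ n / fact n)" for n
        using mult_right_mono[OF le[of n], of "\<bar>u\<bar> ^ n / fact n"]
        by (simp add: abs_mult power_abs power_mult_distrib field_simps)
      then show "\<exists>N. \<forall>n\<ge>N. norm (enn2real ((app ^^ n) h x) / fact n * u ^ n) \<le> C * ((M * \<bar>u\<bar>) ^ n / fact n)"
        by blast
    qed
    assume u: "0 \<le> u"
    have "flow u h x = (\<Sum>n. ennreal (exp (- c * u) * (enn2real ((app ^^ n) h x) / fact n * u ^ n)))"
      unfolding flow_def
    proof (rule suminf_cong)
      fix n
      have "(app ^^ n) h x = ennreal (enn2real ((app ^^ n) h x))"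
        using le_less_trans[OF iter_bounded[of h C n x, OF h] ennreal_less_top] by simp
      moreover have "weight u n * ennreal A = ennreal (exp (- c * u) * (A / fact n * u ^ n))" if "0 \<le> A" for A
        using u that by (simp add: weight_def ennreal_mult''[symmetric] ac_simps)
      ultimately show "weight u n * (app ^^ n) h x = ennreal (exp (- c * u) * (enn2real ((app ^^ n) h x) / fact n * u ^ n))"
        by (metis enn2real_nonneg)
    qed
    also have "\<dots> = ennreal (exp (- c * u) * (\<Sum>n. enn2real ((app ^^ n) h x) / fact n * u ^ n))"
      using u by (subst suminf_ennreal2, simp, intro summable_mult s, subst suminf_mult[OF s]) simp
    finally show "enn2real (flow u h x) = exp (- c * u) * (\<Sum>n. enn2real ((app ^^ n) h x) / fact n * u ^ n)"
      using u s by (simp add: suminf_nonneg)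
  qed
  let ?P = "\<lambda>h u. \<Sum>n. enn2real ((app ^^ n) h x) / fact n * u ^ n"
  have af: "app f y \<le> ennreal (M * K)" for y
    using app_le_const[of f "ennreal K" y, OF f(1)] f M_nonneg by (simp add: ennreal_mult)
  have "((\<lambda>u. ?P f u) has_real_derivative (\<Sum>n. diffs (\<lambda>n. enn2real ((app ^^ n) f x) / fact n) n * t ^ n)) (at t)"
    by (rule termdiffs_strong_converges_everywhere) (rule series(1)[OF f])
  also have "(\<lambda>n. diffs (\<lambda>n. enn2real ((app ^^ n) f x) / fact n) n * t ^ n) =
     (\<lambda>n. enn2real ((app ^^ n) (app f) x) / fact n * t ^ n)"
    by (simp add: diffs_def funpow_swap1 field_simps fun_eq_iff del: of_nat_Suc)
  finally have "((\<lambda>u. exp (- c * u) * ?P f u) has_real_derivative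
      exp (- c * t) * ?P (app f) t - c * (exp (- c * t) * ?P f t)) (at t)"
    by (auto intro!: derivative_eq_intros)
  then have "((\<lambda>u. exp (- c * u) * ?P f u) has_real_derivative
      enn2real (flow t (app f) x) - c * enn2real (flow t f x)) (at t)"
    using series(2)[OF f, of t] series(2)[OF af, of t] t M_nonneg f by simp
  moreover have "\<forall>\<^sub>F u in nhds t. enn2real (flow u f x) = exp (- c * u) * ?P f u"
    using eventually_nhds_in_open[of "{0<..}" t] t
    by (auto elim!: eventually_mono simp: series(2)[OF f])
  ultimately show ?thesis by (subst DERIV_cong_ev) auto
qed

end

section \<open>Convergence of the semigroup in the presence of a ground state\<close>

lemma antimono_bounded_tendsto_at_top:
  fixes f :: "real \<Rightarrow> real"
  assumes anti: "\<And>s t. 0 \<le> s \<Longrightarrow> s \<le> t \<Longrightarrow> f t \<le> f s" and nonneg: "\<And>t. 0 \<le> t \<Longrightarrow> 0 \<le> f t"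
  shows "\<exists>l. (f \<longlongrightarrow> l) at_top"
proof
  have bdd: "bdd_below (f ` {0..})" using nonneg by (auto intro!: bdd_belowI2[where m = 0])
  show "(f \<longlongrightarrow> (INF t\<in>{0..}. f t)) at_top"
  proof (rule decreasing_tendsto)
    show "\<forall>\<^sub>F t in at_top. (INF t\<in>{0..}. f t) \<le> f t"
      using eventually_ge_at_top[of 0] by eventually_elim (rule cINF_lower[OF bdd], simp)
    fix x assume "(INF t\<in>{0..}. f t) < x"
    then obtain s where s: "s \<in> {0..}" "f s < x"
      using cINF_less_iff[of "{0..}" f x] bdd by auto
    show "\<forall>\<^sub>F t in at_top. f t < x"
      using eventually_ge_at_top[of s] by eventually_elim (rule le_less_trans[OF anti s(2)], use s in auto)
  qed
qed

text \<open>
  The function \<open>\<phi>\<close> is a positive square-summable eigenvector of the generator \<open>B - c\<close> for the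
  eigenvalue \<open>0\<close>.
\<close>

locale symmetric_ground_state_kernel = bounded_kernel +
  fixes \<phi> :: "'a \<Rightarrow> real"
  assumes B_sym: "B x y = B y x"
    and ground_pos: "0 < \<phi> x"
    and ground_eigen: "(\<Sum>\<^sup>+y. ennreal (B x y) * ennreal (\<phi> y)) = ennreal (c * \<phi> x)"
    and ground_l2: "(\<Sum>\<^sup>+y. ennreal ((\<phi> y)\<^sup>2)) < top"
    and irreducible: "(\<lambda>x y. 0 < B x y)\<^sup>*\<^sup>* x y"
begin

lemma iter_indicator_sym: "(app ^^ n) (indicator {y}) x = (app ^^ n) (indicator {x}) y"
proof (induction n arbitrary: x y)
  case (Suc n)
  have B: "app (indicator {y}) z = ennreal (B y z)" for z
    unfolding app_def nn_integral_count_space_single by (rule arg_cong[OF B_sym])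
  have "(app ^^ Suc n) (indicator {y}) x = (\<Sum>\<^sup>+z. (app ^^ n) (indicator {z}) x * ennreal (B y z))"
    by (subst funpow_Suc_right, subst o_apply, subst iter_kernel) (simp add: B)
  also have "\<dots> = (app ^^ Suc n) (indicator {x}) y"
    by (simp add: app_def[of "(app ^^ n) _"] Suc[of _ x] mult.commute)
  finally show ?case .
qed (auto simp: indicator_def)

lemma kernel_sym: "kernel t x y = kernel t y x"
  unfolding kernel_def flow_def iter_indicator_sym[of _ y x] ..

lemma flow_ground:
  assumes "0 \<le> t" shows "flow t \<phi> x = ennreal (\<phi> x)"
proof -
  have it: "(app ^^ n) \<phi> x = ennreal (c ^ n * \<phi> x)" for n x
  proof (induction n arbitrary: x)
    case (Suc n)
    have "(app ^^ n) \<phi> = (\<lambda>y. ennreal (c ^ n) * ennreal (\<phi> y))"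
      using Suc c_nonneg less_imp_le[OF ground_pos] by (simp add: ennreal_mult fun_eq_iff)
    then have "(app ^^ Suc n) \<phi> x = app (\<lambda>y. ennreal (c ^ n) * ennreal (\<phi> y)) x"
      by simp
    also have "\<dots> = ennreal (c ^ n) * ennreal (c * \<phi> x)"
      unfolding app_cmult by (simp add: app_def ground_eigen)
    finally show ?case using c_nonneg ground_pos[of x] by (simp add: ennreal_mult[symmetric] ac_simps)
  qed auto
  have sums: "(\<lambda>n. exp (- c * t) * \<phi> x * ((c * t) ^ n / fact n)) sums (exp (- c * t) * \<phi> x * exp (c * t))"
    using exp_converges[of "c * t"] by (intro sums_mult) (simp add: field_simps)
  have "flow t \<phi> x = (\<Sum>n. ennreal (exp (- c * t) * \<phi> x * ((c * t) ^ n / fact n)))"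
    unfolding flow_def it weight_def using assms c_nonneg ground_pos[of x]
    by (intro suminf_cong) (simp add: ennreal_mult[symmetric] field_simps power_mult_distrib)
  also have "\<dots> = ennreal (exp (- c * t) * \<phi> x * exp (c * t))"
    using sums assms c_nonneg ground_pos[of x] by (subst suminf_ennreal2) (auto simp: sums_iff)
  also have "exp (- c * t) * \<phi> x * exp (c * t) = \<phi> x"
    by (simp add: exp_minus)
  finally show ?thesis .
qed

text \<open>
  Schur's test. Writing \<open>s g = sqrt (s \<phi>) * (sqrt (s / \<phi>) g)\<close> for the entries \<open>s\<close> of the kernel, the
  Cauchy-Schwarz inequality and the invariance of \<open>\<phi>\<close> bound the square of the flow at \<open>x\<close> by
  \<open>\<phi> x\<close> times the flow of \<open>g\<^sup>2 / \<phi>\<close>. Summing over \<open>x\<close> and using the invariance once more, now in the other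
  variable by symmetry, cancels both factors.
\<close>

lemma flow_contraction:
  assumes t: "0 \<le> t"
  shows "(\<Sum>\<^sup>+x. (flow t g x)\<^sup>2) \<le> (\<Sum>\<^sup>+x. (g x)\<^sup>2)"
proof -
  define k where "k x y = enn2real (kernel t x y)" for x y
  have k: "kernel t x y = ennreal (k x y)" "0 \<le> k x y" for x y
    using t by (auto simp: k_def)
  have k_sym: "k x y = k y x" for x y by (simp add: k_def kernel_sym[of t x y])
  have pt: "(flow t g x)\<^sup>2 \<le> (\<Sum>\<^sup>+y. ennreal (\<phi> x * k x y / \<phi> y) * (g y)\<^sup>2)" for x
  proof -
    have "(flow t g x)\<^sup>2 = (\<Sum>\<^sup>+y. ennreal (sqrt (k x y * \<phi> y)) * (ennreal (sqrt (k x y / \<phi> y)) * g y))\<^sup>2"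
    proof -
      have "kernel t x y = ennreal (sqrt (k x y * \<phi> y)) * ennreal (sqrt (k x y / \<phi> y))" for y
        using k ground_pos[of y] by (simp add: ennreal_mult[symmetric] real_sqrt_mult[symmetric])
      then show ?thesis by (simp add: flow_kernel mult.assoc)
    qed
    also have "\<dots> \<le> (\<Sum>\<^sup>+y. (ennreal (sqrt (k x y * \<phi> y)))\<^sup>2) *
      (\<Sum>\<^sup>+y. (ennreal (sqrt (k x y / \<phi> y)) * g y)\<^sup>2)"
      by (rule Cauchy_Schwarz_nn_integral) auto
    also have "(\<Sum>\<^sup>+y. (ennreal (sqrt (k x y * \<phi> y)))\<^sup>2) = flow t \<phi> x"
      using k ground_pos by (simp add: flow_kernel ennreal_power ennreal_mult[symmetric] less_imp_le)
    also have "\<dots> = ennreal (\<phi> x)" by (rule flow_ground[OF t])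
    also have "ennreal (\<phi> x) * (\<Sum>\<^sup>+y. (ennreal (sqrt (k x y / \<phi> y)) * g y)\<^sup>2) =
       (\<Sum>\<^sup>+y. ennreal (\<phi> x * k x y / \<phi> y) * (g y)\<^sup>2)"
      using k ground_pos
      by (subst nn_integral_cmult[symmetric])
        (auto simp: power_mult_distrib ennreal_power less_imp_le ennreal_mult[symmetric] mult.assoc[symmetric]
           intro!: nn_integral_cong)
    finally show ?thesis .
  qed
  have "(\<Sum>\<^sup>+x. (flow t g x)\<^sup>2) \<le>
     (\<Sum>\<^sup>+x. \<Sum>\<^sup>+y. ennreal (\<phi> x * k x y / \<phi> y) * (g y)\<^sup>2)"
    by (intro nn_integral_mono pt)
  also have "\<dots> = (\<Sum>\<^sup>+y. \<Sum>\<^sup>+x. ennreal (\<phi> x * k x y / \<phi> y) * (g y)\<^sup>2)"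
    by (rule nn_integral_count_space_swap)
  also have "\<dots> = (\<Sum>\<^sup>+y. (g y)\<^sup>2)"
  proof (intro nn_integral_cong)
    fix y
    have "(\<Sum>\<^sup>+x. ennreal (\<phi> x * k x y / \<phi> y) * (g y)\<^sup>2) =
      (\<Sum>\<^sup>+x. ennreal (1 / \<phi> y) * (kernel t y x * ennreal (\<phi> x))) * (g y)\<^sup>2"
    proof (subst nn_integral_multc)
      have "ennreal (\<phi> x * k x y / \<phi> y) = ennreal (1 / \<phi> y) * (kernel t y x * ennreal (\<phi> x))" for x
        using k(2) ground_pos[of y] less_imp_le[OF ground_pos[of x]]
        by (simp add: k(1) k_sym[of x y] ennreal_mult[symmetric] ac_simps)
      then show "(\<Sum>\<^sup>+x. ennreal (\<phi> x * k x y / \<phi> y)) * (g y)\<^sup>2 =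
        (\<Sum>\<^sup>+x. ennreal (1 / \<phi> y) * (kernel t y x * ennreal (\<phi> x))) * (g y)\<^sup>2"
        by simp
    qed auto
    also have "(\<Sum>\<^sup>+x. ennreal (1 / \<phi> y) * (kernel t y x * ennreal (\<phi> x))) = ennreal (1 / \<phi> y) * flow t \<phi> y"
      unfolding flow_kernel by (rule nn_integral_cmult) auto
    also have "\<dots> = 1"
      using ground_pos[of y] by (simp add: flow_ground[OF t] ennreal_mult[symmetric])
    finally show "(\<Sum>\<^sup>+x. ennreal (\<phi> x * k x y / \<phi> y) * (g y)\<^sup>2) = (g y)\<^sup>2" by simp
  qed
  finally show ?thesis .
qed

text \<open>
  The expression is \<open>\<langle>f, s t f\<rangle>\<close> for \<open>f = \<delta>\<^sub>x + \<delta>\<^sub>y\<close>; by symmetry and the semigroup property it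
  equals the squared norm of the flow of \<open>f\<close> at time \<open>t / 2\<close>, which cannot increase.
\<close>

lemma polarised_kernel_antimono:
  assumes "0 \<le> s" "s \<le> t"
  shows "kernel t x x + 2 * kernel t x y + kernel t y y \<le> kernel s x x + 2 * kernel s x y + kernel s y y"
proof -
  have norm: "(\<Sum>\<^sup>+z. (kernel u x z + kernel u y z)\<^sup>2) =
      kernel (2 * u) x x + 2 * kernel (2 * u) x y + kernel (2 * u) y y" if "0 \<le> u" for u
  proof -
    have ck: "kernel (2 * u) a b = (\<Sum>\<^sup>+z. kernel u a z * kernel u b z)" for a b
      using kernel_chapman_kolmogorov[OF that that, of a b] by (simp add: kernel_sym[of u b])
    have sq: "(p + q)\<^sup>2 = p * p + 2 * (p * q) + q * q" for p q :: ennreal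
    proof -
      have "2 * (p * q) = p * q + p * q" by (rule mult_2)
      then show ?thesis by (simp only: power2_eq_square distrib_left distrib_right ac_simps)
    qed
    have "(\<Sum>\<^sup>+z. (kernel u x z + kernel u y z)\<^sup>2) =
      (\<Sum>\<^sup>+z. kernel u x z * kernel u x z + 2 * (kernel u x z * kernel u y z)) +
      (\<Sum>\<^sup>+z. kernel u y z * kernel u y z)"
      unfolding sq by (rule nn_integral_add) auto
    also have "(\<Sum>\<^sup>+z. kernel u x z * kernel u x z + 2 * (kernel u x z * kernel u y z)) =
      (\<Sum>\<^sup>+z. kernel u x z * kernel u x z) +
      (\<Sum>\<^sup>+z. 2 * (kernel u x z * kernel u y z))"
      by (rule nn_integral_add) auto
    also have "(\<Sum>\<^sup>+z. 2 * (kernel u x z * kernel u y z)) =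
      2 * (\<Sum>\<^sup>+z. kernel u x z * kernel u y z)"
      by (rule nn_integral_cmult) auto
    finally show ?thesis unfolding ck .
  qed
  have shift: "kernel (t / 2) a z = flow ((t - s) / 2) (kernel (s / 2) a) z" for a z
  proof -
    have "kernel (t / 2) a z = kernel ((t - s) / 2 + s / 2) z a"
      by (subst kernel_sym) (simp add: diff_divide_distrib)
    also have "\<dots> = flow ((t - s) / 2) (kernel (s / 2) a) z"
      using assms unfolding flow_kernel
      by (subst kernel_chapman_kolmogorov) (auto simp: kernel_sym[of "s / 2" a])
    finally show ?thesis .
  qed
  have "kernel t x x + 2 * kernel t x y + kernel t y y =
    (\<Sum>\<^sup>+z. (flow ((t - s) / 2) (\<lambda>w. kernel (s / 2) x w + kernel (s / 2) y w) z)\<^sup>2)"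
    using norm[of "t / 2"] assms unfolding shift by (simp add: flow_add)
  also have "\<dots> \<le> (\<Sum>\<^sup>+z. (kernel (s / 2) x z + kernel (s / 2) y z)\<^sup>2)"
    by (rule flow_contraction) (use assms in simp)
  also have "\<dots> = kernel s x x + 2 * kernel s x y + kernel s y y"
    using norm[of "s / 2"] assms by simp
  finally show ?thesis .
qed

definition kernel_limit :: "'a \<Rightarrow> 'a \<Rightarrow> real" where
  "kernel_limit x y = Lim at_top (\<lambda>t. enn2real (kernel t x y))"

text \<open>
  Monotonicity of the quadratic form gives convergence on the diagonal and, by polarisation, everywhere.
\<close>

lemma kernel_tendsto: "((\<lambda>t. enn2real (kernel t x y)) \<longlongrightarrow> kernel_limit x y) at_top"
proof -
  let ?k = "\<lambda>x y t. enn2real (kernel t x y)"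
  have conv: "\<exists>l. ((\<lambda>t. ?k x x t + 2 * ?k x y t + ?k y y t) \<longlongrightarrow> l) at_top" for x y
  proof (rule antimono_bounded_tendsto_at_top)
    fix s t :: real assume st: "0 \<le> s" "s \<le> t"
    have r: "kernel u x x + 2 * kernel u x y + kernel u y y = ennreal (?k x x u + 2 * ?k x y u + ?k y y u)"
      if "0 \<le> u" for u
    proof -
      have "ennreal (?k x x u + 2 * ?k x y u + ?k y y u) = ennreal (?k x x u) + ennreal (2 * ?k x y u) + ennreal (?k y y u)"
        by (subst ennreal_plus, simp, simp, subst ennreal_plus) auto
      also have "ennreal (2 * ?k x y u) = 2 * ennreal (?k x y u)"
        by (subst ennreal_mult) auto
      finally have eq: "ennreal (?k x x u + 2 * ?k x y u + ?k y y u) =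
        ennreal (?k x x u) + 2 * ennreal (?k x y u) + ennreal (?k y y u)" .
      have kk: "ennreal (?k a b u) = kernel u a b" for a b using that by simp
      show ?thesis using eq by (simp only: kk)
    qed
    show "?k x x t + 2 * ?k x y t + ?k y y t \<le> ?k x x s + 2 * ?k x y s + ?k y y s"
    proof -
      have "ennreal (?k x x t + 2 * ?k x y t + ?k y y t) \<le> ennreal (?k x x s + 2 * ?k x y s + ?k y y s)"
        using polarised_kernel_antimono[OF st, of x y] by (simp only: r[OF st(1)] r[OF order_trans[OF st]])
      then show ?thesis by (rule iffD1[OF ennreal_le_iff, rotated]) simp
    qed
  qed auto
  have diag: "\<exists>l. (?k x x \<longlongrightarrow> l) at_top" for x
  proof -
    obtain l where "((\<lambda>t. ?k x x t + 2 * ?k x x t + ?k x x t) \<longlongrightarrow> l) at_top" using conv by blast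
    from tendsto_mult[OF this tendsto_const[of "1/4"]] show ?thesis by (auto simp: algebra_simps)
  qed
  obtain l lx ly where l: "((\<lambda>t. ?k x x t + 2 * ?k x y t + ?k y y t) \<longlongrightarrow> l) at_top"
    "(?k x x \<longlongrightarrow> lx) at_top" "(?k y y \<longlongrightarrow> ly) at_top"
    using conv diag by blast
  have "((\<lambda>t. ((?k x x t + 2 * ?k x y t + ?k y y t) - ?k x x t - ?k y y t) * (1 / 2)) \<longlongrightarrow> (l - lx - ly) * (1 / 2)) at_top"
    by (intro tendsto_intros l)
  then have "(?k x y \<longlongrightarrow> (l - lx - ly) * (1 / 2)) at_top" by simp
  then show ?thesis unfolding kernel_limit_def by (simp add: tendsto_Lim)
qed

text \<open>
  Some power of the matrix connects the two points, and every power occurs in the exponential series.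
\<close>

lemma kernel_pos: "0 < kernel 1 x y"
proof -
  have "\<exists>n. 0 < (app ^^ n) (indicator {y}) x"
    using irreducible[of x y]
  proof (induction rule: converse_rtranclp_induct)
    case base
    show ?case by (rule exI[of _ 0]) simp
  next
    case (step x z)
    then obtain n where n: "0 < (app ^^ n) (indicator {y}) z" by blast
    have "0 < ennreal (B x z) * (app ^^ n) (indicator {y}) z"
      using n step by (simp add: ennreal_zero_less_mult_iff)
    also have "\<dots> = (\<Sum>\<^sup>+w. (ennreal (B x w) * (app ^^ n) (indicator {y}) w) * indicator {z} w)"
      by (simp only: nn_integral_count_space_single)
    also have "\<dots> \<le> (\<Sum>\<^sup>+w. ennreal (B x w) * (app ^^ n) (indicator {y}) w)"
      by (intro nn_integral_mono) (auto simp: indicator_def)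
    also have "\<dots> = (app ^^ Suc n) (indicator {y}) x"
      by (simp add: app_def[of "(app ^^ n) _"])
    finally show ?case by blast
  qed
  then obtain n where "0 < (app ^^ n) (indicator {y}) x" by blast
  then have "0 < weight 1 n * (app ^^ n) (indicator {y}) x"
    by (simp add: ennreal_zero_less_mult_iff weight_def)
  also have "\<dots> \<le> kernel 1 x y"
    unfolding kernel_def flow_def
    using sum_le_suminf[of "\<lambda>n. weight 1 n * (app ^^ n) (indicator {y}) x" "{n}"] by auto
  finally show ?thesis .
qed

text \<open>
  On the diagonal, \<open>\<phi> x\<close> is the flow of \<open>\<phi>\<close>, so that Cauchy-Schwarz bounds \<open>(\<phi> x)\<^sup>2\<close> by
  \<open>kernel t x x\<close> times the squared norm of \<open>\<phi>\<close>, uniformly in \<open>t\<close>. Away from the diagonal, the last unit of time is used to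
  move from \<open>x\<close> to \<open>y\<close>.
\<close>

lemma kernel_limit_pos: "0 < kernel_limit x y"
proof -
  let ?k = "\<lambda>x y t. enn2real (kernel t x y)"
  define N where "N = enn2real (\<Sum>\<^sup>+y. ennreal ((\<phi> y)\<^sup>2))"
  have N: "(\<Sum>\<^sup>+y. ennreal ((\<phi> y)\<^sup>2)) = ennreal N" "0 \<le> N"
    using ground_l2 by (auto simp: N_def)
  \<comment> \<open>A lower bound for the diagonal that does not depend on \<open>t\<close>.\<close>
  have low: "(\<phi> x)\<^sup>2 \<le> ?k x x t * N" if "0 \<le> t" for t
  proof -
    have "ennreal ((\<phi> x)\<^sup>2) = (flow (t / 2) \<phi> x)\<^sup>2"
      using that ground_pos[of x] by (simp add: flow_ground ennreal_power)
    also have "\<dots> = (\<Sum>\<^sup>+z. kernel (t / 2) x z * ennreal (\<phi> z))\<^sup>2"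
      by (simp add: flow_kernel)
    also have "\<dots> \<le> (\<Sum>\<^sup>+z. (kernel (t / 2) x z)\<^sup>2) * (\<Sum>\<^sup>+z. (ennreal (\<phi> z))\<^sup>2)"
      by (rule Cauchy_Schwarz_nn_integral) auto
    also have "(\<Sum>\<^sup>+z. (ennreal (\<phi> z))\<^sup>2) = ennreal N"
      using ground_pos by (simp add: N(1)[symmetric] ennreal_power less_imp_le)
    also have "(\<Sum>\<^sup>+z. (kernel (t / 2) x z)\<^sup>2) = kernel t x x"
    proof -
      have "kernel (t / 2) z x = kernel (t / 2) x z" for z by (rule kernel_sym)
      then show ?thesis
        using kernel_chapman_kolmogorov[of "t / 2" "t / 2" x x] that by (simp add: power2_eq_square)
    qed
    also have "kernel t x x * ennreal N = ennreal (?k x x t * N)"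
      using that N by (simp add: ennreal_mult)
    finally show ?thesis by (rule iffD1[OF ennreal_le_iff, rotated]) (use N in simp)
  qed
  have "(\<phi> x)\<^sup>2 \<le> kernel_limit x x * N"
    by (rule tendsto_le[OF _ tendsto_mult[OF kernel_tendsto tendsto_const] tendsto_const])
      (auto intro!: eventually_mono[OF eventually_ge_at_top[of 0]] low)
  then have diag: "0 < kernel_limit x x"
    using ground_pos[of x] N by (metis less_le_not_le linorder_not_less mult_nonpos_nonneg order.strict_trans2 zero_less_power)
  have one: "0 < ?k x y 1"
    using kernel_pos[of x y] by (simp add: enn2real_positive_iff)
  have "kernel_limit x x * ?k x y 1 \<le> kernel_limit x y"
  proof (rule tendsto_le[OF _ _ tendsto_mult[OF kernel_tendsto tendsto_const]])
    show "((\<lambda>t. ?k x y (t + 1)) \<longlongrightarrow> kernel_limit x y) at_top"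
      by (rule filterlim_compose[OF kernel_tendsto]) (rule filterlim_at_top_mono[OF filterlim_ident], simp)
    have "?k x x t * ?k x y 1 \<le> ?k x y (t + 1)" if "0 \<le> t" for t
      using enn2real_mono[OF kernel_ge_kernel_mult[of t 1 x x y]] that by (simp add: enn2real_mult)
    then show "\<forall>\<^sub>F t in at_top. ?k x x t * ?k x y 1 \<le> ?k x y (t + 1)"
      by (intro eventually_mono[OF eventually_ge_at_top[of 0]])
  qed auto
  then show ?thesis using diag one by (meson mult_pos_pos order.strict_trans2)
qed

text \<open>
  The constant function is not square-summable. But the row-sum condition says that the generator
  maps \<open>1\<close> to \<open>\<beta> \<delta>\<^sub>z - (c - \<gamma>) 1\<close>, so the flow \<open>w\<close> of \<open>1\<close> solves the scalar equation
  \<open>w' = \<beta> s t x z - (c - \<gamma>) w\<close>, and l'Hospital's rule applied to \<open>exp ((c - \<gamma>) t) w\<close> over \<open>exp ((c - \<gamma>) t)\<close> gives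
  the limit.
\<close>

lemma flow_one_tendsto:
  assumes row: "\<And>x. app (\<lambda>_. 1) x = ennreal \<gamma> + ennreal \<beta> * indicator {z} x"
    and g: "0 \<le> \<gamma>" "\<gamma> < c" "0 \<le> \<beta>"
  shows "((\<lambda>t. enn2real (flow t (\<lambda>_. 1) x)) \<longlongrightarrow> \<beta> * kernel_limit x z / (c - \<gamma>)) at_top"
proof -
  let ?w = "\<lambda>t. enn2real (flow t (\<lambda>_. 1) x)" and ?k = "\<lambda>t. enn2real (kernel t x z)"
  define b where "b = c - \<gamma>"
  have b: "0 < b" using g by (simp add: b_def)
  have fin: "flow t (\<lambda>_. 1) x < top" if "0 \<le> t" for t
    by (rule le_less_trans[OF flow_bounded[of "\<lambda>_. 1" 1 t x] ennreal_less_top]) (use that in auto)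
  have deriv: "(?w has_real_derivative \<beta> * ?k t - b * ?w t) (at t)" if "0 < t" for t
  proof -
    have "flow t (app (\<lambda>_. 1)) x = ennreal \<gamma> * flow t (\<lambda>_. 1) x + ennreal \<beta> * kernel t x z"
    proof -
      have "app (\<lambda>_. 1) = (\<lambda>y. ennreal \<gamma> * 1 + ennreal \<beta> * indicator {z} y)"
        using row by (simp add: fun_eq_iff)
      then show ?thesis by (simp only: flow_add flow_cmult kernel_def)
    qed
    then have "enn2real (flow t (app (\<lambda>_. 1)) x) =
        enn2real (ennreal \<gamma> * flow t (\<lambda>_. 1) x) + enn2real (ennreal \<beta> * kernel t x z)"
      using that fin[of t] by (simp add: enn2real_plus ennreal_mult_less_top)
    also have "\<dots> = \<gamma> * ?w t + \<beta> * ?k t"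
      using g by (simp add: enn2real_mult)
    finally have "enn2real (flow t (app (\<lambda>_. 1)) x) = \<gamma> * ?w t + \<beta> * ?k t" .
    moreover have "\<gamma> * ?w t + \<beta> * ?k t - c * ?w t = \<beta> * ?k t - b * ?w t"
      by (simp add: b_def algebra_simps)
    moreover have "(?w has_real_derivative enn2real (flow t (app (\<lambda>_. 1)) x) - c * ?w t) (at t)"
      by (rule flow_deriv[of _ 1]) (use that in auto)
    ultimately show ?thesis by (simp only:)
  qed
  have "((\<lambda>t. exp (b * t) * ?w t / exp (b * t)) \<longlongrightarrow> \<beta> * kernel_limit x z / b) at_top"
  proof (rule lhospital_at_top_at_top[where f = "\<lambda>t. exp (b * t) * ?w t" and g = "\<lambda>t. exp (b * t)"
      and f' = "\<lambda>t. exp (b * t) * (\<beta> * ?k t)" and g' = "\<lambda>t. exp (b * t) * b"])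
    show "LIM t at_top. exp (b * t) :> at_top"
      by (rule filterlim_compose[OF exp_at_top filterlim_tendsto_pos_mult_at_top[OF tendsto_const b filterlim_ident]])
    show "\<forall>\<^sub>F t in at_top. ((\<lambda>t. exp (b * t) * ?w t) has_real_derivative exp (b * t) * (\<beta> * ?k t)) (at t)"
      using eventually_gt_at_top[of 0]
    proof eventually_elim
      fix t :: real assume "0 < t"
      have "((\<lambda>t. exp (b * t)) has_real_derivative exp (b * t) * b) (at t)"
        by (auto intro!: derivative_eq_intros)
      from DERIV_mult[OF this deriv[OF \<open>0 < t\<close>]]
      show "((\<lambda>t. exp (b * t) * ?w t) has_real_derivative exp (b * t) * (\<beta> * ?k t)) (at t)"
        by (rule DERIV_cong) (simp add: algebra_simps)
    qed
    show "\<forall>\<^sub>F t in at_top. ((\<lambda>t. exp (b * t)) has_real_derivative exp (b * t) * b) (at t)"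
      by (intro always_eventually allI) (auto intro!: derivative_eq_intros)
    have "((\<lambda>t. \<beta> * ?k t / b) \<longlongrightarrow> \<beta> * kernel_limit x z / b) at_top"
      by (intro tendsto_intros kernel_tendsto) (use b in auto)
    moreover have "exp (b * t) * (\<beta> * ?k t) / (exp (b * t) * b) = \<beta> * ?k t / b" for t
      by (subst mult_divide_mult_cancel_left) auto
    ultimately show "((\<lambda>t. exp (b * t) * (\<beta> * ?k t) / (exp (b * t) * b)) \<longlongrightarrow> \<beta> * kernel_limit x z / b) at_top"
      by (simp only:)
    show "\<forall>\<^sub>F t in at_top. exp (b * t) * b \<noteq> 0" using b by simp
  qed
  moreover have "exp (b * t) * ?w t / exp (b * t) = ?w t" for t by simp
  ultimately show ?thesis by (simp only: b_def)
qed

end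

section \<open>The laws of the branching walk as a Markov semigroup\<close>

locale branching_walk =
  fixes a :: "int ^ 'd \<Rightarrow> int ^ 'd \<Rightarrow> real" and b :: "nat \<Rightarrow> real"
    and Pr :: "(int ^ 'd) multiset \<Rightarrow> 'w measure"
    and X :: "real \<Rightarrow> 'w \<Rightarrow> (int ^ 'd) multiset"
  assumes walk: "walk_intensity a"
    and branching: "branching_intensity b"
    and process: "branching_random_walk a b Pr X"
begin

lemma prob_space_Pr: "prob_space (Pr \<eta>)"
  and X_measurable: "0 \<le> t \<Longrightarrow> X t \<in> measurable (Pr \<eta>) (count_space UNIV)"
  and X_start: "AE \<omega> in Pr \<eta>. X 0 \<omega> = \<eta>"
  using process by (auto simp: branching_random_walk_def)

lemma X_markov:
  "0 \<le> t \<Longrightarrow> 0 \<le> s \<Longrightarrow> measure (Pr \<eta>) {\<omega> \<in> space (Pr \<eta>). X t \<omega> = \<xi> \<and> X (t + s) \<omega> = \<zeta>} =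
   measure (Pr \<eta>) {\<omega> \<in> space (Pr \<eta>). X t \<omega> = \<xi>} * measure (Pr \<xi>) {\<omega> \<in> space (Pr \<xi>). X s \<omega> = \<zeta>}"
proof -
  assume ts: "0 \<le> t" "0 \<le> s"
  have "\<forall>\<eta> t s I c \<xi> \<zeta>. t \<ge> 0 \<longrightarrow> s \<ge> 0 \<longrightarrow> finite I \<longrightarrow> I \<subseteq> {0..t} \<longrightarrow>
        \<P>(\<omega> in Pr \<eta>. (\<forall>r\<in>I. X r \<omega> = c r) \<and> X t \<omega> = \<xi> \<and> X (t + s) \<omega> = \<zeta>) =
        \<P>(\<omega> in Pr \<eta>. (\<forall>r\<in>I. X r \<omega> = c r) \<and> X t \<omega> = \<xi>) * \<P>(\<omega> in Pr \<xi>. X s \<omega> = \<zeta>)"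
    using process unfolding branching_random_walk_def by (elim conjE)
  from this[rule_format, OF ts, of "{}"] show ?thesis by simp
qed

lemma X_branching:
  "0 \<le> t \<Longrightarrow> distr (Pr (\<eta> + \<xi>)) (count_space UNIV) (X t) =
    distr (Pr \<eta> \<Otimes>\<^sub>M Pr \<xi>) (count_space UNIV) (\<lambda>(\<omega>, \<omega>'). X t \<omega> + X t \<omega>')"
  using process unfolding branching_random_walk_def by blast

text \<open>
  Negative times are clipped to \<open>0\<close>, so that functions of time are defined on the whole line and can
  be treated as continuous and Borel measurable there.
\<close>

definition law :: "real \<Rightarrow> (int ^ 'd) multiset \<Rightarrow> (int ^ 'd) multiset pmf" where
  "law t \<eta> = embed_pmf (\<lambda>\<xi>. measure (Pr \<eta>) {\<omega> \<in> space (Pr \<eta>). X (max 0 t) \<omega> = \<xi>})"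

lemma emeasure_X: "0 \<le> t \<Longrightarrow> emeasure (distr (Pr \<eta>) (count_space UNIV) (X t)) {\<xi>} =
    ennreal (measure (Pr \<eta>) {\<omega> \<in> space (Pr \<eta>). X t \<omega> = \<xi>})"
proof -
  assume [measurable]: "0 \<le> t"
  interpret prob_space "Pr \<eta>" by (rule prob_space_Pr)
  have "X t -` {\<xi>} \<inter> space (Pr \<eta>) = {\<omega> \<in> space (Pr \<eta>). X t \<omega> = \<xi>}" by auto
  then show ?thesis
    by (subst emeasure_distr) (auto simp: X_measurable \<open>0 \<le> t\<close> emeasure_eq_measure)
qed

lemma pmf_law: "pmf (law t \<eta>) \<xi> = measure (Pr \<eta>) {\<omega> \<in> space (Pr \<eta>). X (max 0 t) \<omega> = \<xi>}"
  unfolding law_def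
proof (rule pmf_embed_pmf)
  interpret D: prob_space "distr (Pr \<eta>) (count_space UNIV) (X (max 0 t))"
    by (rule prob_space.prob_space_distr[OF prob_space_Pr X_measurable]) simp
  have "(\<Sum>\<^sup>+\<xi>. ennreal (measure (Pr \<eta>) {\<omega> \<in> space (Pr \<eta>). X (max 0 t) \<omega> = \<xi>})) =
    (\<Sum>\<^sup>+\<xi>. emeasure (distr (Pr \<eta>) (count_space UNIV) (X (max 0 t))) {\<xi>})"
    by (simp add: emeasure_X)
  also have "\<dots> = emeasure (distr (Pr \<eta>) (count_space UNIV) (X (max 0 t))) UNIV"
    by (subst emeasure_countable_singleton) auto
  also have "\<dots> = 1" using D.emeasure_space_1 by simp
  finally show "(\<Sum>\<^sup>+\<xi>. ennreal (measure (Pr \<eta>) {\<omega> \<in> space (Pr \<eta>). X (max 0 t) \<omega> = \<xi>})) = 1" .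
qed simp

lemma measure_law: "0 \<le> t \<Longrightarrow> measure_pmf (law t \<eta>) = distr (Pr \<eta>) (count_space UNIV) (X t)"
  by (rule measure_eqI_countable[where A = UNIV])
    (auto simp: emeasure_pmf_single pmf_law emeasure_X)

lemma nn_integral_law:
  "0 \<le> t \<Longrightarrow> (\<integral>\<^sup>+\<xi>. f \<xi> \<partial>law t \<eta>) = (\<integral>\<^sup>+\<omega>. f (X t \<omega>) \<partial>Pr \<eta>)"
  unfolding measure_law by (rule nn_integral_distr) (auto simp: X_measurable)

lemma law_0: "law 0 \<eta> = return_pmf \<eta>"
proof (rule pmf_eqI)
  fix \<xi>
  interpret prob_space "Pr \<eta>" by (rule prob_space_Pr)
  have "measure (Pr \<eta>) {\<omega> \<in> space (Pr \<eta>). X 0 \<omega> = \<xi>} = (if \<xi> = \<eta> then 1 else 0)"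
  proof -
    have [measurable]: "X 0 \<in> measurable (Pr \<eta>) (count_space UNIV)" by (rule X_measurable) simp
    have "measure (Pr \<eta>) {\<omega> \<in> space (Pr \<eta>). X 0 \<omega> = \<xi>} = measure (Pr \<eta>) {\<omega> \<in> space (Pr \<eta>). \<eta> = \<xi>}"
      using X_start[of \<eta>] by (intro finite_measure_eq_AE) (auto elim!: eventually_mono)
    then show ?thesis by (auto simp: prob_space)
  qed
  then show "pmf (law 0 \<eta>) \<xi> = pmf (return_pmf \<eta>) \<xi>"
    by (auto simp: pmf_law pmf_return indicator_def)
qed

lemma law_neg: "t \<le> 0 \<Longrightarrow> law t \<eta> = return_pmf \<eta>"
  using law_0 by (simp add: law_def)

lemma law_add:
  assumes t: "0 \<le> t" "0 \<le> s"
  shows "law (t + s) \<eta> = bind_pmf (law t \<eta>) (law s)"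
proof (rule pmf_eqI)
  fix \<zeta>
  interpret prob_space "Pr \<eta>" by (rule prob_space_Pr)
  have [measurable]: "X t \<in> measurable (Pr \<eta>) (count_space UNIV)" "X (t + s) \<in> measurable (Pr \<eta>) (count_space UNIV)"
    using t by (auto intro: X_measurable)
  have "{\<omega> \<in> space (Pr \<eta>). X (t + s) \<omega> = \<zeta>} = (\<Union>\<xi>. {\<omega> \<in> space (Pr \<eta>). X t \<omega> = \<xi> \<and> X (t + s) \<omega> = \<zeta>})" by auto
  then have "ennreal (pmf (law (t + s) \<eta>) \<zeta>) = emeasure (Pr \<eta>) (\<Union>\<xi>. {\<omega> \<in> space (Pr \<eta>). X t \<omega> = \<xi> \<and> X (t + s) \<omega> = \<zeta>})"
    using t by (simp add: pmf_law emeasure_eq_measure)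
  also have "\<dots> = (\<Sum>\<^sup>+\<xi>. emeasure (Pr \<eta>) {\<omega> \<in> space (Pr \<eta>). X t \<omega> = \<xi> \<and> X (t + s) \<omega> = \<zeta>})"
    by (rule emeasure_UN_countable) (auto simp: disjoint_family_on_def)
  also have "\<dots> = (\<Sum>\<^sup>+\<xi>. ennreal (pmf (law t \<eta>) \<xi>) * ennreal (pmf (law s \<xi>) \<zeta>))"
    using t by (intro nn_integral_cong) (simp add: emeasure_eq_measure X_markov pmf_law ennreal_mult)
  also have "\<dots> = ennreal (pmf (bind_pmf (law t \<eta>) (law s)) \<zeta>)"
    by (simp add: ennreal_pmf_bind nn_integral_measure_pmf)
  finally show "pmf (law (t + s) \<eta>) \<zeta> = pmf (bind_pmf (law t \<eta>) (law s)) \<zeta>" by simp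
qed

lemma nn_integral_law_plus:
  assumes t: "0 \<le> t"
  shows "(\<integral>\<^sup>+\<zeta>. f \<zeta> \<partial>law t (\<eta> + \<xi>)) =
    (\<integral>\<^sup>+\<zeta>. \<integral>\<^sup>+\<zeta>'. f (\<zeta> + \<zeta>') \<partial>law t \<xi> \<partial>law t \<eta>)"
proof -
  interpret e: prob_space "Pr \<eta>" by (rule prob_space_Pr)
  interpret x: prob_space "Pr \<xi>" by (rule prob_space_Pr)
  have [measurable]: "X t \<in> measurable (Pr \<eta>) (count_space UNIV)" "X t \<in> measurable (Pr \<xi>) (count_space UNIV)"
    using t by (auto intro: X_measurable)
  have "(\<lambda>(\<omega>, \<omega>'). (X t \<omega>, X t \<omega>')) \<in> measurable (Pr \<eta> \<Otimes>\<^sub>M Pr \<xi>) (count_space UNIV \<Otimes>\<^sub>M count_space UNIV)"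
    by measurable
  then have pair: "(\<lambda>(\<omega>, \<omega>'). (X t \<omega>, X t \<omega>')) \<in> measurable (Pr \<eta> \<Otimes>\<^sub>M Pr \<xi>) (count_space UNIV)"
    by (subst (asm) pair_measure_countable) auto
  from measurable_compose[OF pair, of "\<lambda>(x, y). x + y" "count_space UNIV"]
  have [measurable]: "(\<lambda>(\<omega>, \<omega>'). X t \<omega> + X t \<omega>') \<in> measurable (Pr \<eta> \<Otimes>\<^sub>M Pr \<xi>) (count_space UNIV)"
    by (simp add: case_prod_beta)
  from measurable_compose[OF this, of f borel]
  have [measurable]: "(\<lambda>(\<omega>, \<omega>'). f (X t \<omega> + X t \<omega>')) \<in> borel_measurable (Pr \<eta> \<Otimes>\<^sub>M Pr \<xi>)"
    by (simp add: case_prod_beta)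
  have "(\<integral>\<^sup>+\<zeta>. f \<zeta> \<partial>law t (\<eta> + \<xi>)) = (\<integral>\<^sup>+(\<omega>, \<omega>'). f (X t \<omega> + X t \<omega>') \<partial>(Pr \<eta> \<Otimes>\<^sub>M Pr \<xi>))"
    unfolding measure_law[OF t] X_branching[OF t]
    by (subst nn_integral_distr) (auto simp: case_prod_beta')
  also have "\<dots> = (\<integral>\<^sup>+\<omega>. \<integral>\<^sup>+\<omega>'. f (X t \<omega> + X t \<omega>') \<partial>Pr \<xi> \<partial>Pr \<eta>)"
    using x.nn_integral_fst[of "\<lambda>(\<omega>, \<omega>'). f (X t \<omega> + X t \<omega>')" "Pr \<eta>"] by simp
  finally show ?thesis using t by (simp add: nn_integral_law)
qed

text \<open>
  A sufficient event: each of the two subpopulations is unchanged.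
\<close>

lemma law_plus_stay: "pmf (law t \<eta>) \<eta> * pmf (law t \<xi>) \<xi> \<le> pmf (law t (\<eta> + \<xi>)) (\<eta> + \<xi>)"
proof (cases "0 \<le> t")
  case True
  have "ennreal (pmf (law t \<eta>) \<eta> * pmf (law t \<xi>) \<xi>) =
    (\<integral>\<^sup>+\<zeta>. \<integral>\<^sup>+\<zeta>'. indicator {\<eta>} \<zeta> * indicator {\<xi>} \<zeta>' \<partial>law t \<xi> \<partial>law t \<eta>)"
    by (simp add: nn_integral_cmult nn_integral_multc emeasure_pmf_single ennreal_mult mult.commute)
  also have "\<dots> \<le> (\<integral>\<^sup>+\<zeta>. \<integral>\<^sup>+\<zeta>'. indicator {\<eta> + \<xi>} (\<zeta> + \<zeta>') \<partial>law t \<xi> \<partial>law t \<eta>)"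
    by (intro nn_integral_mono) (auto simp: indicator_def)
  also have "\<dots> = ennreal (pmf (law t (\<eta> + \<xi>)) (\<eta> + \<xi>))"
    by (subst nn_integral_law_plus[OF True, symmetric]) (simp add: emeasure_pmf_single)
  finally show ?thesis by simp
qed (simp add: law_neg)

lemma law_plus: 
  assumes "0 \<le> t"
  shows "law t (\<eta> + \<xi>) = map_pmf (\<lambda>(\<zeta>, \<zeta>'). \<zeta> + \<zeta>') (pair_pmf (law t \<eta>) (law t \<xi>))"
proof (rule pmf_eqI)
  fix \<rho>
  have "ennreal (pmf (law t (\<eta> + \<xi>)) \<rho>) = (\<integral>\<^sup>+\<zeta>. indicator {\<rho>} \<zeta> \<partial>law t (\<eta> + \<xi>))"
    by (simp add: emeasure_pmf_single)
  also have "\<dots> = ennreal (pmf (map_pmf (\<lambda>(\<zeta>, \<zeta>'). \<zeta> + \<zeta>') (pair_pmf (law t \<eta>) (law t \<xi>))) \<rho>)"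
    unfolding nn_integral_law_plus[OF assms]
    by (subst emeasure_pmf_single[symmetric], subst nn_integral_indicator[symmetric])
      (simp_all add: nn_integral_pair_pmf')
  finally show "pmf (law t (\<eta> + \<xi>)) \<rho> = pmf (map_pmf (\<lambda>(\<zeta>, \<zeta>'). \<zeta> + \<zeta>') (pair_pmf (law t \<eta>) (law t \<xi>))) \<rho>"
    by simp
qed

text \<open>
  The empty population splits into two empty populations, so its size at time \<open>t\<close> is distributed as
  the sum of two independent copies of itself. The least possible size \<open>m\<close> then satisfies
  \<open>m \<ge> 2 m\<close>, hence \<open>m = 0\<close>, and the probability \<open>p > 0\<close> of size \<open>0\<close> satisfies \<open>p = p\<^sup>2\<close>.
\<close>

lemma law_empty: "law t {#} = return_pmf {#}"
proof (cases "0 \<le> t")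
  case True
  let ?p = "pmf (law t {#}) {#}"
  have plus: "law t {#} = map_pmf (\<lambda>(\<zeta>, \<zeta>'). \<zeta> + \<zeta>') (pair_pmf (law t {#}) (law t {#}))"
    using law_plus[OF True, of "{#}" "{#}"] by simp
  \<comment> \<open>A population of minimal size among those reachable from the empty one.\<close>
  obtain \<zeta> where \<zeta>: "\<zeta> \<in> set_pmf (law t {#})" "\<And>\<rho>. \<rho> \<in> set_pmf (law t {#}) \<Longrightarrow> size \<zeta> \<le> size \<rho>"
    using ex_has_least_nat[of "\<lambda>\<rho>. \<rho> \<in> set_pmf (law t {#})" _ size] set_pmf_not_empty[of "law t {#}"] by blast
  obtain \<rho> \<rho>' where "\<zeta> = \<rho> + \<rho>'" "\<rho> \<in> set_pmf (law t {#})" "\<rho>' \<in> set_pmf (law t {#})"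
    using \<zeta>(1) by (subst (asm) plus) auto
  then have "\<zeta> = {#}" using \<zeta>(2)[of \<rho>] \<zeta>(2)[of \<rho>'] by simp
  then have pos: "0 < ?p" using \<zeta>(1) by (simp add: pmf_positive_iff)
  have "?p = measure_pmf.prob (pair_pmf (law t {#}) (law t {#})) {({#}, {#})}"
    by (subst plus, subst pmf_map) (auto intro!: arg_cong[where f = "measure_pmf.prob _"])
  also have "\<dots> = ?p * ?p"
    by (simp add: measure_pmf_single pmf_pair)
  finally have "?p = 1" using pos by simp
  then have "AE \<zeta> in measure_pmf (law t {#}). \<zeta> \<in> {{#}}"
    by (subst measure_pmf.AE_in_set_eq_1) (simp_all add: measure_pmf_single)
  then have "set_pmf (law t {#}) \<subseteq> {{#}}" by (auto simp: AE_measure_pmf_iff)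
  then show ?thesis by (simp only: set_pmf_subset_singleton)
qed (simp add: law_neg)

end

section \<open>Jump rates of a single particle\<close>

context branching_walk
begin

lemma a_nonneg: "x \<noteq> y \<Longrightarrow> 0 \<le> a x y"
  and a_sum: "(a x has_sum 0) UNIV"
  and a_sym: "a x y = a y x"
  and a_diag_neg: "a x x < 0"
  and a_irreducible: "(\<lambda>u v. 0 < a u v)\<^sup>*\<^sup>* x y"
  using walk unfolding walk_intensity_def by blast+

lemma a_shift: "a x y = a 0 (y - x)"
  using walk unfolding walk_intensity_def by blast

lemma a_diag: "a x x = a 0 0"
  using a_shift[of x x] by simp

lemma b_nonneg: "n \<noteq> 1 \<Longrightarrow> 0 \<le> b n" and b_sums: "b sums 0"
  using branching unfolding branching_intensity_def by blast+

text \<open>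
  The total rate of splitting at the origin. Splittings are indexed by \<open>n + 2\<close> throughout: \<open>b 0\<close> is the death
  rate, and \<open>b 1\<close> is negative and not a rate.
\<close>

definition split_rate :: real where "split_rate = (\<Sum>n. b (n + 2))"

lemma split_rate_sums: "(\<lambda>n. b (n + 2)) sums split_rate"
  unfolding split_rate_def using b_sums by (intro summable_sums summable_ignore_initial_segment) (auto simp: sums_iff)

lemma split_rate_nonneg: "0 \<le> split_rate"
  using split_rate_sums b_nonneg unfolding split_rate_def by (intro suminf_nonneg) (auto simp: sums_iff)

lemma infsum_from_2:
  fixes f :: "nat \<Rightarrow> real"
  assumes "(\<lambda>n. f (n + 2)) sums s" "\<And>n. 0 \<le> f (n + 2)"
  shows "(\<Sum>\<^sub>\<infinity>n\<in>{1<..}. f n) = s"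
proof -
  have "((\<lambda>n. f (n + 2)) has_sum s) UNIV"
    using assms by (intro sums_nonneg_imp_has_sum) auto
  then have "(f has_sum s) (range (\<lambda>n. n + 2))"
    by (subst has_sum_reindex) (auto simp: o_def inj_on_def)
  moreover have "range (\<lambda>n. n + 2) = {(1::nat)<..}"
  proof -
    have "k \<in> range (\<lambda>n. n + 2)" if "1 < k" for k :: nat
      using that by (intro image_eqI[of _ _ "k - 2"]) auto
    then show ?thesis by auto
  qed
  ultimately show ?thesis by (simp add: infsumI)
qed

text \<open>
  The rates are completed by fictitious transitions that do nothing, such that the total rate of all
  transitions of a particle is the same constant \<open>uniform_rate\<close> everywhere. A particle at the origin uses
  the part \<open>split_rate\<close> for splitting; elsewhere this part is spent on staying.
\<close>

definition jump :: "int ^ 'd \<Rightarrow> int ^ 'd \<Rightarrow> real" where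
  "jump x y = (if y = x then (if x = 0 then 0 else split_rate) else a x y)"

definition uniform_rate :: real where
  "uniform_rate = - a 0 0 + b 0 + split_rate"

text \<open>
  The uniformised rate from a single particle at \<open>x\<close> to the population \<open>\<zeta>\<close>.
\<close>

definition rate :: "int ^ 'd \<Rightarrow> (int ^ 'd) multiset \<Rightarrow> real" where
  "rate x \<zeta> = (if size \<zeta> = 1 then jump x (THE y. \<zeta> = {#y#})
     else if \<zeta> = {#} then b 0
     else if x = 0 \<and> \<zeta> = replicate_mset (size \<zeta>) 0 then b (size \<zeta>) else 0)"

lemma rate_single [simp]: "rate x {#y#} = jump x y"
  by (simp add: rate_def)

lemma rate_empty [simp]: "rate x {#} = b 0"
  by (simp add: rate_def)

lemma rate_split [simp]: "rate x (replicate_mset (n + 2) 0) = (if x = 0 then b (n + 2) else 0)"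
  by (simp add: rate_def del: replicate_mset_Suc)

lemma jump_nonneg: "0 \<le> jump x y"
  using a_nonneg split_rate_nonneg by (simp add: jump_def)

lemma rate_nonneg: "0 \<le> rate x \<zeta>"
  using jump_nonneg b_nonneg by (simp add: rate_def)

text \<open>
  The populations of positive rate are singletons, the empty one, and multiples of the origin.
\<close>

lemma nn_integral_rate:
  "(\<Sum>\<^sup>+\<zeta>. ennreal (rate x \<zeta>) * f \<zeta>) =
    (\<Sum>\<^sup>+y. ennreal (jump x y) * f {#y#}) + ennreal (b 0) * f {#} +
    (if x = 0 then \<Sum>n. ennreal (b (n + 2)) * f (replicate_mset (n + 2) 0) else 0)"
proof -
  let ?R = "\<lambda>\<zeta>. ennreal (rate x \<zeta>) * f \<zeta>"
  let ?A = "range (\<lambda>y. {#y#}) :: (int ^ 'd) multiset set"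
    and ?C = "range (\<lambda>n. replicate_mset (n + 2) 0) :: (int ^ 'd) multiset set"
  have split: "?R \<zeta> = ?R \<zeta> * indicator ?A \<zeta> + ?R \<zeta> * indicator {{#}} \<zeta> + ?R \<zeta> * indicator ?C \<zeta>" for \<zeta>
  proof -
    have C: "size \<rho> \<ge> 2" if "\<rho> \<in> ?C" for \<rho> using that by auto
    consider (A) "size \<zeta> = 1" | (E) "\<zeta> = {#}" | (C) "\<zeta> \<in> ?C"
      | (Z) "size \<zeta> \<noteq> 1" "\<zeta> \<noteq> {#}" "\<zeta> \<notin> ?C"
      by blast
    then show ?thesis
    proof cases
      case A
      then have "\<zeta> \<in> ?A" by (auto dest: size_1_singleton_mset simp: One_nat_def[symmetric] simp del: One_nat_def)
      moreover have "\<zeta> \<notin> ?C" "\<zeta> \<noteq> {#}" using C[of \<zeta>] A by auto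
      ultimately show ?thesis by simp
    next
      case E
      then have "\<zeta> \<notin> ?C" "\<zeta> \<notin> ?A" using C[of \<zeta>] by auto
      then show ?thesis using E by simp
    next
      case C
      then have "\<zeta> \<notin> ?A" "\<zeta> \<noteq> {#}" using \<open>\<And>\<rho>. \<rho> \<in> ?C \<Longrightarrow> size \<rho> \<ge> 2\<close>[of \<zeta>] by auto
      then show ?thesis using C by simp
    next
      case Z
      have "\<zeta> \<noteq> replicate_mset (size \<zeta>) 0"
      proof
        assume eq: "\<zeta> = replicate_mset (size \<zeta>) 0"
        have "size \<zeta> \<noteq> 0" using Z(2) by simp
        then have "size \<zeta> = (size \<zeta> - 2) + 2" using Z(1) by linarith
        then have "\<zeta> = replicate_mset (size \<zeta> - 2 + 2) 0" using eq by simp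
        with Z(3) show False by blast
      qed
      then have "rate x \<zeta> = 0" using Z by (simp add: rate_def)
      then show ?thesis by simp
    qed
  qed
  have "(\<Sum>\<^sup>+\<zeta>. ?R \<zeta>) =
     (\<Sum>\<^sup>+\<zeta>. ?R \<zeta> * indicator ?A \<zeta> + ?R \<zeta> * indicator {{#}} \<zeta> + ?R \<zeta> * indicator ?C \<zeta>)"
    by (rule nn_integral_cong) (rule split)
  also have "\<dots> = (\<integral>\<^sup>+\<zeta>\<in>?A. ?R \<zeta> \<partial>count_space UNIV) + (\<Sum>\<^sup>+\<zeta>. ?R \<zeta> * indicator {{#}} \<zeta>)
      + (\<integral>\<^sup>+\<zeta>\<in>?C. ?R \<zeta> \<partial>count_space UNIV)"
    by (subst nn_integral_add, simp, simp, subst nn_integral_add) auto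
  also have "(\<integral>\<^sup>+\<zeta>\<in>?A. ?R \<zeta> \<partial>count_space UNIV) = (\<Sum>\<^sup>+y. ennreal (jump x y) * f {#y#})"
    by (subst nn_integral_count_compose_inj[symmetric]) (auto simp: inj_on_def)
  also have "(\<Sum>\<^sup>+\<zeta>. ?R \<zeta> * indicator {{#}} \<zeta>) = ennreal (b 0) * f {#}"
    by (simp only: nn_integral_count_space_single rate_empty)
  also have "(\<integral>\<^sup>+\<zeta>\<in>?C. ?R \<zeta> \<partial>count_space UNIV) = (\<Sum>\<^sup>+n. ?R (replicate_mset (n + 2) 0))"
  proof -
    have "inj (\<lambda>n. replicate_mset (n + 2) (0 :: int ^ 'd))"
      by (metis (no_types, lifting) add_right_cancel injI size_replicate_mset)
    from nn_integral_count_compose_inj[OF this, of ?R] show ?thesis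
      by (simp del: rate_split replicate_mset_Suc add_2_eq_Suc')
  qed
  also have "\<dots> = (if x = 0 then \<Sum>n. ennreal (b (n + 2)) * f (replicate_mset (n + 2) 0) else 0)"
    unfolding rate_split by (simp add: nn_integral_count_space_nat)
  finally show ?thesis .
qed

lemma nn_integral_jump:
  "(\<Sum>\<^sup>+y. ennreal (jump x y)) = ennreal (- a 0 0 + (if x = 0 then 0 else split_rate))"
proof -
  have "((\<lambda>y. if y = x then jump x x - a x x else 0) has_sum (jump x x - a x x)) UNIV"
    by (rule has_sum_finite_neutralI[of "{x}"]) auto
  from has_sum_add[OF a_sum[of x] this]
  moreover have "jump x = (\<lambda>y. a x y + (if y = x then jump x x - a x x else 0))"
    by (auto simp: jump_def fun_eq_iff)
  ultimately have "(jump x has_sum (jump x x - a x x)) UNIV" by simp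
  then have "(\<Sum>\<^sup>+y. ennreal (jump x y)) = ennreal (jump x x - a x x)"
    by (rule has_sum_imp_nn_integral_count_space) (rule jump_nonneg)
  also have "jump x x - a x x = - a 0 0 + (if x = 0 then 0 else split_rate)"
    using a_diag[of x] by (simp add: jump_def)
  finally show ?thesis .
qed

lemma nn_integral_rate_total: "(\<Sum>\<^sup>+\<zeta>. ennreal (rate x \<zeta>)) = ennreal uniform_rate"
proof -
  have s: "(\<Sum>n. ennreal (b (n + 2))) = ennreal split_rate"
    unfolding split_rate_def using split_rate_sums b_nonneg by (intro suminf_ennreal2) (auto simp: sums_iff)
  show ?thesis
    using nn_integral_rate[of x "\<lambda>_. 1"] s b_nonneg[of 0] split_rate_nonneg a_diag_neg[of 0]
    by (auto simp: nn_integral_jump uniform_rate_def ennreal_plus[symmetric] simp del: ennreal_plus)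
qed

lemma uniform_rate_nonneg: "0 \<le> uniform_rate"
  using b_nonneg[of 0] split_rate_nonneg a_diag_neg[of 0] by (simp add: uniform_rate_def)

lemma integrable_rate: "integrable (count_space UNIV) (rate x)"
  by (rule integrableI_nonneg) (auto simp: rate_nonneg nn_integral_rate_total)

lemma integral_rate: "(\<integral>\<zeta>. rate x \<zeta> \<partial>count_space UNIV) = uniform_rate"
  using integrable_rate[of x] nn_integral_rate_total[of x] uniform_rate_nonneg
  by (subst integral_eq_nn_integral) (auto simp: rate_nonneg)

lemma exit_rate_eq: "exit_rate a b x = uniform_rate - rate x {#x#}"
proof -
  have "(a x has_sum (0 - a x x)) (UNIV - {x})"
    by (rule has_sum_Diff[OF a_sum]) (auto intro: has_sum_finiteI)
  then have "(\<Sum>\<^sub>\<infinity>y\<in>-{x}. a x y) = - a x x" by (simp add: infsumI Compl_eq_Diff_UNIV)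
  moreover have "(\<Sum>\<^sub>\<infinity>n\<in>{1<..}. b n) = split_rate"
    by (rule infsum_from_2[OF split_rate_sums]) (simp add: b_nonneg)
  ultimately show ?thesis
    by (simp add: exit_rate_def uniform_rate_def jump_def a_diag[of x])
qed

end

section \<open>The backward equation\<close>

context branching_walk
begin

lemma pmf_law_quotient:
  assumes "(\<lambda>h. measure (Pr \<eta>) {\<omega> \<in> space (Pr \<eta>). X h \<omega> = \<zeta>} - (p + k * h)) \<in> o[at_right 0](\<lambda>h. h)"
  shows "((\<lambda>h. (pmf (law h \<eta>) \<zeta> - p) / h) \<longlongrightarrow> k) (at_right 0)"
proof -
  have "((\<lambda>h. (measure (Pr \<eta>) {\<omega> \<in> space (Pr \<eta>). X h \<omega> = \<zeta>} - (p + k * h)) / h + k) \<longlongrightarrow> 0 + k) (at_right 0)"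
    by (intro tendsto_add smalloD_tendsto[OF assms] tendsto_const)
  moreover have "\<forall>\<^sub>F h in at_right 0. (measure (Pr \<eta>) {\<omega> \<in> space (Pr \<eta>). X h \<omega> = \<zeta>} - (p + k * h)) / h + k
      = (pmf (law h \<eta>) \<zeta> - p) / h"
    using eventually_at_right_less[of 0]
    by eventually_elim (simp add: pmf_law max_def field_simps)
  ultimately show ?thesis by (auto dest: Lim_transform_eventually)
qed

lemma pmf_law_rate:
  assumes "0 < rate x \<zeta>" "\<zeta> \<noteq> {#x#}"
  shows "((\<lambda>h. pmf (law h {#x#}) \<zeta> / h) \<longlongrightarrow> rate x \<zeta>) (at_right 0)"
proof -
  have small_o:
    "\<And>x y. x \<noteq> y \<Longrightarrow> (\<lambda>h. \<P>(\<omega> in Pr {#x#}. X h \<omega> = {#y#}) - a x y * h) \<in> o[at_right 0](\<lambda>h. h)"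
    "\<And>x. (\<lambda>h. \<P>(\<omega> in Pr {#x#}. X h \<omega> = {#}) - b 0 * h) \<in> o[at_right 0](\<lambda>h. h)"
    "\<And>n. 1 < n \<Longrightarrow> (\<lambda>h. \<P>(\<omega> in Pr {#0#}. X h \<omega> = replicate_mset n 0) - b n * h) \<in> o[at_right 0](\<lambda>h. h)"
    using process unfolding branching_random_walk_def by blast+
  have lim: "(\<lambda>h. measure (Pr {#x#}) {\<omega> \<in> space (Pr {#x#}). X h \<omega> = \<zeta>} - k * h) \<in> o[at_right 0](\<lambda>h. h) \<Longrightarrow>
    ((\<lambda>h. pmf (law h {#x#}) \<zeta> / h) \<longlongrightarrow> k) (at_right 0)" for k
    using pmf_law_quotient[of "{#x#}" \<zeta> 0 k] by simp
  consider (A) "size \<zeta> = 1" | (E) "\<zeta> = {#}" | (C) "size \<zeta> \<noteq> 1" "\<zeta> \<noteq> {#}" by blast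
  then show ?thesis
  proof cases
    case A
    then obtain y where y: "\<zeta> = {#y#}" using size_1_singleton_mset by blast
    then have "x \<noteq> y" using assms by auto
    then have "rate x \<zeta> = a x y" using y by (simp add: jump_def)
    then show ?thesis using lim[of "a x y"] small_o(1)[OF \<open>x \<noteq> y\<close>] y by simp
  next
    case E
    then show ?thesis using lim[of "b 0"] small_o(2) by simp
  next
    case C
    then have x: "x = 0" and \<zeta>: "\<zeta> = replicate_mset (size \<zeta>) 0" and r: "rate x \<zeta> = b (size \<zeta>)"
      using assms by (auto simp: rate_def split: if_splits)
    have "size \<zeta> \<noteq> 0" using C(2) by simp
    then have "1 < size \<zeta>" using C(1) by linarith
    from small_o(3)[OF this] show ?thesis
      unfolding r by (intro lim) (simp only: x \<zeta>[symmetric])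
  qed
qed

lemma pmf_law_stay_quotient:
  "((\<lambda>h. (1 - pmf (law h {#x#}) {#x#}) / h) \<longlongrightarrow> uniform_rate - rate x {#x#}) (at_right 0)"
proof -
  have "(\<lambda>h. \<P>(\<omega> in Pr {#x#}. X h \<omega> = {#x#}) - (1 - exit_rate a b x * h)) \<in> o[at_right 0](\<lambda>h. h)"
    using process unfolding branching_random_walk_def by blast
  then have "((\<lambda>h. (pmf (law h {#x#}) {#x#} - 1) / h) \<longlongrightarrow> - exit_rate a b x) (at_right 0)"
    by (intro pmf_law_quotient) simp
  from tendsto_minus[OF this] show ?thesis
    by (simp add: exit_rate_eq minus_divide_left)
qed

text \<open>
  The difference quotients of the transition probabilities. At \<open>{#x#}\<close> the limit is inserted: this
  keeps the function nonnegative and does no harm, because it only gets multiplied by increments that vanish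
  there.
\<close>

definition quotient :: "int ^ 'd \<Rightarrow> real \<Rightarrow> (int ^ 'd) multiset \<Rightarrow> real" where
  "quotient x h \<zeta> = (if \<zeta> = {#x#} then rate x \<zeta> else pmf (law h {#x#}) \<zeta> / h)"

definition rate_error :: "int ^ 'd \<Rightarrow> real \<Rightarrow> real" where
  "rate_error x h = (\<integral>\<zeta>. \<bar>quotient x h \<zeta> - rate x \<zeta>\<bar> \<partial>count_space UNIV)"

lemma quotient_nonneg: "0 < h \<Longrightarrow> 0 \<le> quotient x h \<zeta>"
  using rate_nonneg[of x \<zeta>] by (auto simp: quotient_def)

lemma quotient_alt:
  "quotient x h \<zeta> = pmf (law h {#x#}) \<zeta> / h + indicator {{#x#}} \<zeta> * (rate x {#x#} - pmf (law h {#x#}) {#x#} / h)"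
  by (auto simp: quotient_def indicator_def)

lemma integrable_indicator_single:
  fixes k :: real shows "integrable (count_space UNIV) (\<lambda>\<zeta>. indicator {\<xi>} \<zeta> * k)"
  by (intro integrable_mult_left integrable_real_indicator) auto

lemma integral_indicator_single:
  fixes k :: real shows "(\<integral>\<zeta>. indicator {\<xi>} \<zeta> * k \<partial>count_space UNIV) = k"
  by (simp add: measure_def)

lemma integrable_quotient: "integrable (count_space UNIV) (quotient x h)"
  unfolding quotient_alt[abs_def]
  by (intro Bochner_Integration.integrable_add integrable_indicator_single integrable_divide_zero integrable_pmf)

lemma integral_quotient:
  "(\<integral>\<zeta>. quotient x h \<zeta> \<partial>count_space UNIV) = rate x {#x#} + (1 - pmf (law h {#x#}) {#x#}) / h"
proof -
  have "(\<integral>\<zeta>. quotient x h \<zeta> \<partial>count_space UNIV) = (\<integral>\<zeta>. pmf (law h {#x#}) \<zeta> / h \<partial>count_space UNIV) +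
     (\<integral>\<zeta>. indicator {{#x#}} \<zeta> * (rate x {#x#} - pmf (law h {#x#}) {#x#} / h) \<partial>count_space UNIV)"
    unfolding quotient_alt[abs_def]
    by (intro Bochner_Integration.integral_add integrable_indicator_single integrable_divide_zero integrable_pmf)
  also have "(\<integral>\<zeta>. pmf (law h {#x#}) \<zeta> / h \<partial>count_space UNIV) = 1 / h"
    by (simp add: integral_pmf)
  finally show ?thesis by (simp only: integral_indicator_single diff_divide_distrib)
qed

text \<open>
  Scheffe's argument. The total mass of the quotients converges to the total mass of the rates,
  and \<open>\<bar>p - q\<bar> = (p - q) + 2 max 0 (q - p)\<close>; the positive part of rate minus quotient is dominated by the
  rate and vanishes wherever the rate does. So pointwise convergence is needed only
  for populations of positive rate, and transitions to all other populations are negligible together.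
\<close>

lemma rate_error_tendsto: "(rate_error x \<longlongrightarrow> 0) (at_right 0)"
proof -
  have "(\<lambda>i. rate_error x (Z i)) \<longlonglongrightarrow> 0" if Z: "\<And>i. 0 < Z i" "Z \<longlonglongrightarrow> 0" for Z
  proof -
    have Z0: "filterlim Z (at_right 0) sequentially"
      using Z Z(1)[THEN less_imp_neq] by (auto simp: filterlim_at intro!: always_eventually)
    have "(\<lambda>i. (\<integral>\<zeta>. max 0 (rate x \<zeta> - quotient x (Z i) \<zeta>) \<partial>count_space UNIV)) \<longlonglongrightarrow> (\<integral>\<zeta>. 0 \<partial>count_space (UNIV :: (int ^ 'd) multiset set))"
    proof (rule integral_dominated_convergence)
      show "AE \<zeta> in count_space UNIV. (\<lambda>i. max 0 (rate x \<zeta> - quotient x (Z i) \<zeta>)) \<longlonglongrightarrow> 0"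
      proof (rule AE_I2)
        fix \<zeta>
        show "(\<lambda>i. max 0 (rate x \<zeta> - quotient x (Z i) \<zeta>)) \<longlonglongrightarrow> 0"
        proof (cases "0 < rate x \<zeta> \<and> \<zeta> \<noteq> {#x#}")
          case True
          then have "(\<lambda>i. quotient x (Z i) \<zeta>) \<longlonglongrightarrow> rate x \<zeta>"
            using filterlim_compose[OF pmf_law_rate Z0, of x \<zeta>] by (simp add: quotient_def)
          then have "(\<lambda>i. max 0 (rate x \<zeta> - quotient x (Z i) \<zeta>)) \<longlonglongrightarrow> max 0 (rate x \<zeta> - rate x \<zeta>)"
            by (intro tendsto_intros)
          then show ?thesis by simp
        next
          case False
          then have "max 0 (rate x \<zeta> - quotient x (Z i) \<zeta>) = 0" for i
            using rate_nonneg[of x \<zeta>] quotient_nonneg[OF Z(1), of x i \<zeta>] by (auto simp: quotient_def)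
          then show ?thesis by simp
        qed
      qed
      show "AE \<zeta> in count_space UNIV. norm (max 0 (rate x \<zeta> - quotient x (Z i) \<zeta>)) \<le> rate x \<zeta>" for i
        using rate_nonneg quotient_nonneg[OF Z(1)] by (auto intro!: AE_I2)
    qed (auto simp: integrable_rate)
    moreover have "(\<lambda>i. (\<integral>\<zeta>. quotient x (Z i) \<zeta> \<partial>count_space UNIV)) \<longlonglongrightarrow> rate x {#x#} + (uniform_rate - rate x {#x#})"
      unfolding integral_quotient
      by (intro tendsto_add tendsto_const filterlim_compose[OF pmf_law_stay_quotient Z0])
    ultimately have "(\<lambda>i. (\<integral>\<zeta>. quotient x (Z i) \<zeta> \<partial>count_space UNIV) - uniform_rate +
        2 * (\<integral>\<zeta>. max 0 (rate x \<zeta> - quotient x (Z i) \<zeta>) \<partial>count_space UNIV)) \<longlonglongrightarrow>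
        rate x {#x#} + (uniform_rate - rate x {#x#}) - uniform_rate + 2 * (\<integral>\<zeta>. 0 \<partial>count_space (UNIV :: (int ^ 'd) multiset set))"
      by (intro tendsto_add tendsto_mult tendsto_diff tendsto_const)
    moreover have "rate_error x (Z i) = (\<integral>\<zeta>. quotient x (Z i) \<zeta> \<partial>count_space UNIV) - uniform_rate +
        2 * (\<integral>\<zeta>. max 0 (rate x \<zeta> - quotient x (Z i) \<zeta>) \<partial>count_space UNIV)" for i
    proof -
      have abs: "\<bar>p - q\<bar> = p - q + 2 * max 0 (q - p)" for p q :: real by (simp add: max_def abs_if)
      have "integrable (count_space UNIV) (\<lambda>\<zeta>. max 0 (rate x \<zeta> - quotient x (Z i) \<zeta>))"
        by (intro integrable_max Bochner_Integration.integrable_diff integrable_rate integrable_quotient integrable_zero)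
      then show ?thesis unfolding rate_error_def abs
        by (simp add: integrable_rate integrable_quotient integral_rate)
    qed
    ultimately show ?thesis by simp
  qed
  then show ?thesis
    unfolding tendsto_at_iff_sequentially by (auto simp: o_def)
qed

text \<open>
  Induction over the population, using independence of its parts.
\<close>

lemma pmf_law_stay_tendsto: "((\<lambda>h. pmf (law h \<xi>) \<xi>) \<longlongrightarrow> 1) (at_right 0)"
proof (induction \<xi>)
  case empty
  show ?case by (simp add: law_empty)
next
  case (add x \<xi>)
  have id: "((\<lambda>h. h) \<longlongrightarrow> 0) (at_right (0 :: real))" by (rule tendsto_ident_at)
  have "((\<lambda>h. 1 - (1 - pmf (law h {#x#}) {#x#}) / h * h) \<longlongrightarrow> 1 - (uniform_rate - rate x {#x#}) * 0) (at_right 0)"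
    by (intro tendsto_diff tendsto_mult tendsto_const pmf_law_stay_quotient id)
  then have "((\<lambda>h. 1 - (1 - pmf (law h {#x#}) {#x#}) / h * h) \<longlongrightarrow> 1) (at_right 0)"
    by simp
  moreover have "\<forall>\<^sub>F h in at_right 0. 1 - (1 - pmf (law h {#x#}) {#x#}) / h * h = pmf (law h {#x#}) {#x#}"
    using eventually_at_right_less[of 0] by eventually_elim simp
  ultimately have "((\<lambda>h. pmf (law h {#x#}) {#x#}) \<longlongrightarrow> 1) (at_right 0)"
    by (rule Lim_transform_eventually)
  from tendsto_mult[OF this add]
  have lower: "((\<lambda>h. pmf (law h {#x#}) {#x#} * pmf (law h \<xi>) \<xi>) \<longlongrightarrow> 1) (at_right 0)" by simp
  show ?case
  proof (rule tendsto_sandwich[OF _ _ lower tendsto_const])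
    show "\<forall>\<^sub>F h in at_right 0. pmf (law h {#x#}) {#x#} * pmf (law h \<xi>) \<xi> \<le> pmf (law h (add_mset x \<xi>)) (add_mset x \<xi>)"
      using law_plus_stay[of _ "{#x#}" \<xi>] by (intro always_eventually) simp
  qed (auto simp: pmf_le_1)
qed

definition mean :: "((int ^ 'd) multiset \<Rightarrow> real) \<Rightarrow> real \<Rightarrow> (int ^ 'd) multiset \<Rightarrow> real" where
  "mean H t \<xi> = measure_pmf.expectation (law t \<xi>) H"

context
  fixes H :: "(int ^ 'd) multiset \<Rightarrow> real" and C :: real
  assumes H: "\<And>\<zeta>. 0 \<le> H \<zeta>" "\<And>\<zeta>. H \<zeta> \<le> C"
begin

lemma integrable_H: "integrable (measure_pmf p) H"
  by (rule measure_pmf.integrable_const_bound[where B = C]) (use H in auto)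

lemma nn_integral_H: "(\<integral>\<^sup>+\<zeta>. ennreal (H \<zeta>) \<partial>law t \<xi>) = ennreal (mean H t \<xi>)"
  unfolding mean_def by (rule nn_integral_eq_integral) (use integrable_H H in auto)

lemma mean_bounds: "0 \<le> mean H t \<xi>" "mean H t \<xi> \<le> C"
proof -
  show "0 \<le> mean H t \<xi>" unfolding mean_def by (rule integral_nonneg_AE) (use H in auto)
  show "mean H t \<xi> \<le> C" unfolding mean_def
    by (rule measure_pmf.integral_le_const) (use integrable_H H in auto)
qed

lemma mean_add:
  assumes "0 \<le> h" "0 \<le> l"
  shows "mean H (l + h) \<xi> = (\<integral>\<zeta>. mean H l \<zeta> \<partial>law h \<xi>)"
proof -
  have "ennreal (mean H (l + h) \<xi>) = (\<integral>\<^sup>+\<zeta>. ennreal (mean H l \<zeta>) \<partial>law h \<xi>)"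
    using law_add[OF assms, of \<xi>] by (simp add: nn_integral_H[symmetric] nn_integral_bind_pmf add.commute)
  also have "\<dots> = ennreal (\<integral>\<zeta>. mean H l \<zeta> \<partial>law h \<xi>)"
    by (rule nn_integral_eq_integral)
      (use mean_bounds in \<open>auto intro!: measure_pmf.integrable_const_bound[where B = C]\<close>)
  finally show ?thesis
    using mean_bounds by (subst (asm) ennreal_inj) (auto intro!: integral_nonneg_AE)
qed

lemma mean_increment:
  assumes "0 \<le> h" "0 \<le> l"
  shows "mean H (l + h) \<xi> - mean H l \<xi> = (\<integral>\<zeta>. pmf (law h \<xi>) \<zeta> * (mean H l \<zeta> - mean H l \<xi>) \<partial>count_space UNIV)"
proof -
  have int: "integrable (measure_pmf (law h \<xi>)) (mean H l)"
    using mean_bounds by (auto intro!: measure_pmf.integrable_const_bound[where B = C])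
  have "mean H (l + h) \<xi> - mean H l \<xi> = (\<integral>\<zeta>. mean H l \<zeta> - mean H l \<xi> \<partial>law h \<xi>)"
    using int by (simp add: mean_add[OF assms])
  also have "\<dots> = (\<integral>\<zeta>. pmf (law h \<xi>) \<zeta> * (mean H l \<zeta> - mean H l \<xi>) \<partial>count_space UNIV)"
    by (subst measure_pmf_eq_density, subst integral_real_density) auto
  finally show ?thesis .
qed

lemma mean_diff_le: "\<bar>mean H l \<zeta> - mean H l \<xi>\<bar> \<le> C"
  using mean_bounds[of l \<zeta>] mean_bounds[of l \<xi>] by (auto simp: abs_le_iff)

lemma mean_increment_le:
  assumes "0 \<le> h" "0 \<le> l"
  shows "\<bar>mean H (l + h) \<xi> - mean H l \<xi>\<bar> \<le> C * (1 - pmf (law h \<xi>) \<xi>)"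
proof -
  have "\<bar>mean H (l + h) \<xi> - mean H l \<xi>\<bar> \<le> (\<integral>\<zeta>. C * (pmf (law h \<xi>) \<zeta> - indicator {\<xi>} \<zeta> * pmf (law h \<xi>) \<xi>) \<partial>count_space UNIV)"
    unfolding mean_increment[OF assms] real_norm_def[symmetric]
  proof (rule order_trans[OF integral_norm_bound integral_mono], rule integrable_norm)
    show "integrable (count_space UNIV) (\<lambda>\<zeta>. pmf (law h \<xi>) \<zeta> * (mean H l \<zeta> - mean H l \<xi>))"
    proof (rule Bochner_Integration.integrable_bound)
      show "integrable (count_space UNIV) (\<lambda>\<zeta>. C * pmf (law h \<xi>) \<zeta>)"
        by (intro integrable_mult_right integrable_pmf)
      show "AE \<zeta> in count_space UNIV. norm (pmf (law h \<xi>) \<zeta> * (mean H l \<zeta> - mean H l \<xi>)) \<le> norm (C * pmf (law h \<xi>) \<zeta>)"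
        using mult_right_mono[OF order_trans[OF mean_diff_le abs_ge_self], of "pmf (law h \<xi>) _"]
        by (intro AE_I2) (simp add: abs_mult mult.commute[of "pmf _ _"])
    qed simp
    show "integrable (count_space UNIV) (\<lambda>\<zeta>. C * (pmf (law h \<xi>) \<zeta> - indicator {\<xi>} \<zeta> * pmf (law h \<xi>) \<xi>))"
      by (intro integrable_mult_right Bochner_Integration.integrable_diff integrable_indicator_single integrable_pmf)
    show "norm (pmf (law h \<xi>) \<zeta> * (mean H l \<zeta> - mean H l \<xi>)) \<le> C * (pmf (law h \<xi>) \<zeta> - indicator {\<xi>} \<zeta> * pmf (law h \<xi>) \<xi>)" for \<zeta>
      using mult_left_mono[OF mean_diff_le[of l \<zeta> \<xi>], of "pmf (law h \<xi>) \<zeta>"]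
      by (auto simp: abs_mult indicator_def ac_simps)
  qed
  also have "\<dots> = C * (1 - pmf (law h \<xi>) \<xi>)"
    by (simp add: integrable_pmf integrable_indicator_single integral_pmf measure_def)
  finally show ?thesis .
qed

text \<open>
  By the Markov property an increment over a short time is at most the bound of the function times the probability of a change.
\<close>

lemma continuous_mean: "isCont (\<lambda>t. mean H t \<xi>) t"
proof -
  let ?g = "\<lambda>h. pmf (law h \<xi>) \<xi>"
  have neg: "mean H s \<xi> = mean H (max 0 s) \<xi>" for s
    by (simp add: mean_def law_def)
  have g0: "isCont ?g 0"
    unfolding isCont_def using pmf_law_stay_tendsto[of \<xi>]
    by (auto simp: filterlim_at_split law_0 law_neg intro!: tendsto_eventually eventually_mono[OF eventually_at_left_real[of "-1" 0]])
  have "((\<lambda>s. \<bar>max 0 s - max 0 t\<bar>) \<longlongrightarrow> \<bar>max 0 t - max 0 t\<bar>) (at t)"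
    by (intro tendsto_intros)
  then have "((\<lambda>s. C * (1 - ?g \<bar>max 0 s - max 0 t\<bar>)) \<longlongrightarrow> C * (1 - ?g 0)) (at t)"
    by (intro tendsto_intros isCont_tendsto_compose[OF g0]) simp
  then have lim: "((\<lambda>s. C * (1 - ?g \<bar>max 0 s - max 0 t\<bar>)) \<longlongrightarrow> 0) (at t)"
    by (simp add: law_0)
  have bound: "\<bar>mean H s \<xi> - mean H t \<xi>\<bar> \<le> C * (1 - ?g \<bar>max 0 s - max 0 t\<bar>)" for s
  proof (cases "t \<le> s")
    case True
    then have "max 0 s = max 0 t + \<bar>max 0 s - max 0 t\<bar>" by auto
    then show ?thesis
      using mean_increment_le[of "\<bar>max 0 s - max 0 t\<bar>" "max 0 t" \<xi>]
      by (subst (1 2) neg) simp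
  next
    case False
    then have "max 0 t = max 0 s + \<bar>max 0 s - max 0 t\<bar>" by auto
    then show ?thesis
      using mean_increment_le[of "\<bar>max 0 s - max 0 t\<bar>" "max 0 s" \<xi>]
      by (subst (1 2) neg) (simp add: abs_minus_commute)
  qed
  have "((\<lambda>s. mean H s \<xi> - mean H t \<xi>) \<longlongrightarrow> 0) (at t)"
    by (rule tendsto_rabs_zero_cancel, rule tendsto_sandwich[OF _ _ tendsto_const lim])
      (auto simp: bound)
  then show ?thesis unfolding isCont_def by (simp add: LIM_zero_iff)
qed

text \<open>
  The uniformised generator without its diagonal part \<open>- uniform_rate\<close>.
\<close>

definition generator :: "real \<Rightarrow> int ^ 'd \<Rightarrow> real" where
  "generator t x = (\<integral>\<zeta>. rate x \<zeta> * mean H t \<zeta> \<partial>count_space UNIV)"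

lemma integrable_rate_mult:
  assumes "\<And>\<zeta>. \<bar>g \<zeta>\<bar> \<le> K"
  shows "integrable (count_space UNIV) (\<lambda>\<zeta>. rate x \<zeta> * g \<zeta>)"
proof (rule Bochner_Integration.integrable_bound)
  show "integrable (count_space UNIV) (\<lambda>\<zeta>. K * rate x \<zeta>)"
    by (intro integrable_mult_right integrable_rate)
  show "AE \<zeta> in count_space UNIV. norm (rate x \<zeta> * g \<zeta>) \<le> norm (K * rate x \<zeta>)"
    using mult_right_mono[OF order_trans[OF assms abs_ge_self] rate_nonneg[of x]] rate_nonneg[of x]
    by (intro AE_I2) (simp add: abs_mult mult.commute[of "rate x _"])
qed simp

lemma abs_mean_le: "\<bar>mean H t \<zeta>\<bar> \<le> C"
  using mean_bounds[of t \<zeta>] by simp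

lemma generator_nonneg: "0 \<le> generator t x"
  unfolding generator_def by (rule integral_nonneg_AE) (auto simp: rate_nonneg mean_bounds)

lemma nn_integral_generator:
  "(\<Sum>\<^sup>+\<zeta>. ennreal (rate x \<zeta>) * (\<integral>\<^sup>+\<rho>. ennreal (H \<rho>) \<partial>law t \<zeta>)) = ennreal (generator t x)"
proof -
  have "(\<Sum>\<^sup>+\<zeta>. ennreal (rate x \<zeta>) * (\<integral>\<^sup>+\<rho>. ennreal (H \<rho>) \<partial>law t \<zeta>)) =
    (\<Sum>\<^sup>+\<zeta>. ennreal (rate x \<zeta> * mean H t \<zeta>))"
    by (simp add: nn_integral_H ennreal_mult rate_nonneg mean_bounds)
  also have "\<dots> = ennreal (generator t x)"
    unfolding generator_def
    by (rule nn_integral_eq_integral) (auto simp: rate_nonneg mean_bounds intro!: integrable_rate_mult[of _ C] abs_mean_le)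
  finally show ?thesis .
qed

lemma continuous_generator: "isCont (\<lambda>t. generator t x) t"
proof -
  have "(\<lambda>i. generator (Z i) x) \<longlonglongrightarrow> generator t x" if Z: "Z \<longlonglongrightarrow> t" for Z
    unfolding generator_def
  proof (rule integral_dominated_convergence)
    show "integrable (count_space UNIV) (\<lambda>\<zeta>. C * rate x \<zeta>)"
      by (intro integrable_mult_right integrable_rate)
    show "AE \<zeta> in count_space UNIV. (\<lambda>i. rate x \<zeta> * mean H (Z i) \<zeta>) \<longlonglongrightarrow> rate x \<zeta> * mean H t \<zeta>"
      by (intro AE_I2 tendsto_mult tendsto_const isCont_tendsto_compose[OF continuous_mean Z])
    show "AE \<zeta> in count_space UNIV. norm (rate x \<zeta> * mean H (Z i) \<zeta>) \<le> C * rate x \<zeta>" for i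
      using mult_right_mono[OF abs_mean_le rate_nonneg[of x]] rate_nonneg[of x]
      by (intro AE_I2) (simp add: abs_mult mult.commute[of "rate x _"])
  qed auto
  then show ?thesis
    by (simp add: continuous_at_sequentially o_def)
qed

text \<open>
  The estimate is uniform in the time \<open>l\<close>; this makes the two-sided derivative in \<open>mean_deriv\<close>
  accessible although the transition probabilities are only known for short positive times.
\<close>

lemma mean_quotient:
  assumes h: "0 < h" and l: "0 \<le> l"
  shows "\<bar>(mean H (l + h) {#x#} - mean H l {#x#}) / h - (generator l x - uniform_rate * mean H l {#x#})\<bar> \<le> C * rate_error x h"
proof -
  let ?\<Delta> = "\<lambda>\<zeta>. mean H l \<zeta> - mean H l {#x#}"
  have int_q: "integrable (count_space UNIV) (\<lambda>\<zeta>. quotient x h \<zeta> * ?\<Delta> \<zeta>)"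
  proof (rule Bochner_Integration.integrable_bound)
    show "integrable (count_space UNIV) (\<lambda>\<zeta>. C * quotient x h \<zeta>)"
      by (intro integrable_mult_right integrable_quotient)
    show "AE \<zeta> in count_space UNIV. norm (quotient x h \<zeta> * ?\<Delta> \<zeta>) \<le> norm (C * quotient x h \<zeta>)"
      using mult_right_mono[OF order_trans[OF mean_diff_le abs_ge_self] quotient_nonneg[OF h, of x]] quotient_nonneg[OF h, of x]
      by (intro AE_I2) (simp add: abs_mult mult.commute[of "quotient x h _"])
  qed simp
  have int_r: "integrable (count_space UNIV) (\<lambda>\<zeta>. rate x \<zeta> * ?\<Delta> \<zeta>)"
    by (rule integrable_rate_mult[of _ C]) (rule mean_diff_le)
  have "(mean H (l + h) {#x#} - mean H l {#x#}) / h = (\<integral>\<zeta>. pmf (law h {#x#}) \<zeta> * ?\<Delta> \<zeta> / h \<partial>count_space UNIV)"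
    using h l by (simp add: mean_increment)
  also have "\<dots> = (\<integral>\<zeta>. quotient x h \<zeta> * ?\<Delta> \<zeta> \<partial>count_space UNIV)"
    by (intro Bochner_Integration.integral_cong refl) (simp add: quotient_def)
  finally have 1: "(mean H (l + h) {#x#} - mean H l {#x#}) / h = (\<integral>\<zeta>. quotient x h \<zeta> * ?\<Delta> \<zeta> \<partial>count_space UNIV)" .
  have "(\<integral>\<zeta>. rate x \<zeta> * ?\<Delta> \<zeta> \<partial>count_space UNIV) =
    (\<integral>\<zeta>. rate x \<zeta> * mean H l \<zeta> - rate x \<zeta> * mean H l {#x#} \<partial>count_space UNIV)"
    by (simp add: right_diff_distrib)
  also have "\<dots> = generator l x - (\<integral>\<zeta>. rate x \<zeta> * mean H l {#x#} \<partial>count_space UNIV)"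
    unfolding generator_def
    by (intro Bochner_Integration.integral_diff integrable_rate_mult[of _ C] abs_mean_le)
  also have "(\<integral>\<zeta>. rate x \<zeta> * mean H l {#x#} \<partial>count_space UNIV) = uniform_rate * mean H l {#x#}"
    by (simp add: integral_rate)
  finally have 2: "generator l x - uniform_rate * mean H l {#x#} = (\<integral>\<zeta>. rate x \<zeta> * ?\<Delta> \<zeta> \<partial>count_space UNIV)" by simp
  have "\<bar>(mean H (l + h) {#x#} - mean H l {#x#}) / h - (generator l x - uniform_rate * mean H l {#x#})\<bar> =
    norm (\<integral>\<zeta>. (quotient x h \<zeta> - rate x \<zeta>) * ?\<Delta> \<zeta> \<partial>count_space UNIV)"
    unfolding 1 2 using int_q int_r by (simp add: left_diff_distrib)
  also have "\<dots> \<le> (\<integral>\<zeta>. \<bar>quotient x h \<zeta> - rate x \<zeta>\<bar> * C \<partial>count_space UNIV)"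
  proof (rule order_trans[OF integral_norm_bound integral_mono], rule integrable_norm)
    show "integrable (count_space UNIV) (\<lambda>\<zeta>. (quotient x h \<zeta> - rate x \<zeta>) * ?\<Delta> \<zeta>)"
      unfolding left_diff_distrib by (intro Bochner_Integration.integrable_diff int_q int_r)
    show "integrable (count_space UNIV) (\<lambda>\<zeta>. \<bar>quotient x h \<zeta> - rate x \<zeta>\<bar> * C)"
      by (intro integrable_mult_left integrable_abs Bochner_Integration.integrable_diff integrable_rate integrable_quotient)
    show "norm ((quotient x h \<zeta> - rate x \<zeta>) * ?\<Delta> \<zeta>) \<le> \<bar>quotient x h \<zeta> - rate x \<zeta>\<bar> * C" for \<zeta>
      by (simp add: abs_mult mult_left_mono mean_diff_le)
  qed
  also have "\<dots> = C * rate_error x h"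
    unfolding rate_error_def by simp
  finally show ?thesis .
qed

text \<open>
  For \<open>s\<close> on either side of \<open>t\<close> the difference quotient over the interval between them is compared
  with the generator at its left end \<open>min s t\<close>.
\<close>

lemma mean_deriv:
  assumes t: "0 \<le> t"
  shows "((\<lambda>s. mean H s {#x#}) has_real_derivative generator t x - uniform_rate * mean H t {#x#}) (at t within {0..})"
proof -
  let ?u = "\<lambda>s. mean H s {#x#}" and ?G = "\<lambda>s. generator s x - uniform_rate * mean H s {#x#}"
  have "isCont ?G t"
    by (intro continuous_intros continuous_generator continuous_mean)
  moreover have "((\<lambda>s. min s t) \<longlongrightarrow> min t t) (at t within {0..})"
    by (intro tendsto_intros)
  ultimately have G: "((\<lambda>s. ?G (min s t)) \<longlongrightarrow> ?G t) (at t within {0..})"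
    by (intro isCont_tendsto_compose[of t ?G]) simp_all
  have "((\<lambda>s. \<bar>s - t\<bar>) \<longlongrightarrow> \<bar>t - t\<bar>) (at t within {0..})"
    by (intro tendsto_intros)
  then have "filterlim (\<lambda>s. \<bar>s - t\<bar>) (at_right 0) (at t within {0..})"
    by (auto simp: filterlim_at eventually_at_filter)
  from filterlim_compose[OF rate_error_tendsto this, of x]
  have E: "((\<lambda>s. C * rate_error x \<bar>s - t\<bar>) \<longlongrightarrow> C * 0) (at t within {0..})"
    by (intro tendsto_mult tendsto_const)
  have ev: "\<forall>\<^sub>F s in at t within {0..}. \<bar>(?u s - ?u t) / (s - t) - ?G (min s t)\<bar> \<le> C * rate_error x \<bar>s - t\<bar>"
  proof (unfold eventually_at_filter, intro always_eventually allI impI)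
    fix s assume s: "s \<noteq> t" "s \<in> {0..}"
    show "\<bar>(?u s - ?u t) / (s - t) - ?G (min s t)\<bar> \<le> C * rate_error x \<bar>s - t\<bar>"
    proof (cases "t < s")
      case True
      then show ?thesis using mean_quotient[of "s - t" t x] t by simp
    next
      case False
      moreover have "(?u t - ?u s) / (t - s) = (?u s - ?u t) / (s - t)"
        by (metis minus_diff_eq minus_divide_divide)
      ultimately show ?thesis using mean_quotient[of "t - s" s x] s by simp
    qed
  qed
  have "((\<lambda>s. \<bar>(?u s - ?u t) / (s - t) - ?G (min s t)\<bar>) \<longlongrightarrow> 0) (at t within {0..})"
    by (rule tendsto_sandwich[OF _ ev tendsto_const E[simplified mult_zero_right]]) simp
  then have lim: "((\<lambda>s. (?u s - ?u t) / (s - t) - ?G (min s t)) \<longlongrightarrow> 0) (at t within {0..})"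
    by (rule tendsto_rabs_zero_cancel)
  from tendsto_add[OF lim G] show ?thesis
    by (simp add: has_field_derivative_iff)
qed

text \<open>
  Integrating the derivative of \<open>exp (- uniform_rate (t - s)) * mean H s {#x#}\<close>. All terms are nonnegative
  because the rates were uniformised.
\<close>

lemma backward_mild_bounded:
  assumes t: "0 \<le> t"
  shows "(\<integral>\<^sup>+\<zeta>. ennreal (H \<zeta>) \<partial>law t {#x#}) = ennreal (exp (- uniform_rate * t)) * ennreal (H {#x#}) +
    (\<integral>\<^sup>+s\<in>{0..t}. ennreal (exp (- uniform_rate * (t - s))) *
      (\<Sum>\<^sup>+\<zeta>. ennreal (rate x \<zeta>) * (\<integral>\<^sup>+\<rho>. ennreal (H \<rho>) \<partial>law s \<zeta>)) \<partial>lborel)"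
proof -
  let ?c = uniform_rate
  let ?F = "\<lambda>s. exp (- ?c * (t - s)) * mean H s {#x#}"
  let ?f = "\<lambda>s. exp (- ?c * (t - s)) * generator s x"
  have deriv: "(?F has_vector_derivative ?f s) (at s within {0..t})" if "0 \<le> s" for s
  proof -
    have e: "((\<lambda>s. exp (- ?c * (t - s))) has_real_derivative exp (- ?c * (t - s)) * ?c) (at s within {0..t})"
      by (auto intro!: derivative_eq_intros)
    have "((\<lambda>s. mean H s {#x#}) has_real_derivative generator s x - ?c * mean H s {#x#}) (at s within {0..t})"
      by (rule DERIV_subset[OF mean_deriv[OF that]]) auto
    from DERIV_mult[OF e this] have "(?F has_real_derivative ?f s) (at s within {0..t})"
      by (rule DERIV_cong) (simp add: algebra_simps)
    then show ?thesis by (simp add: has_real_derivative_iff_has_vector_derivative)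
  qed
  have "has_bochner_integral lborel (\<lambda>s. indicator {0..t} s *\<^sub>R ?f s) (?F t - ?F 0)"
  proof (rule has_bochner_integral_FTC_Icc[OF t])
    show "(?F has_vector_derivative ?f s) (at s within {0..t})" if "0 \<le> s" "s \<le> t" for s
      by (rule deriv[OF that(1)])
    show "continuous_on {0..t} ?f"
      by (intro continuous_at_imp_continuous_on ballI continuous_intros continuous_generator)
  qed
  then have "(\<integral>\<^sup>+s. ennreal (indicator {0..t} s *\<^sub>R ?f s) \<partial>lborel) = ennreal (?F t - ?F 0)"
    by (subst nn_integral_eq_integral) (auto simp: has_bochner_integral_iff generator_nonneg intro!: AE_I2)
  moreover have "ennreal (indicator {0..t} s *\<^sub>R ?f s) =
      ennreal (exp (- ?c * (t - s))) * ennreal (generator s x) * indicator {0..t} s" for s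
    by (auto simp: ennreal_mult generator_nonneg split: split_indicator)
  ultimately have I: "(\<integral>\<^sup>+s\<in>{0..t}. ennreal (exp (- ?c * (t - s))) * ennreal (generator s x) \<partial>lborel) = ennreal (?F t - ?F 0)"
    by simp
  have F0: "?F 0 = exp (- ?c * t) * H {#x#}"
    by (simp add: mean_def law_0 integral_return)
  have "0 \<le> ?F t - ?F 0"
  proof -
    have "0 \<le> (\<integral>s. indicator {0..t} s *\<^sub>R ?f s \<partial>lborel)"
      by (rule integral_nonneg_AE) (auto simp: generator_nonneg)
    then show ?thesis
      using \<open>has_bochner_integral lborel (\<lambda>s. indicator {0..t} s *\<^sub>R ?f s) (?F t - ?F 0)\<close>
      by (simp add: has_bochner_integral_iff)
  qed
  then have "ennreal (?F t) = ennreal (?F 0) + ennreal (?F t - ?F 0)"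
    using mean_bounds(1)[of 0 "{#x#}"] by (subst ennreal_plus[symmetric]) auto
  then show ?thesis
    unfolding nn_integral_generator I unfolding nn_integral_H F0 using H(1)[of "{#x#}"]
    by (simp add: ennreal_mult)
qed

end
end

context branching_walk
begin

lemma nn_integral_law_measurable:
  assumes H: "\<And>\<zeta>. 0 \<le> H \<zeta>"
  shows "(\<lambda>t. \<integral>\<^sup>+\<zeta>. ennreal (H \<zeta>) \<partial>law t \<xi>) \<in> borel_measurable borel"
    and "(\<integral>\<^sup>+\<zeta>. ennreal (H \<zeta>) \<partial>law t \<xi>) =
      (SUP N. \<integral>\<^sup>+\<zeta>. ennreal (min (H \<zeta>) (real N)) \<partial>law t \<xi>)"
proof -
  have bdd: "0 \<le> min (H \<zeta>) (real N)" "min (H \<zeta>) (real N) \<le> real N" for \<zeta> N using H by auto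
  have meas: "(\<lambda>t. \<integral>\<^sup>+\<zeta>. ennreal (min (H \<zeta>) (real N)) \<partial>law t \<xi>) \<in> borel_measurable borel" for N
    unfolding nn_integral_H[of "\<lambda>\<zeta>. min (H \<zeta>) (real N)" "real N", OF bdd]
    using continuous_mean[of "\<lambda>\<zeta>. min (H \<zeta>) (real N)" "real N", OF bdd]
    by (intro measurable_compose[OF _ measurable_ennreal] borel_measurable_continuous_onI continuous_at_imp_continuous_on) auto
  have sup: "ennreal (H \<zeta>) = (SUP N. ennreal (min (H \<zeta>) (real N)))" for \<zeta>
  proof (rule antisym)
    obtain N where "H \<zeta> \<le> real N" using real_arch_simple by blast
    then have "ennreal (H \<zeta>) = ennreal (min (H \<zeta>) (real N))" by simp
    also have "\<dots> \<le> (SUP N. ennreal (min (H \<zeta>) (real N)))" by (rule SUP_upper) simp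
    finally show "ennreal (H \<zeta>) \<le> (SUP N. ennreal (min (H \<zeta>) (real N)))" .
  qed (auto intro!: SUP_least ennreal_leI)
  show eq: "(\<integral>\<^sup>+\<zeta>. ennreal (H \<zeta>) \<partial>law t \<xi>) =
      (SUP N. \<integral>\<^sup>+\<zeta>. ennreal (min (H \<zeta>) (real N)) \<partial>law t \<xi>)" for t
    unfolding sup
    by (rule nn_integral_monotone_convergence_SUP) (auto simp: incseq_def le_fun_def intro!: ennreal_leI)
  show "(\<lambda>t. \<integral>\<^sup>+\<zeta>. ennreal (H \<zeta>) \<partial>law t \<xi>) \<in> borel_measurable borel"
    unfolding eq using meas by measurable
qed

text \<open>
  Monotone convergence along the truncations of the function.
\<close>

theorem backward_mild:
  assumes H: "\<And>\<zeta>. 0 \<le> H \<zeta>" and t: "0 \<le> t"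
  shows "(\<integral>\<^sup>+\<zeta>. ennreal (H \<zeta>) \<partial>law t {#x#}) = ennreal (exp (- uniform_rate * t)) * ennreal (H {#x#}) +
    (\<integral>\<^sup>+s\<in>{0..t}. ennreal (exp (- uniform_rate * (t - s))) *
      (\<Sum>\<^sup>+\<zeta>. ennreal (rate x \<zeta>) * (\<integral>\<^sup>+\<rho>. ennreal (H \<rho>) \<partial>law s \<zeta>)) \<partial>lborel)"
proof -
  let ?H = "\<lambda>N \<zeta>. min (H \<zeta>) (real N)"
  let ?e = "\<lambda>s. ennreal (exp (- uniform_rate * (t - s)))"
  let ?U = "\<lambda>N s \<zeta>. \<integral>\<^sup>+\<rho>. ennreal (?H N \<rho>) \<partial>law s \<zeta>"
  let ?I = "\<lambda>N s. ?e s * (\<Sum>\<^sup>+\<zeta>. ennreal (rate x \<zeta>) * ?U N s \<zeta>) * indicator {0..t} s"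
  have bdd: "0 \<le> ?H N \<zeta>" "?H N \<zeta> \<le> real N" for \<zeta> N using H by auto
  have U_mono: "?U N s \<zeta> \<le> ?U N' s \<zeta>" if "N \<le> N'" for N N' s \<zeta>
    using that by (intro nn_integral_mono ennreal_leI) auto
  have U_meas [measurable]: "(\<lambda>s. ?U N s \<zeta>) \<in> borel_measurable borel" for N \<zeta>
    by (rule nn_integral_law_measurable(1)) (use bdd in auto)
  have [measurable]: "(\<lambda>s. \<Sum>\<^sup>+\<zeta>. ennreal (rate x \<zeta>) * ?U N s \<zeta>) \<in> borel_measurable borel" for N
    by (rule borel_measurable_nn_integral_countable) measurable
  have U_sup: "(\<integral>\<^sup>+\<rho>. ennreal (H \<rho>) \<partial>law s \<zeta>) = (SUP N. ?U N s \<zeta>)" for s \<zeta>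
    by (rule nn_integral_law_measurable(2)[OF H])
  have rate_sup: "(\<Sum>\<^sup>+\<zeta>. ennreal (rate x \<zeta>) * (SUP N. ?U N s \<zeta>)) =
    (SUP N. \<Sum>\<^sup>+\<zeta>. ennreal (rate x \<zeta>) * ?U N s \<zeta>)" for s
    unfolding SUP_mult_left_ennreal
    by (rule nn_integral_monotone_convergence_SUP)
      (auto simp: incseq_def le_fun_def intro!: mult_left_mono U_mono)
  have "(\<integral>\<^sup>+s\<in>{0..t}. ?e s * (\<Sum>\<^sup>+\<zeta>. ennreal (rate x \<zeta>) * (SUP N. ?U N s \<zeta>)) \<partial>lborel) =
    (\<integral>\<^sup>+s. (SUP N. ?I N s) \<partial>lborel)"
    unfolding rate_sup by (simp only: SUP_mult_left_ennreal SUP_mult_right_ennreal)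
  also have "\<dots> = (SUP N. \<integral>\<^sup>+s. ?I N s \<partial>lborel)"
    by (rule nn_integral_monotone_convergence_SUP)
      (auto simp: incseq_def le_fun_def intro!: mult_right_mono mult_left_mono nn_integral_mono U_mono)
  finally have I_sup: "(\<integral>\<^sup>+s\<in>{0..t}. ?e s * (\<Sum>\<^sup>+\<zeta>. ennreal (rate x \<zeta>) * (SUP N. ?U N s \<zeta>)) \<partial>lborel) =
    (SUP N. \<integral>\<^sup>+s. ?I N s \<partial>lborel)" .
  have start: "ennreal (H {#x#}) = (SUP N. ennreal (?H N {#x#}))"
    using U_sup[of 0 "{#x#}"] by (simp add: law_0)
  have "(SUP N. ?U N t {#x#}) = (SUP N. ennreal (exp (- uniform_rate * t)) * ennreal (?H N {#x#}) + (\<integral>\<^sup>+s. ?I N s \<partial>lborel))"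
    by (intro SUP_cong refl backward_mild_bounded[OF bdd t])
  also have "\<dots> = (SUP N. ennreal (exp (- uniform_rate * t)) * ennreal (?H N {#x#})) + (SUP N. \<integral>\<^sup>+s. ?I N s \<partial>lborel)"
    by (rule ennreal_SUP_add)
      (auto simp: incseq_def intro!: mult_left_mono mult_right_mono nn_integral_mono U_mono ennreal_leI)
  finally show ?thesis
    unfolding U_sup I_sup start SUP_mult_left_ennreal[symmetric] .
qed

end

section \<open>Moments of the branching mechanism\<close>

lemma summable_abs_if_eventually_nonneg:
  fixes c :: "nat \<Rightarrow> real"
  assumes "summable c" "\<And>n. N \<le> n \<Longrightarrow> 0 \<le> c n"
  shows "summable (\<lambda>n. \<bar>c n\<bar>)"
proof -
  have "(\<lambda>n. \<bar>c (n + N)\<bar>) = (\<lambda>n. c (n + N))" using assms(2) by auto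
  moreover have "summable (\<lambda>n. c (n + N))" using assms(1) by (simp add: summable_iff_shift)
  ultimately have "summable (\<lambda>n. \<bar>c (n + N)\<bar>)" by simp
  then show ?thesis by (simp only: summable_iff_shift[of "\<lambda>n. \<bar>c n\<bar>"])
qed

text \<open>
  For a power series with eventually nonnegative coefficients, the difference quotients at \<open>1\<close>
  dominate the partial sums of \<open>\<Sum> c n (1 + u + ... + u ^ (n - 1))\<close>, which tend to the partial sums of
  \<open>\<Sum> n c n\<close>. So a finite one-sided derivative at \<open>1\<close> forces the differentiated series to converge there.
  The second conclusion allows the argument to be repeated for the next derivative.
\<close>

lemma summable_diffs_of_derivative:
  fixes c :: "nat \<Rightarrow> real" and g G :: "real \<Rightarrow> real"
  assumes c: "summable c" "\<And>n. 2 \<le> n \<Longrightarrow> 0 \<le> c n"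
    and g: "\<And>u. u \<in> {0..1} \<Longrightarrow> g u = (\<Sum>n. c n * u ^ n)"
    and deriv: "\<And>u. u \<in> {0..1} \<Longrightarrow> (g has_real_derivative G u) (at u within {0..1})"
    and cont: "continuous_on {0..1} G"
  shows "summable (diffs c)" and "\<And>u. u \<in> {0..1} \<Longrightarrow> G u = (\<Sum>n. diffs c n * u ^ n)"
proof -
  have summ: "summable (\<lambda>n. c n * u ^ n)" if "u \<in> {0..1}" for u
  proof (rule summable_comparison_test_ev)
    show "summable (\<lambda>n. \<bar>c n\<bar>)"
      by (rule summable_abs_if_eventually_nonneg[OF c(1), of 2]) (rule c(2))
    show "\<forall>\<^sub>F n in sequentially. norm (c n * u ^ n) \<le> \<bar>c n\<bar>"
      using that by (auto simp: abs_mult power_abs intro!: always_eventually mult_left_le power_le_one)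
  qed
  have bounded: "(\<Sum>n\<in>{2..N}. real n * c n) \<le> G 1 - c 1" for N
  proof -
    have quot: "((\<lambda>u. (g u - g 1) / (u - 1)) \<longlongrightarrow> G 1) (at 1 within {0..1})"
      using deriv[of 1] by (simp add: has_field_derivative_iff)
    have "((\<lambda>u. \<Sum>n\<in>{2..N}. c n * (\<Sum>j<n. u ^ j)) \<longlongrightarrow> (\<Sum>n\<in>{2..N}. c n * (\<Sum>j<n. 1 ^ j))) (at 1 within {0..1 :: real})"
      by (intro tendsto_intros)
    moreover have "\<forall>\<^sub>F u in at 1 within {0..1}. (\<Sum>n\<in>{2..N}. c n * (\<Sum>j<n. u ^ j)) \<le> (g u - g 1) / (u - 1) - c 1"
      unfolding eventually_at_filter
    proof (intro always_eventually allI impI)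
      fix u :: real assume u: "u \<noteq> 1" "u \<in> {0..1}"
      \<comment> \<open>The difference quotient of each monomial is a geometric sum, increasing in \<open>u\<close> to \<open>n\<close>.\<close>
      have geo: "(1 - u ^ n) / (1 - u) = (\<Sum>j<n. u ^ j)" for n
        using u by (simp add: sum_gp_strict)
      have "(g u - g 1) / (u - 1) = (g 1 - g u) / (1 - u)"
        by (metis minus_diff_eq minus_divide_divide)
      also have "g 1 - g u = (\<Sum>n. c n * 1 ^ n - c n * u ^ n)"
        using u by (subst suminf_diff[symmetric]) (auto simp: g summ c(1))
      also have "\<dots> / (1 - u) = (\<Sum>n. (c n * 1 ^ n - c n * u ^ n) / (1 - u))"
        using u by (subst suminf_divide) (auto intro!: summable_diff summ c(1))
      also have "\<dots> = (\<Sum>n. c n * (\<Sum>j<n. u ^ j))"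
        by (simp add: geo[symmetric] right_diff_distrib)
      finally have q: "(g u - g 1) / (u - 1) = (\<Sum>n. c n * (\<Sum>j<n. u ^ j))" .
      have s: "summable (\<lambda>n. c n * (\<Sum>j<n. u ^ j))"
      proof -
        have "summable (\<lambda>n. (c n * 1 ^ n - c n * u ^ n) / (1 - u))"
          using u by (intro summable_divide summable_diff summ) (auto simp: c(1))
        then show ?thesis by (simp add: geo[symmetric] right_diff_distrib)
      qed
      \<comment> \<open>The coefficient of index 1 may be negative and is kept; it is the term \<open>c 1\<close> subtracted in the bound.\<close>
      have "(\<Sum>n\<in>insert 1 {2..N}. c n * (\<Sum>j<n. u ^ j)) \<le> (\<Sum>n. c n * (\<Sum>j<n. u ^ j))"
      proof (rule sum_le_suminf[OF s])
        fix n assume "n \<in> - insert 1 {2..N}"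
        then show "0 \<le> c n * (\<Sum>j<n. u ^ j)"
          using u c(2)[of n] by (cases "n = 0") (auto intro!: mult_nonneg_nonneg sum_nonneg)
      qed auto
      then show "(\<Sum>n\<in>{2..N}. c n * (\<Sum>j<n. u ^ j)) \<le> (g u - g 1) / (u - 1) - c 1"
        unfolding q by simp
    qed
    ultimately have "(\<Sum>n\<in>{2..N}. c n * (\<Sum>j<n. 1 ^ j)) \<le> G 1 - c 1"
      by (intro tendsto_le[OF _ tendsto_diff[OF quot tendsto_const]]) (auto simp: trivial_limit_within islimpt_Icc)
    then show ?thesis by (simp add: mult.commute)
  qed
  have "summable (\<lambda>n. real (n + 2) * c (n + 2))"
  proof (rule bounded_imp_summable)
    show "0 \<le> real (n + 2) * c (n + 2)" for n using c(2)[of "n + 2"] by simp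
    show "(\<Sum>n\<le>N. real (n + 2) * c (n + 2)) \<le> G 1 - c 1" for N
      using bounded[of "N + 2"] sum.shift_bounds_cl_nat_ivl[of "\<lambda>n. real n * c n" 0 2 N]
      by (simp only: atMost_atLeast0 add_0)
  qed
  then have "summable (\<lambda>n. diffs c (n + 1))"
    by (simp add: diffs_def)
  then show s: "summable (diffs c)" by (subst (asm) summable_iff_shift)
  have d2: "0 \<le> diffs c n" if "1 \<le> n" for n
    using that c(2)[of "n + 1"] by (simp add: diffs_def)
  have contS: "continuous_on {0..1} (\<lambda>u. \<Sum>n. diffs c n * u ^ n)"
  proof (rule uniform_limit_theorem)
    show "uniform_limit {0..1} (\<lambda>N u. \<Sum>n<N. diffs c n * u ^ n) (\<lambda>u. \<Sum>n. diffs c n * u ^ n) sequentially"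
    proof (rule Weierstrass_m_test)
      show "norm (diffs c n * u ^ n) \<le> \<bar>diffs c n\<bar>" if "u \<in> {0..1}" for n and u :: real
        using that by (auto simp: abs_mult power_abs intro!: mult_left_le power_le_one)
      show "summable (\<lambda>n. \<bar>diffs c n\<bar>)"
        by (rule summable_abs_if_eventually_nonneg[OF s, of 1]) (rule d2)
    qed
  qed (auto intro!: always_eventually continuous_intros)
  have inner: "G u = (\<Sum>n. diffs c n * u ^ n)" if u: "u \<in> {0..<1}" for u
  proof -
    have "((\<lambda>u. \<Sum>n. c n * u ^ n) has_real_derivative (\<Sum>n. diffs c n * u ^ n)) (at u)"
      by (rule termdiffs_strong[of _ 1]) (use u c in auto)
    then have "((\<lambda>u. \<Sum>n. c n * u ^ n) has_real_derivative (\<Sum>n. diffs c n * u ^ n)) (at u within {0..1})"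
      by (rule has_field_derivative_at_within)
    then have "(g has_real_derivative (\<Sum>n. diffs c n * u ^ n)) (at u within {0..1})"
      by (rule has_field_derivative_transform_within[OF _ zero_less_one]) (use u g in auto)
    from has_real_derivative_iff_has_vector_derivative[THEN iffD1, OF this]
      has_real_derivative_iff_has_vector_derivative[THEN iffD1, OF deriv[of u]] u
    show ?thesis
      by (intro vector_derivative_unique_within_closed_interval[of 0 1 u g "G u"]) auto
  qed
  show "G u = (\<Sum>n. diffs c n * u ^ n)" if "u \<in> {0..1}" for u
  proof (cases "u = 1")
    case True
    have "((\<lambda>u. G u - (\<Sum>n. diffs c n * u ^ n)) \<longlongrightarrow> G 1 - (\<Sum>n. diffs c n * 1 ^ n)) (at 1 within {0..1})"
      using bspec[OF continuous_on_diff[OF cont contS, unfolded continuous_on], of 1] by simp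
    moreover have "\<forall>\<^sub>F u in at 1 within {0..1}. G u - (\<Sum>n. diffs c n * u ^ n) = 0"
      unfolding eventually_at_filter using inner by (intro always_eventually) auto
    ultimately have "((\<lambda>u. 0) \<longlongrightarrow> G 1 - (\<Sum>n. diffs c n * 1 ^ n)) (at 1 within {0..1 :: real})"
      by (rule Lim_transform_eventually)
    then have "0 = G 1 - (\<Sum>n. diffs c n * 1 ^ n)"
      by (intro tendsto_unique[OF _ tendsto_const]) (auto simp: trivial_limit_within islimpt_Icc)
    then show ?thesis using True by simp
  qed (use inner that in auto)
qed

lemma diffs_funpow_nonneg:
  assumes "\<And>n. 2 \<le> n \<Longrightarrow> 0 \<le> (b n :: real)" "2 \<le> n" shows "0 \<le> (diffs ^^ r) b n"
  using assms(2) by (induction r arbitrary: n) (auto simp: assms(1) diffs_def)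

text \<open>
  The \<open>r\<close>-fold differentiated coefficient is \<open>(n + 1) ... (n + r) b (n + r)\<close>.
\<close>

lemma diffs_funpow_ge:
  assumes "\<And>n. 2 \<le> n \<Longrightarrow> 0 \<le> (b n :: real)" "2 \<le> n"
  shows "real n ^ r * b (n + r) \<le> (diffs ^^ r) b n"
  using assms(2)
proof (induction r arbitrary: n)
  case (Suc r)
  have "real n ^ Suc r * b (n + Suc r) = real n * (real n ^ r * b (Suc n + r))" by simp
  also have "\<dots> \<le> real (Suc n) * (real (Suc n) ^ r * b (Suc n + r))"
    using assms(1)[of "Suc n + r"] Suc.prems by (intro mult_mono mult_right_mono power_mono) auto
  also have "\<dots> \<le> real (Suc n) * (diffs ^^ r) b (Suc n)"
    using Suc.IH[of "Suc n"] Suc.prems by (intro mult_left_mono) auto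
  finally show ?case by (simp add: diffs_def[of "(diffs ^^ r) b"])
qed simp

text \<open>
  By induction all derived series converge at the right end point, and the falling factorials in them dominate powers.
\<close>

theorem all_derivatives_finite_imp_summable:
  assumes b: "branching_intensity b" and f: "all_derivatives_finite (branching_gf b)"
  shows "summable (\<lambda>n. real n ^ r * b n)"
proof -
  have nonneg: "\<And>n. 2 \<le> n \<Longrightarrow> 0 \<le> b n" and s: "summable b"
    using b by (auto simp: branching_intensity_def sums_iff)
  obtain F where F: "F 0 = branching_gf b"
    "\<And>r u. u \<in> {0..1} \<Longrightarrow> (F r has_real_derivative F (Suc r) u) (at u within {0..1})"
    using f unfolding all_derivatives_finite_def by metis
  have cont: "continuous_on {0..1} (F r)" for r
    using F(2) by (meson DERIV_continuous continuous_on_eq_continuous_within)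
  have "summable ((diffs ^^ r) b) \<and> (\<forall>u\<in>{0..1}. F r u = (\<Sum>n. (diffs ^^ r) b n * u ^ n))" for r
  proof (induction r)
    case 0
    then show ?case using s F(1) by (simp add: branching_gf_def)
  next
    case (Suc r)
    then show ?case
      using summable_diffs_of_derivative[of "(diffs ^^ r) b" "F r" "F (Suc r)"]
        diffs_funpow_nonneg[of b] nonneg F(2)[of _ r] cont[of "Suc r"] by auto
  qed
  then have "summable ((diffs ^^ r) b)" by blast
  then have "summable (\<lambda>n. real (Suc r) ^ r * (diffs ^^ r) b n)" by (rule summable_mult)
  then have "summable (\<lambda>n. real (n + r) ^ r * b (n + r))"
  proof (rule summable_comparison_test_ev[rotated])
    show "\<forall>\<^sub>F n in sequentially. norm (real (n + r) ^ r * b (n + r)) \<le> real (Suc r) ^ r * (diffs ^^ r) b n"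
      unfolding eventually_sequentially
    proof (intro exI[of _ 2] allI impI)
      fix n :: nat assume n: "2 \<le> n"
      have "real (n + r) \<le> real (Suc r) * real n"
        using n mult_right_mono[of 1 "real n" "real r"] by (simp add: algebra_simps)
      then have "real (n + r) ^ r * b (n + r) \<le> (real (Suc r) * real n) ^ r * b (n + r)"
        using n nonneg[of "n + r"] by (intro mult_right_mono power_mono) auto
      also have "\<dots> \<le> real (Suc r) ^ r * (diffs ^^ r) b n"
        using diffs_funpow_ge[of b n r] nonneg n by (simp add: power_mult_distrib mult.assoc mult_left_mono del: of_nat_Suc)
      finally show "norm (real (n + r) ^ r * b (n + r)) \<le> real (Suc r) ^ r * (diffs ^^ r) b n"
        using n nonneg[of "n + r"] by simp
    qed
  qed
  then show ?thesis by (subst (asm) summable_iff_shift)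
qed

section \<open>Moments of sums of independent copies\<close>

text \<open>
  If \<open>m\<close> is the moment sequence of a random variable, this is the \<open>n\<close>-th moment of the sum of \<open>k\<close>
  independent copies.
\<close>

primrec power_moment :: "(nat \<Rightarrow> 'a) \<Rightarrow> nat \<Rightarrow> nat \<Rightarrow> 'a::comm_semiring_1" where
  "power_moment m 0 n = (if n = 0 then 1 else 0)"
| "power_moment m (Suc k) n = (\<Sum>j\<le>n. of_nat (n choose j) * power_moment m k j * m (n - j))"

text \<open>
  The part of \<open>power_moment\<close> that involves only moments of order below \<open>n\<close>; summand \<open>i\<close> collects the
  mixed terms that arise when copy number \<open>i + 1\<close> is added to the first \<open>i\<close> copies.
\<close>

definition cross_moment :: "(nat \<Rightarrow> 'a) \<Rightarrow> nat \<Rightarrow> nat \<Rightarrow> 'a::comm_semiring_1" where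
  "cross_moment m k n = (\<Sum>i<k. \<Sum>j\<in>{0<..<n}. of_nat (n choose j) * power_moment m i j * m (n - j))"

lemma power_moment_0: "m 0 = 1 \<Longrightarrow> power_moment m k 0 = 1"
  by (induction k) auto

lemma sum_atMost_split_ends:
  fixes n :: nat
  assumes "1 \<le> n"
  shows "(\<Sum>j\<le>n. f j) = f 0 + f n + (\<Sum>j\<in>{0<..<n}. (f j :: 'a::comm_monoid_add))"
proof -
  have "{..n} = insert 0 (insert n {0<..<n})" using assms by auto
  then show ?thesis using assms by (simp add: add.assoc)
qed

lemma power_moment_Suc:
  assumes "m 0 = 1" "1 \<le> n"
  shows "power_moment m (Suc k) n = m n + power_moment m k n +
    (\<Sum>j\<in>{0<..<n}. of_nat (n choose j) * power_moment m k j * m (n - j))"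
  unfolding power_moment.simps sum_atMost_split_ends[OF assms(2)]
  using assms(1) by (simp add: power_moment_0)

lemma power_moment_eq_cross:
  assumes "m 0 = 1" "1 \<le> n"
  shows "power_moment m k n = of_nat k * m n + cross_moment m k n"
proof (induction k)
  case (Suc k)
  show ?case unfolding power_moment_Suc[of m, OF assms] Suc
    by (simp add: cross_moment_def distrib_right distrib_left ac_simps)
qed (use assms in \<open>simp add: cross_moment_def\<close>)

lemma power_moment_nonneg:
  fixes m :: "nat \<Rightarrow> real" assumes "\<And>j. 0 \<le> m j" shows "0 \<le> power_moment m k n"
  using assms by (induction k arbitrary: n) (auto intro!: sum_nonneg)

lemma cross_moment_nonneg:
  fixes m :: "nat \<Rightarrow> real" assumes "\<And>j. 0 \<le> m j" shows "0 \<le> cross_moment m k n"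
  unfolding cross_moment_def using assms by (auto intro!: sum_nonneg mult_nonneg_nonneg power_moment_nonneg)

lemma power_moment_ennreal:
  fixes m :: "nat \<Rightarrow> real"
  assumes "\<And>j. 0 \<le> m j" "\<And>j. j \<le> n \<Longrightarrow> M j = ennreal (m j)"
  shows "power_moment M k n = ennreal (power_moment m k n)"
  using assms(2)
proof (induction k arbitrary: n)
  case (Suc k)
  have "power_moment M (Suc k) n = (\<Sum>j\<le>n. ennreal (of_nat (n choose j) * power_moment m k j * m (n - j)))"
    unfolding power_moment.simps
  proof (rule sum.cong[OF refl])
    fix j assume "j \<in> {..n}"
    then have "power_moment M k j = ennreal (power_moment m k j)" "M (n - j) = ennreal (m (n - j))"
      using Suc by auto
    then show "of_nat (n choose j) * power_moment M k j * M (n - j) =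
      ennreal (of_nat (n choose j) * power_moment m k j * m (n - j))"
      using assms(1) power_moment_nonneg[of m k j]
      by (simp add: ennreal_mult ennreal_of_nat_eq_real_of_nat)
  qed
  also have "\<dots> = ennreal (power_moment m (Suc k) n)"
    using assms(1) power_moment_nonneg[of m k] by (simp add: sum_ennreal)
  finally show ?case .
qed (simp add: ennreal_0)

lemma cross_moment_ennreal:
  fixes m :: "nat \<Rightarrow> real"
  assumes "\<And>j. 0 \<le> m j" "\<And>j. j < n \<Longrightarrow> M j = ennreal (m j)"
  shows "cross_moment M k n = ennreal (cross_moment m k n)"
proof -
  have "of_nat (n choose j) * power_moment M i j * M (n - j) =
      ennreal (of_nat (n choose j) * power_moment m i j * m (n - j))" if "j \<in> {0<..<n}" for i j
    using that power_moment_ennreal[of m j M i] assms power_moment_nonneg[of m i j]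
    by (simp add: ennreal_mult ennreal_of_nat_eq_real_of_nat)
  then have "cross_moment M k n = (\<Sum>i<k. \<Sum>j\<in>{0<..<n}. ennreal (of_nat (n choose j) * power_moment m i j * m (n - j)))"
    unfolding cross_moment_def by (intro sum.cong refl)
  also have "\<dots> = ennreal (cross_moment m k n)"
    using assms(1) power_moment_nonneg[of m]
    unfolding cross_moment_def by (simp add: sum_ennreal sum_nonneg)
  finally show ?thesis .
qed

text \<open>
  The parameter \<open>D\<close> records the gain per factor: with \<open>D = 1\<close> this is a crude bound, and with \<open>D = 1 + t\<close> and
  \<open>L = A (1 + t)\<close> it is the growth \<open>(1 + t) ^ (n - 1)\<close> of the moments.
\<close>

lemma power_moment_le:
  fixes m :: "nat \<Rightarrow> real"
  assumes nonneg: "\<And>j. 0 \<le> m j" and m0: "m 0 = 1"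
    and bound: "\<And>j. 1 \<le> j \<Longrightarrow> j \<le> n \<Longrightarrow> m j * D \<le> L ^ j" and D: "1 \<le> D" and L: "0 \<le> L" and n: "1 \<le> n"
  shows "power_moment m k n * D \<le> (real k * L) ^ n"
  using bound n
proof (induction k arbitrary: n)
  case (Suc k)
  have "power_moment m (Suc k) n * D = (\<Sum>j\<le>n. real (n choose j) * (power_moment m k j * (m (n - j) * D)))"
    by (simp add: sum_distrib_right mult.assoc)
  also have "\<dots> \<le> (\<Sum>j\<le>n. real (n choose j) * ((real k * L) ^ j * L ^ (n - j)))"
  proof (intro sum_mono mult_left_mono)
    fix j assume j: "j \<in> {..n}"
    show "power_moment m k j * (m (n - j) * D) \<le> (real k * L) ^ j * L ^ (n - j)"
    proof (cases "j = 0")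
      case True
      then show ?thesis using Suc.prems by (simp add: power_moment_0 m0)
    next
      case j0: False
      then have IH: "power_moment m k j * D \<le> (real k * L) ^ j" using Suc j by auto
      show ?thesis
      proof (cases "j = n")
        case True
        then show ?thesis using IH by (simp add: m0)
      next
        case False
        have "power_moment m k j \<le> power_moment m k j * D"
          using D power_moment_nonneg[of m k j] nonneg by (simp add: mult_le_cancel_left1)
        then have "power_moment m k j \<le> (real k * L) ^ j" using IH by linarith
        moreover have "m (n - j) * D \<le> L ^ (n - j)" using Suc.prems j False by auto
        ultimately show ?thesis
          using nonneg D L power_moment_nonneg[of m k j] by (intro mult_mono) auto
      qed
    qed
  qed auto
  also have "\<dots> = (real k * L + L) ^ n"
    by (simp add: binomial_ring mult.assoc)
  finally show ?case by (simp add: distrib_right add.commute)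
qed (auto simp: power_0_left)

text \<open>
  Every term of the cross moment contains at least two factors, so \<open>D\<close> is gained twice.
\<close>

lemma cross_moment_le:
  fixes m :: "nat \<Rightarrow> real"
  assumes nonneg: "\<And>j. 0 \<le> m j" and m0: "m 0 = 1"
    and bound: "\<And>j. 1 \<le> j \<Longrightarrow> j < n \<Longrightarrow> m j * D \<le> L ^ j" and D: "1 \<le> D" and L: "0 \<le> L"
  shows "cross_moment m k n * D\<^sup>2 \<le> real (k + 1) ^ (n + 1) * L ^ n"
proof -
  have "cross_moment m k n * D\<^sup>2 = (\<Sum>i<k. \<Sum>j\<in>{0<..<n}. real (n choose j) * ((power_moment m i j * D) * (m (n - j) * D)))"
    unfolding cross_moment_def sum_distrib_right
    by (intro sum.cong refl) (simp add: power2_eq_square ac_simps)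
  also have "\<dots> \<le> (\<Sum>i<k. \<Sum>j\<in>{0<..<n}. real (n choose j) * ((real i * L) ^ j * L ^ (n - j)))"
  proof (intro sum_mono mult_left_mono mult_mono)
    fix i j assume "j \<in> {0<..<n}"
    then show "power_moment m i j * D \<le> (real i * L) ^ j"
      using bound nonneg m0 D L by (intro power_moment_le) auto
  qed (use bound nonneg D L in auto)
  also have "\<dots> \<le> (\<Sum>i<k. \<Sum>j\<le>n. real (n choose j) * ((real i * L) ^ j * L ^ (n - j)))"
    using L by (intro sum_mono sum_mono2) auto
  also have "\<dots> = (\<Sum>i<k. (real i * L + L) ^ n)"
    by (simp add: binomial_ring mult.assoc)
  also have "\<dots> \<le> (\<Sum>i<k. (real (k + 1) * L) ^ n)"
  proof (intro sum_mono power_mono)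
    fix i assume "i \<in> {..<k}"
    then have "(real i + 1) * L \<le> real (k + 1) * L" using L by (intro mult_right_mono) auto
    then show "real i * L + L \<le> real (k + 1) * L" by (simp add: distrib_right)
  qed (use L in auto)
  also have "\<dots> = real k * (real (k + 1) ^ n * L ^ n)"
    by (simp add: power_mult_distrib)
  also have "\<dots> \<le> real (k + 1) * (real (k + 1) ^ n * L ^ n)"
    using L by (intro mult_right_mono) auto
  finally show ?thesis by simp
qed

lemma power_moment_measurable:
  fixes m :: "nat \<Rightarrow> 's \<Rightarrow> ennreal"
  assumes "\<And>j. m j \<in> borel_measurable M"
  shows "(\<lambda>s. power_moment (\<lambda>j. m j s) k n) \<in> borel_measurable M"
  using assms by (induction k arbitrary: n) auto

lemma cross_moment_measurable:
  fixes m :: "nat \<Rightarrow> 's \<Rightarrow> ennreal"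
  assumes [measurable]: "\<And>j. m j \<in> borel_measurable M"
  shows "(\<lambda>s. cross_moment (\<lambda>j. m j s) k n) \<in> borel_measurable M"
proof -
  have [measurable]: "(\<lambda>s. power_moment (\<lambda>j. m j s) k n) \<in> borel_measurable M" for k n
    by (rule power_moment_measurable) measurable
  show ?thesis unfolding cross_moment_def by measurable
qed

section \<open>The evolution kernel\<close>

locale moment_walk = branching_walk a b Pr X
  for a :: "int ^ 'd \<Rightarrow> int ^ 'd \<Rightarrow> real" and b :: "nat \<Rightarrow> real"
    and Pr :: "(int ^ 'd) multiset \<Rightarrow> 'w measure" and X :: "real \<Rightarrow> 'w \<Rightarrow> (int ^ 'd) multiset" +
  assumes smooth: "all_derivatives_finite (branching_gf b)"
    and supercritical: "0 < beta_star b"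
begin

lemma summable_offspring: "summable (\<lambda>k. b (k + 2) * real (k + 3) ^ r)"
proof (rule summable_comparison_test_ev)
  have "summable (\<lambda>k. real (k + 2) ^ r * b (k + 2))"
    using all_derivatives_finite_imp_summable[OF branching smooth, of r]
    by (intro summable_ignore_initial_segment)
  then show "summable (\<lambda>k. 2 ^ r * (real (k + 2) ^ r * b (k + 2)))" by (rule summable_mult)
  have le: "norm (b (k + 2) * real (k + 3) ^ r) \<le> 2 ^ r * (real (k + 2) ^ r * b (k + 2))" for k
  proof -
    have "b (k + 2) * real (k + 3) ^ r \<le> b (k + 2) * (2 * real (k + 2)) ^ r"
      by (intro mult_left_mono power_mono) (auto simp: b_nonneg)
    then show ?thesis
      using b_nonneg[of "k + 2"] unfolding power_mult_distrib by (simp add: mult.commute mult.left_commute)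
  qed
  then show "\<forall>\<^sub>F k in sequentially. norm (b (k + 2) * real (k + 3) ^ r) \<le> 2 ^ r * (real (k + 2) ^ r * b (k + 2))"
    by (intro always_eventually allI)
qed

lemma summable_offspring_le:
  assumes "\<And>k. \<bar>f k\<bar> \<le> C * real (k + 3) ^ r"
  shows "summable (\<lambda>k. b (k + 2) * f k)"
proof (rule summable_comparison_test_ev)
  show "summable (\<lambda>k. C * (b (k + 2) * real (k + 3) ^ r))"
    by (rule summable_mult[OF summable_offspring])
  show "\<forall>\<^sub>F k in sequentially. norm (b (k + 2) * f k) \<le> C * (b (k + 2) * real (k + 3) ^ r)"
    using mult_left_mono[OF assms b_nonneg[of "_ + 2"]] b_nonneg
    by (intro always_eventually) (simp add: abs_mult ac_simps)
qed

lemma offspring_mean_sums: "(\<lambda>k. b (k + 2) * real (k + 2)) sums (beta_star b + split_rate)"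
proof -
  have s: "summable (\<lambda>k. b (k + 2) * real (k + 2))"
    by (rule summable_offspring_le[of _ 1 1]) simp
  have "(\<lambda>k. b (k + 2) * real (k + 2) - b (k + 2)) sums ((\<Sum>k. b (k + 2) * real (k + 2)) - split_rate)"
    by (rule sums_diff[OF summable_sums[OF s] split_rate_sums])
  then have "(\<lambda>k. (real (k + 2) - 1) * b (k + 2)) sums ((\<Sum>k. b (k + 2) * real (k + 2)) - split_rate)"
    by (simp add: algebra_simps)
  then have "beta_star b = (\<Sum>k. b (k + 2) * real (k + 2)) - split_rate"
    unfolding beta_star_def by (rule infsum_from_2) (use b_nonneg in auto)
  then show ?thesis using summable_sums[OF s] by simp
qed

text \<open>
  The matrix \<open>\<A> + \<beta>\<^sup>* \<Delta>\<^sub>0 - b\<^sub>0\<close> shifted by \<open>uniform_rate\<close>, which makes all entries nonnegative.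
\<close>

definition evolution :: "int ^ 'd \<Rightarrow> int ^ 'd \<Rightarrow> real" where
  "evolution x y = jump x y + (if x = 0 \<and> y = 0 then beta_star b + split_rate else 0)"

lemma evolution_nonneg: "0 \<le> evolution x y"
  using jump_nonneg supercritical split_rate_nonneg by (simp add: evolution_def)

lemma nn_integral_evolution:
  "(\<Sum>\<^sup>+y. ennreal (evolution x y) * f y) =
    (\<Sum>\<^sup>+y. ennreal (jump x y) * f y) +
    indicator {0} x * (ennreal (beta_star b + split_rate) * f 0)"
proof -
  have "ennreal (evolution x y) * f y = ennreal (jump x y) * f y +
      indicator {0} x * ennreal (beta_star b + split_rate) * f y * indicator {0} y" for y
    using jump_nonneg supercritical split_rate_nonneg
    by (auto simp: evolution_def indicator_def distrib_right)
  then have "(\<Sum>\<^sup>+y. ennreal (evolution x y) * f y) =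
    (\<Sum>\<^sup>+y. ennreal (jump x y) * f y +
      (indicator {0} x * ennreal (beta_star b + split_rate) * f y) * indicator {0} y)"
    by (simp only:)
  also have "\<dots> = (\<Sum>\<^sup>+y. ennreal (jump x y) * f y) +
    (\<Sum>\<^sup>+y. (indicator {0} x * ennreal (beta_star b + split_rate) * f y) * indicator {0} y)"
    by (rule nn_integral_add) auto
  finally show ?thesis unfolding nn_integral_count_space_single by (simp only: mult.assoc)
qed

sublocale K: bounded_kernel evolution uniform_rate "- a 0 0 + beta_star b + split_rate"
proof
  show "(\<Sum>\<^sup>+y. ennreal (evolution x y)) \<le> ennreal (- a 0 0 + beta_star b + split_rate)" for x
    using nn_integral_evolution[of x "\<lambda>_. 1"] supercritical split_rate_nonneg a_diag_neg[of 0]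
    by (auto simp: nn_integral_jump ennreal_plus[symmetric] simp del: ennreal_plus intro!: ennreal_leI)
  show "0 \<le> - a 0 0 + beta_star b + split_rate"
    using supercritical split_rate_nonneg a_diag_neg[of 0] by simp
qed (auto simp: evolution_nonneg uniform_rate_nonneg)

end

section \<open>Moment equations\<close>

text \<open>
  The local and the total particle numbers are treated together: both are additive functions of the
  population that take only the values \<open>0\<close> and \<open>1\<close> on single particles.
\<close>

locale additive_statistic = moment_walk a b Pr X
  for a :: "int ^ 'd \<Rightarrow> int ^ 'd \<Rightarrow> real" and b :: "nat \<Rightarrow> real"
    and Pr :: "(int ^ 'd) multiset \<Rightarrow> 'w measure" and X :: "real \<Rightarrow> 'w \<Rightarrow> (int ^ 'd) multiset" +
  fixes h :: "(int ^ 'd) multiset \<Rightarrow> nat"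
  assumes h_plus: "h (\<eta> + \<xi>) = h \<eta> + h \<xi>"
    and h_single: "h {#x#} \<le> 1"
begin

lemma h_empty: "h {#} = 0"
  using h_plus[of "{#}" "{#}"] by simp

lemma h_single_power: "1 \<le> n \<Longrightarrow> real (h {#x#}) ^ n = real (h {#x#})"
  using h_single[of x] by (cases "h {#x#}") (auto simp: power_0_left)

definition moment :: "nat \<Rightarrow> real \<Rightarrow> (int ^ 'd) multiset \<Rightarrow> ennreal" where
  "moment n t \<xi> = (\<integral>\<^sup>+\<zeta>. ennreal (real (h \<zeta>) ^ n) \<partial>law t \<xi>)"

definition trunc_moment :: "nat \<Rightarrow> nat \<Rightarrow> real \<Rightarrow> (int ^ 'd) multiset \<Rightarrow> ennreal" where
  "trunc_moment N n t \<xi> = (\<integral>\<^sup>+\<zeta>. ennreal (real (min (h \<zeta>) N) ^ n) \<partial>law t \<xi>)"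

text \<open>
  What the lower moments contribute to the \<open>n\<close>-th moment when a particle splits at the origin.
\<close>

definition source :: "nat \<Rightarrow> real \<Rightarrow> ennreal" where
  "source n t = (\<Sum>k. ennreal (b (k + 2)) * cross_moment (\<lambda>j. moment j t {#0#}) (k + 2) n)"

lemma moment_0 [simp]: "moment 0 t \<xi> = 1"
  by (simp add: moment_def)

lemma moment_measurable [measurable]: "(\<lambda>t. moment n t \<xi>) \<in> borel_measurable borel"
  unfolding moment_def by (rule nn_integral_law_measurable) simp

lemma source_measurable [measurable]: "source n \<in> borel_measurable borel"
proof -
  have [measurable]: "(\<lambda>t. cross_moment (\<lambda>j. moment j t {#0#}) k n) \<in> borel_measurable borel" for k
    by (rule cross_moment_measurable) measurable
  show ?thesis unfolding source_def[abs_def] by measurable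
qed

lemma moment_empty: "1 \<le> n \<Longrightarrow> moment n t {#} = 0"
  by (simp add: moment_def law_empty h_empty power_0_left)

lemma trunc_moment_empty: "1 \<le> n \<Longrightarrow> trunc_moment N n t {#} = 0"
  by (simp add: trunc_moment_def law_empty h_empty power_0_left)

lemma moment_replicate:
  assumes t: "0 \<le> t"
  shows "moment n t (replicate_mset k x) = power_moment (\<lambda>j. moment j t {#x#}) k n"
proof (induction k arbitrary: n)
  case 0
  show ?case by (cases n) (auto simp: moment_empty)
next
  case (Suc k)
  have binom: "ennreal (real (h (\<zeta> + \<zeta>')) ^ n) =
    (\<Sum>j\<le>n. of_nat (n choose j) * ennreal (real (h \<zeta>) ^ j) * ennreal (real (h \<zeta>') ^ (n - j)))" for \<zeta> \<zeta>'
    by (simp add: h_plus binomial_ring sum_ennreal[symmetric] ennreal_mult ennreal_of_nat_eq_real_of_nat)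
  have "moment n t (replicate_mset (Suc k) x) = moment n t (replicate_mset k x + {#x#})"
    by simp
  also have "\<dots> = (\<Sum>j\<le>n. of_nat (n choose j) * moment j t (replicate_mset k x) * moment (n - j) t {#x#})"
    unfolding moment_def nn_integral_law_plus[OF t] binom
    by (simp add: nn_integral_sum nn_integral_cmult nn_integral_multc mult.assoc)
  finally show ?case by (simp add: Suc)
qed

text \<open>
  Truncation is subadditive, \<open>min (h + h') N \<le> min h N + min h' N\<close>. In the mixed terms of the binomial
  expansion the truncation is dropped; only the two pure powers keep it.
\<close>

lemma trunc_moment_replicate:
  assumes t: "0 \<le> t" and n: "1 \<le> n"
  shows "trunc_moment N n t (replicate_mset k x) \<le>
    of_nat k * trunc_moment N n t {#x#} + cross_moment (\<lambda>j. moment j t {#x#}) k n"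
proof (induction k)
  case 0
  show ?case using n by (simp add: trunc_moment_empty)
next
  case (Suc k)
  let ?c = "\<lambda>j. of_nat (n choose j) :: ennreal"
  have binom: "ennreal (real (min (h (\<zeta> + \<zeta>')) N) ^ n) \<le>
    ennreal (real (min (h \<zeta>') N) ^ n) + ennreal (real (min (h \<zeta>) N) ^ n) +
    (\<Sum>j\<in>{0<..<n}. ?c j * ennreal (real (h \<zeta>) ^ j) * ennreal (real (h \<zeta>') ^ (n - j)))" for \<zeta> \<zeta>'
  proof -
    let ?p = "real (min (h \<zeta>) N)" and ?q = "real (min (h \<zeta>') N)"
    have "real (min (h (\<zeta> + \<zeta>')) N) ^ n \<le> (?p + ?q) ^ n"
      by (intro power_mono) (auto simp: h_plus)
    also have "\<dots> = ?q ^ n + ?p ^ n + (\<Sum>j\<in>{0<..<n}. real (n choose j) * ?p ^ j * ?q ^ (n - j))"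
      unfolding binomial_ring by (subst sum_atMost_split_ends[OF n]) simp
    also have "(\<Sum>j\<in>{0<..<n}. real (n choose j) * ?p ^ j * ?q ^ (n - j)) \<le>
      (\<Sum>j\<in>{0<..<n}. real (n choose j) * real (h \<zeta>) ^ j * real (h \<zeta>') ^ (n - j))"
      by (intro sum_mono mult_mono mult_left_mono power_mono) auto
    finally have "ennreal (real (min (h (\<zeta> + \<zeta>')) N) ^ n) \<le> ennreal (?q ^ n + ?p ^ n +
       (\<Sum>j\<in>{0<..<n}. real (n choose j) * real (h \<zeta>) ^ j * real (h \<zeta>') ^ (n - j)))"
      by (intro ennreal_leI) simp
    also have "\<dots> = ennreal (?q ^ n) + ennreal (?p ^ n) +
       (\<Sum>j\<in>{0<..<n}. ?c j * ennreal (real (h \<zeta>) ^ j) * ennreal (real (h \<zeta>') ^ (n - j)))"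
      by (simp add: sum_nonneg sum_ennreal[symmetric] ennreal_mult ennreal_of_nat_eq_real_of_nat)
    finally show ?thesis .
  qed
  have "trunc_moment N n t (replicate_mset (Suc k) x) = trunc_moment N n t (replicate_mset k x + {#x#})"
    by simp
  also have "\<dots> \<le> (\<integral>\<^sup>+\<zeta>. \<integral>\<^sup>+\<zeta>'. ennreal (real (min (h \<zeta>') N) ^ n) + ennreal (real (min (h \<zeta>) N) ^ n) +
      (\<Sum>j\<in>{0<..<n}. ?c j * ennreal (real (h \<zeta>) ^ j) * ennreal (real (h \<zeta>') ^ (n - j)))
      \<partial>law t {#x#} \<partial>law t (replicate_mset k x))"
    unfolding trunc_moment_def nn_integral_law_plus[OF t]
    by (intro nn_integral_mono binom)
  also have "\<dots> = trunc_moment N n t {#x#} + trunc_moment N n t (replicate_mset k x) +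
      (\<Sum>j\<in>{0<..<n}. ?c j * moment j t (replicate_mset k x) * moment (n - j) t {#x#})"
    unfolding moment_def trunc_moment_def
    by (simp add: nn_integral_add nn_integral_sum nn_integral_cmult nn_integral_multc mult.assoc)
  also have "\<dots> \<le> trunc_moment N n t {#x#} +
      (of_nat k * trunc_moment N n t {#x#} + cross_moment (\<lambda>j. moment j t {#x#}) k n) +
      (\<Sum>j\<in>{0<..<n}. ?c j * moment j t (replicate_mset k x) * moment (n - j) t {#x#})"
    by (intro add_mono Suc order_refl)
  also have "\<dots> = of_nat (Suc k) * trunc_moment N n t {#x#} + cross_moment (\<lambda>j. moment j t {#x#}) (Suc k) n"
    by (simp add: moment_replicate[OF t] cross_moment_def distrib_right ac_simps)
  finally show ?case .
qed

lemma offspring_suminf: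
  "(\<Sum>k. ennreal (b (k + 2)) * (of_nat (k + 2) * c + cross_moment (\<lambda>j. moment j t {#0#}) (k + 2) n)) =
    ennreal (beta_star b + split_rate) * c + source n t"
proof -
  have "(\<Sum>k. ennreal (b (k + 2)) * (of_nat (k + 2) * c + cross_moment (\<lambda>j. moment j t {#0#}) (k + 2) n)) =
     (\<Sum>k. ennreal (b (k + 2) * real (k + 2)) * c + ennreal (b (k + 2)) * cross_moment (\<lambda>j. moment j t {#0#}) (k + 2) n)"
    using b_nonneg by (intro suminf_cong)
      (simp only: distrib_left ennreal_of_nat_eq_real_of_nat ennreal_mult of_nat_0_le_iff mult.assoc)
  also have "\<dots> = (\<Sum>k. ennreal (b (k + 2) * real (k + 2))) * c + source n t"
    unfolding source_def by (subst suminf_add[symmetric]) (simp_all only: summableI ennreal_suminf_multc)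
  also have "(\<Sum>k. ennreal (b (k + 2) * real (k + 2))) = ennreal (beta_star b + split_rate)"
    by (rule suminf_ennreal_sums[OF offspring_mean_sums]) (simp add: b_nonneg)
  finally show ?thesis .
qed

text \<open>
  Splitting into \<open>k\<close> particles contributes \<open>k\<close> times the \<open>n\<close>-th moment, which is absorbed into the evolution
  kernel, and a cross moment of lower order.
\<close>

lemma rate_moment:
  assumes "0 \<le> s" "1 \<le> n"
  shows "(\<Sum>\<^sup>+\<zeta>. ennreal (rate x \<zeta>) * moment n s \<zeta>) =
    K.app (\<lambda>y. moment n s {#y#}) x + indicator {0} x * source n s"
  unfolding nn_integral_rate moment_replicate[OF assms(1)] K.app_def nn_integral_evolution
  using offspring_suminf[of "moment n s {#0#}" s n] assms
  by (simp add: moment_empty power_moment_eq_cross[of "\<lambda>j. moment j s {#0#}", OF moment_0 assms(2)]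
      indicator_def distrib_left add.assoc del: of_nat_add)

lemma rate_trunc_moment:
  assumes "0 \<le> s" "1 \<le> n"
  shows "(\<Sum>\<^sup>+\<zeta>. ennreal (rate x \<zeta>) * trunc_moment N n s \<zeta>) \<le>
    K.app (\<lambda>y. trunc_moment N n s {#y#}) x + indicator {0} x * source n s"
proof -
  have "(\<Sum>k. ennreal (b (k + 2)) * trunc_moment N n s (replicate_mset (k + 2) 0)) \<le>
    (\<Sum>k. ennreal (b (k + 2)) * (of_nat (k + 2) * trunc_moment N n s {#0#} + cross_moment (\<lambda>j. moment j s {#0#}) (k + 2) n))"
    by (intro suminf_le mult_left_mono trunc_moment_replicate assms) auto
  also have "\<dots> = ennreal (beta_star b + split_rate) * trunc_moment N n s {#0#} + source n s"
    by (rule offspring_suminf)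
  finally show ?thesis
    unfolding nn_integral_rate K.app_def nn_integral_evolution
    using assms by (simp add: trunc_moment_empty indicator_def distrib_left add.assoc add_left_mono del: replicate_mset_Suc add_2_eq_Suc')
qed

definition start :: "int ^ 'd \<Rightarrow> ennreal" where
  "start x = ennreal (real (h {#x#}))"

definition mild_data :: "nat \<Rightarrow> real \<Rightarrow> int ^ 'd \<Rightarrow> ennreal" where
  "mild_data n t x = ennreal (exp (- uniform_rate * t)) * start x +
    (\<integral>\<^sup>+s\<in>{0..t}. ennreal (exp (- uniform_rate * (t - s))) * (indicator {0} x * source n s) \<partial>lborel)"

lemma set_nn_integral_add_mult:
  fixes e f g :: "real \<Rightarrow> ennreal"
  assumes [measurable]: "e \<in> borel_measurable borel" "f \<in> borel_measurable borel" "g \<in> borel_measurable borel"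
  shows "(\<integral>\<^sup>+s\<in>{0..t::real}. e s * (f s + g s) \<partial>lborel) = (\<integral>\<^sup>+s\<in>{0..t}. e s * f s \<partial>lborel) + (\<integral>\<^sup>+s\<in>{0..t}. e s * g s \<partial>lborel)"
  unfolding distrib_left distrib_right by (rule nn_integral_add) measurable

lemma moment_mild:
  assumes t: "0 \<le> t" and n: "1 \<le> n"
  shows "moment n t {#x#} = mild_data n t x +
    (\<integral>\<^sup>+s\<in>{0..t}. ennreal (exp (- uniform_rate * (t - s))) * K.app (\<lambda>y. moment n s {#y#}) x \<partial>lborel)"
proof -
  have "moment n t {#x#} = ennreal (exp (- uniform_rate * t)) * start x +
    (\<integral>\<^sup>+s\<in>{0..t}. ennreal (exp (- uniform_rate * (t - s))) *
      (\<Sum>\<^sup>+\<zeta>. ennreal (rate x \<zeta>) * moment n s \<zeta>) \<partial>lborel)"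
    unfolding moment_def
    by (subst backward_mild[OF _ t]) (simp_all add: start_def h_single_power[OF n])
  also have "(\<integral>\<^sup>+s\<in>{0..t}. ennreal (exp (- uniform_rate * (t - s))) *
      (\<Sum>\<^sup>+\<zeta>. ennreal (rate x \<zeta>) * moment n s \<zeta>) \<partial>lborel) =
    (\<integral>\<^sup>+s\<in>{0..t}. ennreal (exp (- uniform_rate * (t - s))) *
      (K.app (\<lambda>y. moment n s {#y#}) x + indicator {0} x * source n s) \<partial>lborel)"
  proof (intro nn_integral_cong)
    fix s
    show "ennreal (exp (- uniform_rate * (t - s))) *
        (\<Sum>\<^sup>+\<zeta>. ennreal (rate x \<zeta>) * moment n s \<zeta>) * indicator {0..t} s =
      ennreal (exp (- uniform_rate * (t - s))) *
        (K.app (\<lambda>y. moment n s {#y#}) x + indicator {0} x * source n s) * indicator {0..t} s"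
      using rate_moment[OF _ n, of s x] by (cases "s \<in> {0..t}") auto
  qed
  also have "\<dots> = (\<integral>\<^sup>+s\<in>{0..t}. ennreal (exp (- uniform_rate * (t - s))) * K.app (\<lambda>y. moment n s {#y#}) x \<partial>lborel) +
      (\<integral>\<^sup>+s\<in>{0..t}. ennreal (exp (- uniform_rate * (t - s))) * (indicator {0} x * source n s) \<partial>lborel)"
    by (rule set_nn_integral_add_mult) measurable
  finally show ?thesis by (simp only: mild_data_def ac_simps)
qed

lemma trunc_moment_mild:
  assumes t: "0 \<le> t" and n: "1 \<le> n"
  shows "trunc_moment N n t {#x#} \<le> mild_data n t x +
    (\<integral>\<^sup>+s\<in>{0..t}. ennreal (exp (- uniform_rate * (t - s))) * K.app (\<lambda>y. trunc_moment N n s {#y#}) x \<partial>lborel)"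
proof -
  have [measurable]: "(\<lambda>t. trunc_moment N n t \<xi>) \<in> borel_measurable borel" for \<xi>
    unfolding trunc_moment_def by (rule nn_integral_law_measurable) simp
  have "trunc_moment N n t {#x#} = ennreal (exp (- uniform_rate * t)) * ennreal (real (min (h {#x#}) N) ^ n) +
    (\<integral>\<^sup>+s\<in>{0..t}. ennreal (exp (- uniform_rate * (t - s))) *
      (\<Sum>\<^sup>+\<zeta>. ennreal (rate x \<zeta>) * trunc_moment N n s \<zeta>) \<partial>lborel)"
    unfolding trunc_moment_def by (subst backward_mild[OF _ t]) simp_all
  also have "\<dots> \<le> ennreal (exp (- uniform_rate * t)) * start x +
    (\<integral>\<^sup>+s\<in>{0..t}. ennreal (exp (- uniform_rate * (t - s))) *
      (K.app (\<lambda>y. trunc_moment N n s {#y#}) x + indicator {0} x * source n s) \<partial>lborel)"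
  proof (intro add_mono mult_left_mono nn_integral_mono)
    have "real (min (h {#x#}) N) ^ n \<le> real (h {#x#}) ^ n" by (intro power_mono) auto
    then show "ennreal (real (min (h {#x#}) N) ^ n) \<le> start x"
      unfolding start_def using h_single_power[OF n, of x] by (intro ennreal_leI) simp
    fix s
    show "ennreal (exp (- uniform_rate * (t - s))) *
        (\<Sum>\<^sup>+\<zeta>. ennreal (rate x \<zeta>) * trunc_moment N n s \<zeta>) * indicator {0..t} s
      \<le> ennreal (exp (- uniform_rate * (t - s))) *
        (K.app (\<lambda>y. trunc_moment N n s {#y#}) x + indicator {0} x * source n s) * indicator {0..t} s"
      by (cases "s \<in> {0..t}") (auto intro!: mult_left_mono rate_trunc_moment n)
  qed auto
  also have "(\<integral>\<^sup>+s\<in>{0..t}. ennreal (exp (- uniform_rate * (t - s))) *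
      (K.app (\<lambda>y. trunc_moment N n s {#y#}) x + indicator {0} x * source n s) \<partial>lborel) =
      (\<integral>\<^sup>+s\<in>{0..t}. ennreal (exp (- uniform_rate * (t - s))) * K.app (\<lambda>y. trunc_moment N n s {#y#}) x \<partial>lborel) +
      (\<integral>\<^sup>+s\<in>{0..t}. ennreal (exp (- uniform_rate * (t - s))) * (indicator {0} x * source n s) \<partial>lborel)"
    by (rule set_nn_integral_add_mult) measurable
  finally show ?thesis by (simp only: mild_data_def ac_simps)
qed

text \<open>
  The truncated moments are bounded subsolutions, so they lie below the Duhamel solution, and so does
  their supremum. Conversely, the Duhamel solution is bounded and the moment is a solution.
\<close>

lemma moment_eq_duhamel_if_source_bounded:
  assumes n: "1 \<le> n" and t: "0 \<le> t"
    and bound: "\<And>s. 0 \<le> s \<Longrightarrow> s \<le> t \<Longrightarrow> source n s \<le> ennreal R" "0 \<le> R"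
  shows "moment n t {#x#} = K.duhamel 0 start (source n) t x"
proof (rule antisym)
  have super: "mild_data n s y + (\<integral>\<^sup>+u\<in>{0..s}. ennreal (exp (- uniform_rate * (s - u))) * K.app (K.duhamel 0 start (source n) u) y \<partial>lborel)
     = K.duhamel 0 start (source n) s y" if "0 \<le> s" for s y
    unfolding mild_data_def by (rule K.duhamel_mild[OF source_measurable that, symmetric])
  have start: "start y \<le> ennreal 1" for y
    unfolding start_def using h_single[of y] by (intro ennreal_leI) simp
  have "trunc_moment N n t {#x#} \<le> K.duhamel 0 start (source n) t x" for N
  proof (rule K.mild_comparison[where T = t and g = "mild_data n" and K = "real N ^ n" and m = "\<lambda>t x. trunc_moment N n t {#x#}"])
    show "trunc_moment N n s {#y#} \<le> ennreal (real N ^ n)" for s y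
    proof -
      have "trunc_moment N n s {#y#} \<le> (\<integral>\<^sup>+\<zeta>. ennreal (real N ^ n) \<partial>law s {#y#})"
        unfolding trunc_moment_def by (intro nn_integral_mono ennreal_leI power_mono) auto
      then show ?thesis by simp
    qed
  qed (use t n super trunc_moment_mild in auto)
  moreover have "moment n t {#x#} = (SUP N. trunc_moment N n t {#x#})"
  proof -
    have "ennreal (real (h \<zeta>) ^ n) = (SUP N. ennreal (real (min (h \<zeta>) N) ^ n))" for \<zeta>
    proof (rule antisym)
      show "ennreal (real (h \<zeta>) ^ n) \<le> (SUP N. ennreal (real (min (h \<zeta>) N) ^ n))"
        by (rule SUP_upper2[of "h \<zeta>"]) auto
      show "(SUP N. ennreal (real (min (h \<zeta>) N) ^ n)) \<le> ennreal (real (h \<zeta>) ^ n)"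
        by (intro SUP_least ennreal_leI power_mono) auto
    qed
    then show ?thesis
      unfolding moment_def trunc_moment_def
      by (simp, intro nn_integral_monotone_convergence_SUP)
        (auto simp: incseq_def le_fun_def intro!: ennreal_leI power_mono)
  qed
  ultimately show "moment n t {#x#} \<le> K.duhamel 0 start (source n) t x"
    by (auto intro: SUP_least)
  show "K.duhamel 0 start (source n) t x \<le> moment n t {#x#}"
  proof (rule K.mild_comparison[where T = t and g = "mild_data n" and v = "\<lambda>t x. moment n t {#x#}"])
    show "K.duhamel 0 start (source n) s y \<le>
      ennreal (1 * exp ((- a 0 0 + beta_star b + split_rate) * t) + t * exp ((- a 0 0 + beta_star b + split_rate) * t) * R)"
      if "0 \<le> s" "s \<le> t" for s y
      by (rule K.duhamel_bounded[OF start]) (use that bound in auto)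
  qed (use t n super moment_mild in auto)
qed

text \<open>
  The series of the source is dominated by a moment of the branching mechanism and inherits the two
  factors \<open>D\<close> gained in \<open>cross_moment_le\<close>.
\<close>

lemma source_eq_real:
  assumes "\<And>j. j < n \<Longrightarrow> moment j t {#0#} = ennreal (m j)" and nonneg: "\<And>j. 0 \<le> m j" and m0: "m 0 = 1"
    and bound: "\<And>j. 1 \<le> j \<Longrightarrow> j < n \<Longrightarrow> m j * D \<le> L ^ j" and D: "1 \<le> D" and L: "0 \<le> L"
  shows "summable (\<lambda>k. b (k + 2) * cross_moment m (k + 2) n)"
    and "source n t = ennreal (\<Sum>k. b (k + 2) * cross_moment m (k + 2) n)"
    and "(\<Sum>k. b (k + 2) * cross_moment m (k + 2) n) * D\<^sup>2 \<le> L ^ n * (\<Sum>k. b (k + 2) * real (k + 3) ^ (n + 1))"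
proof -
  have le: "cross_moment m (k + 2) n * D\<^sup>2 \<le> L ^ n * real (k + 3) ^ (n + 1)" for k
    using cross_moment_le[of m n D L "k + 2"] nonneg m0 bound D L by (simp add: ac_simps)
  have le1: "cross_moment m (k + 2) n \<le> cross_moment m (k + 2) n * D\<^sup>2" for k
    using D cross_moment_nonneg[of m "k + 2" n] nonneg by (simp add: mult_le_cancel_left1 one_le_power)
  show s: "summable (\<lambda>k. b (k + 2) * cross_moment m (k + 2) n)"
    using cross_moment_nonneg[of m] nonneg order_trans[OF le1 le]
    by (intro summable_offspring_le[of _ "L ^ n" "n + 1"]) simp
  have "source n t = (\<Sum>k. ennreal (b (k + 2) * cross_moment m (k + 2) n))"
    unfolding source_def using assms(1) nonneg b_nonneg cross_moment_nonneg[of m]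
    by (intro suminf_cong) (simp add: cross_moment_ennreal[of m] ennreal_mult)
  also have "\<dots> = ennreal (\<Sum>k. b (k + 2) * cross_moment m (k + 2) n)"
    using s b_nonneg cross_moment_nonneg[of m] nonneg by (intro suminf_ennreal_sums summable_sums) auto
  finally show "source n t = ennreal (\<Sum>k. b (k + 2) * cross_moment m (k + 2) n)" .
  have "(\<Sum>k. b (k + 2) * cross_moment m (k + 2) n) * D\<^sup>2 = (\<Sum>k. b (k + 2) * (cross_moment m (k + 2) n * D\<^sup>2))"
    by (subst suminf_mult2[OF s]) (simp add: mult.assoc)
  also have "\<dots> \<le> (\<Sum>k. L ^ n * (b (k + 2) * real (k + 3) ^ (n + 1)))"
  proof (rule suminf_le)
    show "b (k + 2) * (cross_moment m (k + 2) n * D\<^sup>2) \<le> L ^ n * (b (k + 2) * real (k + 3) ^ (n + 1))" for k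
      using mult_left_mono[OF le[of k] b_nonneg[of "k + 2"]] by (simp add: ac_simps)
    show "summable (\<lambda>k. b (k + 2) * (cross_moment m (k + 2) n * D\<^sup>2))"
      using summable_mult2[OF s, of "D\<^sup>2"] by (simp add: mult.assoc)
    show "summable (\<lambda>k. L ^ n * (b (k + 2) * real (k + 3) ^ (n + 1)))"
      by (rule summable_mult[OF summable_offspring])
  qed
  also have "\<dots> = L ^ n * (\<Sum>k. b (k + 2) * real (k + 3) ^ (n + 1))"
    by (rule suminf_mult[OF summable_offspring])
  finally show "(\<Sum>k. b (k + 2) * cross_moment m (k + 2) n) * D\<^sup>2 \<le> L ^ n * (\<Sum>k. b (k + 2) * real (k + 3) ^ (n + 1))" .
qed

definition real_moment :: "nat \<Rightarrow> real \<Rightarrow> int ^ 'd \<Rightarrow> real" where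
  "real_moment n t x = enn2real (moment n t {#x#})"

definition real_source :: "nat \<Rightarrow> real \<Rightarrow> real" where
  "real_source n t = (\<Sum>k. b (k + 2) * cross_moment (\<lambda>j. real_moment j t 0) (k + 2) n)"

lemma real_moment_nonneg: "0 \<le> real_moment n t x"
  by (simp add: real_moment_def)

lemma real_moment_0 [simp]: "real_moment 0 t x = 1"
  by (simp add: real_moment_def)

lemma source_bounded_if:
  assumes IH: "\<And>j. j < n \<Longrightarrow> \<exists>C. \<forall>t\<in>{0..T}. \<forall>x. moment j t {#x#} \<le> ennreal C"
  shows "\<exists>R\<ge>0. \<forall>t\<in>{0..T}. source n t \<le> ennreal R"
proof -
  obtain C where C: "\<And>j t x. j < n \<Longrightarrow> t \<in> {0..T} \<Longrightarrow> moment j t {#x#} \<le> ennreal (C j)"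
    using IH by metis
  \<comment> \<open>One constant, at least 1, whose powers dominate all lower moments.\<close>
  define L where "L = 1 + (\<Sum>j<n. \<bar>C j\<bar>)"
  have L: "1 \<le> L" by (simp add: L_def sum_nonneg)
  have le: "real_moment j t 0 * 1 \<le> L ^ j" if "1 \<le> j" "j < n" "t \<in> {0..T}" for j t
  proof -
    have "real_moment j t 0 \<le> max 0 (C j)"
      unfolding real_moment_def using C[OF that(2,3), of 0]
      by (intro enn2real_leI) (auto simp: max_def ennreal_neg)
    also have "\<dots> \<le> \<bar>C j\<bar>" by simp
    also have "\<dots> \<le> (\<Sum>j<n. \<bar>C j\<bar>)" using that by (intro member_le_sum) auto
    also have "\<dots> \<le> L" by (simp add: L_def)
    also have "\<dots> \<le> L ^ j" using L that by (simp add: self_le_power)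
    finally show ?thesis by simp
  qed
  let ?R = "L ^ n * (\<Sum>k. b (k + 2) * real (k + 3) ^ (n + 1))"
  have "source n t \<le> ennreal ?R" if t: "t \<in> {0..T}" for t
  proof -
    have fin: "moment j t {#0#} = ennreal (real_moment j t 0)" if "j < n" for j
      using le_less_trans[OF C[OF that t, of 0] ennreal_less_top] by (simp add: real_moment_def)
    note eq = source_eq_real[of n t "\<lambda>j. real_moment j t 0" 1 L, OF fin real_moment_nonneg real_moment_0 le[OF _ _ t]]
    show ?thesis using eq(2,3) L by (auto intro!: ennreal_leI)
  qed
  moreover have "0 \<le> ?R"
    using L b_nonneg by (intro mult_nonneg_nonneg suminf_nonneg summable_offspring) auto
  ultimately show ?thesis by blast
qed

text \<open>
  Strong induction: bounded lower moments give a bounded source, hence a bounded Duhamel solution.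
\<close>

lemma moment_bounded: "\<exists>C. \<forall>t\<in>{0..T}. \<forall>x. moment n t {#x#} \<le> ennreal C"
proof (induction n rule: less_induct)
  case (less n)
  show ?case
  proof (cases "n = 0")
    case True
    then show ?thesis by (auto intro!: exI[of _ 1])
  next
    case False
    obtain R where R: "0 \<le> R" "\<And>t. t \<in> {0..T} \<Longrightarrow> source n t \<le> ennreal R"
      using source_bounded_if[OF less] by blast
    have start: "start y \<le> ennreal 1" for y
      unfolding start_def using h_single[of y] by (intro ennreal_leI) simp
    have "moment n t {#x#} \<le> ennreal (1 * exp ((- a 0 0 + beta_star b + split_rate) * T) + T * exp ((- a 0 0 + beta_star b + split_rate) * T) * R)"
      if "t \<in> {0..T}" for t x
    proof -
      have "moment n t {#x#} = K.duhamel 0 start (source n) t x"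
        by (rule moment_eq_duhamel_if_source_bounded[of _ _ R]) (use False that R in auto)
      also have "\<dots> \<le> ennreal (1 * exp ((- a 0 0 + beta_star b + split_rate) * T) + T * exp ((- a 0 0 + beta_star b + split_rate) * T) * R)"
        by (rule K.duhamel_bounded[OF start]) (use that R in auto)
      finally show ?thesis .
    qed
    then show ?thesis by blast
  qed
qed

lemma moment_eq_real: "0 \<le> t \<Longrightarrow> moment n t {#x#} = ennreal (real_moment n t x)"
proof -
  assume t: "0 \<le> t"
  obtain C where "moment n t {#x#} \<le> ennreal C" using moment_bounded[of t n] t by (meson atLeastAtMost_iff order_refl)
  then have "moment n t {#x#} < top" by (rule le_less_trans) simp
  then show ?thesis by (simp add: real_moment_def)
qed

theorem moment_eq_duhamel:
  assumes "1 \<le> n" "0 \<le> t"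
  shows "moment n t {#x#} = K.duhamel 0 start (source n) t x"
proof -
  obtain R where "0 \<le> R" "\<forall>s\<in>{0..t}. source n s \<le> ennreal R"
    using source_bounded_if moment_bounded by meson
  then show ?thesis
    using assms by (intro moment_eq_duhamel_if_source_bounded[of _ _ R]) auto
qed

end

section \<open>Asymptotics of convolutions\<close>

lemma bounded_if_tendsto_at_top:
  fixes f :: "real \<Rightarrow> real"
  assumes lim: "(f \<longlongrightarrow> l) at_top" and loc: "\<And>T. \<exists>C. \<forall>t\<in>{0..T}. f t \<le> C"
  shows "\<exists>C\<ge>0. \<forall>t\<ge>0. f t \<le> C"
proof -
  have "\<forall>\<^sub>F t in at_top. f t < l + 1" using lim by (rule order_tendstoD) simp
  then obtain T where T: "\<And>t. T \<le> t \<Longrightarrow> f t < l + 1" by (auto simp: eventually_at_top_linorder)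
  obtain C where C: "\<And>t. t \<in> {0..T} \<Longrightarrow> f t \<le> C" using loc by blast
  show ?thesis
  proof (intro exI[of _ "max 0 (max C (l + 1))"] conjI allI impI)
    fix t :: real assume "0 \<le> t"
    show "f t \<le> max 0 (max C (l + 1))"
    proof (cases "T \<le> t")
      case True
      then show ?thesis using T[of t] by linarith
    next
      case False
      then show ?thesis using C[of t] \<open>0 \<le> t\<close> by (simp add: le_max_iff_disj)
    qed
  qed simp
qed

text \<open>
  Only the \<open>i\<close> terms in which a single copy carries the whole power survive; every mixed term loses a
  power of \<open>t\<close>.
\<close>

lemma power_moment_tendsto:
  fixes m :: "nat \<Rightarrow> real \<Rightarrow> real"
  assumes m0: "\<And>t. m 0 t = 1"
    and lim: "\<And>j. 1 \<le> j \<Longrightarrow> j \<le> n \<Longrightarrow> ((\<lambda>t. m j t / t ^ (j - 1)) \<longlongrightarrow> J j) at_top"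
    and n: "1 \<le> n"
  shows "((\<lambda>t. power_moment (\<lambda>j. m j t) i n / t ^ (n - 1)) \<longlongrightarrow> real i * J n) at_top"
  using lim n
proof (induction i arbitrary: n)
  case 0
  then show ?case by simp
next
  case (Suc i)
  let ?p = "\<lambda>l t. power_moment (\<lambda>j. m j t) i l"
  have inv: "((\<lambda>t. 1 / t) \<longlongrightarrow> 0) (at_top :: real filter)"
    by (simp add: tendsto_inverse_0_at_top filterlim_ident flip: inverse_eq_divide)
  have "((\<lambda>t. \<Sum>l\<in>{0<..<n}. real (n choose l) * (?p l t / t ^ (l - 1)) * (m (n - l) t / t ^ (n - l - 1)) * (1 / t))
     \<longlongrightarrow> (\<Sum>l\<in>{0<..<n}. real (n choose l) * (real i * J l) * J (n - l) * 0)) at_top"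
  proof (intro tendsto_sum tendsto_mult tendsto_const inv)
    fix l assume l: "l \<in> {0<..<n}"
    show "((\<lambda>t. ?p l t / t ^ (l - 1)) \<longlongrightarrow> real i * J l) at_top"
      using l Suc.prems(1) by (intro Suc.IH) auto
    show "((\<lambda>t. m (n - l) t / t ^ (n - l - 1)) \<longlongrightarrow> J (n - l)) at_top"
      using l by (intro Suc.prems(1)) auto
  qed
  then have "((\<lambda>t. m n t / t ^ (n - 1) + ?p n t / t ^ (n - 1) +
     (\<Sum>l\<in>{0<..<n}. real (n choose l) * (?p l t / t ^ (l - 1)) * (m (n - l) t / t ^ (n - l - 1)) * (1 / t)))
     \<longlongrightarrow> J n + real i * J n + (\<Sum>l\<in>{0<..<n}. real (n choose l) * (real i * J l) * J (n - l) * 0)) at_top"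
    using Suc by (intro tendsto_add) auto
  moreover have "\<forall>\<^sub>F t in at_top. m n t / t ^ (n - 1) + ?p n t / t ^ (n - 1) +
     (\<Sum>l\<in>{0<..<n}. real (n choose l) * (?p l t / t ^ (l - 1)) * (m (n - l) t / t ^ (n - l - 1)) * (1 / t)) =
     power_moment (\<lambda>j. m j t) (Suc i) n / t ^ (n - 1)"
    using eventually_gt_at_top[of 0]
  proof eventually_elim
    fix t :: real assume t: "0 < t"
    have "real (n choose l) * (?p l t / t ^ (l - 1)) * (m (n - l) t / t ^ (n - l - 1)) * (1 / t) =
      real (n choose l) * ?p l t * m (n - l) t / t ^ (n - 1)" if "l \<in> {0<..<n}" for l
    proof -
      have "n - 1 = (l - 1) + (n - l - 1) + 1" using that by auto
      then have "t ^ (n - 1) = t ^ (l - 1) * t ^ (n - l - 1) * t" by (metis power_add power_one_right)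
      then show ?thesis by simp
    qed
    then have "(\<Sum>l\<in>{0<..<n}. real (n choose l) * (?p l t / t ^ (l - 1)) * (m (n - l) t / t ^ (n - l - 1)) * (1 / t)) =
      (\<Sum>l\<in>{0<..<n}. real (n choose l) * ?p l t * m (n - l) t) / t ^ (n - 1)"
      unfolding sum_divide_distrib by (intro sum.cong refl)
    then show "m n t / t ^ (n - 1) + ?p n t / t ^ (n - 1) +
     (\<Sum>l\<in>{0<..<n}. real (n choose l) * (?p l t / t ^ (l - 1)) * (m (n - l) t / t ^ (n - l - 1)) * (1 / t)) =
     power_moment (\<lambda>j. m j t) (Suc i) n / t ^ (n - 1)"
      using power_moment_Suc[of "\<lambda>j. m j t" n i] m0 Suc.prems(2)
      by (simp only: add_divide_distrib)
  qed
  ultimately have "((\<lambda>t. power_moment (\<lambda>j. m j t) (Suc i) n / t ^ (n - 1)) \<longlongrightarrow>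
     J n + real i * J n + (\<Sum>l\<in>{0<..<n}. real (n choose l) * (real i * J l) * J (n - l) * 0)) at_top"
    by (rule Lim_transform_eventually)
  then show ?case by (simp add: algebra_simps del: power_moment.simps)
qed

definition cross_limit :: "(nat \<Rightarrow> real) \<Rightarrow> nat \<Rightarrow> nat \<Rightarrow> real" where
  "cross_limit J k n = (\<Sum>i<k. \<Sum>j\<in>{0<..<n}. real (n choose j) * (real i * J j) * J (n - j))"

lemma cross_moment_tendsto:
  fixes m :: "nat \<Rightarrow> real \<Rightarrow> real"
  assumes m0: "\<And>t. m 0 t = 1"
    and lim: "\<And>j. 1 \<le> j \<Longrightarrow> j < n \<Longrightarrow> ((\<lambda>t. m j t / t ^ (j - 1)) \<longlongrightarrow> J j) at_top"
  shows "((\<lambda>t. cross_moment (\<lambda>j. m j t) k n / t ^ (n - 2)) \<longlongrightarrow> cross_limit J k n) at_top"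
proof -
  have "((\<lambda>t. \<Sum>i<k. \<Sum>j\<in>{0<..<n}. real (n choose j) * (power_moment (\<lambda>j. m j t) i j / t ^ (j - 1)) * (m (n - j) t / t ^ (n - j - 1)))
    \<longlongrightarrow> cross_limit J k n) at_top"
    unfolding cross_limit_def
    by (intro tendsto_sum tendsto_mult tendsto_const power_moment_tendsto m0 lim) auto
  moreover have "(\<Sum>i<k. \<Sum>j\<in>{0<..<n}. real (n choose j) * (power_moment (\<lambda>j. m j t) i j / t ^ (j - 1)) * (m (n - j) t / t ^ (n - j - 1)))
     = cross_moment (\<lambda>j. m j t) k n / t ^ (n - 2)" for t
    unfolding cross_moment_def sum_divide_distrib
  proof (intro sum.cong refl)
    fix i j assume "j \<in> {0<..<n}"
    then have "n - 2 = (j - 1) + (n - j - 1)" by auto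
    then have "t ^ (n - 2) = t ^ (j - 1) * t ^ (n - j - 1)" by (metis power_add)
    then show "real (n choose j) * (power_moment (\<lambda>j. m j t) i j / t ^ (j - 1)) * (m (n - j) t / t ^ (n - j - 1)) =
      real (n choose j) * power_moment (\<lambda>j. m j t) i j * m (n - j) t / t ^ (n - 2)"
      by simp
  qed
  ultimately show ?thesis by simp
qed

lemma cross_limit_pos:
  assumes J: "\<And>j. 1 \<le> j \<Longrightarrow> j < n \<Longrightarrow> 0 < J j" and n: "2 \<le> n"
  shows "0 \<le> cross_limit J k n" and "2 \<le> k \<Longrightarrow> 0 < cross_limit J k n"
proof -
  have nonneg: "0 \<le> real (n choose j) * (real i * J j) * J (n - j)" if "j \<in> {0<..<n}" for i j
    using less_imp_le[OF J[of j]] less_imp_le[OF J[of "n - j"]] that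
    by (intro mult_nonneg_nonneg) auto
  then show "0 \<le> cross_limit J k n" unfolding cross_limit_def by (intro sum_nonneg) auto
  assume k: "2 \<le> k"
  have "0 < real (n choose 1) * (real 1 * J 1) * J (n - 1)"
    using J[of 1] J[of "n - 1"] n by auto
  also have "\<dots> \<le> (\<Sum>j\<in>{0<..<n}. real (n choose j) * (real 1 * J j) * J (n - j))"
    using n nonneg[of _ 1] by (intro member_le_sum[of 1 _ "\<lambda>j. real (n choose j) * (real 1 * J j) * J (n - j)"]) auto
  also have "\<dots> \<le> cross_limit J k n"
    unfolding cross_limit_def using k nonneg
    by (intro member_le_sum[of 1 _ "\<lambda>i. \<Sum>j\<in>{0<..<n}. real (n choose j) * (real i * J j) * J (n - j)"] sum_nonneg) auto
  finally show "0 < cross_limit J k n" .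
qed

text \<open>
  After the substitution \<open>u = t v\<close> the integrand converges to \<open>L R v ^ m\<close> for \<open>0 < v < 1\<close>, dominated by a
  constant.
\<close>

lemma convolution_tendsto:
  fixes k r :: "real \<Rightarrow> real"
  assumes [measurable]: "k \<in> borel_measurable borel" "r \<in> borel_measurable borel"
    and k_lim: "(k \<longlongrightarrow> L) at_top" and k: "\<And>t. 0 \<le> t \<Longrightarrow> 0 \<le> k t" "\<And>t. 0 \<le> t \<Longrightarrow> k t \<le> K"
    and r_lim: "((\<lambda>t. r t / t ^ m) \<longlongrightarrow> R) at_top"
    and r: "\<And>t. 0 \<le> t \<Longrightarrow> 0 \<le> r t" "\<And>t. 0 \<le> t \<Longrightarrow> r t \<le> C * (1 + t) ^ m"
  shows "((\<lambda>t. enn2real (\<integral>\<^sup>+u\<in>{0..t}. ennreal (k (t - u)) * ennreal (r u) \<partial>lborel) / t ^ (m + 1)) \<longlongrightarrow> L * R / real (m + 1)) at_top"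
proof -
  \<comment> \<open>The rescaled integrand, after dividing by the power of \<open>t\<close>.\<close>
  let ?g = "\<lambda>t v. indicator {0..1} v * (k (t * (1 - v)) * (r (t * v) / t ^ m))"
  have K: "0 \<le> K" using k[of 0] by simp
  have C: "0 \<le> C" using r[of 0] by simp
  have bound: "norm (?g t v) \<le> indicator {0..1} v * (K * (C * 2 ^ m))" if t: "1 \<le> t" for t v
  proof (cases "v \<in> {0..1}")
    case True
    have "r (t * v) \<le> C * (1 + t * v) ^ m" using r(2)[of "t * v"] t True by simp
    also have "\<dots> \<le> C * (2 * t) ^ m"
    proof (intro mult_left_mono power_mono C)
      have "t * v \<le> t * 1" using t True by (intro mult_left_mono) auto
      then show "1 + t * v \<le> 2 * t" using t by linarith
      show "0 \<le> 1 + t * v" using t True by simp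
    qed
    finally have "r (t * v) / t ^ m \<le> C * 2 ^ m"
      using t by (simp add: power_mult_distrib field_simps)
    moreover have "0 \<le> r (t * v) / t ^ m" using r(1)[of "t * v"] t True by simp
    moreover have "0 \<le> k (t * (1 - v))" "k (t * (1 - v)) \<le> K" using k[of "t * (1 - v)"] t True by auto
    ultimately have "k (t * (1 - v)) * (r (t * v) / t ^ m) \<le> K * (C * 2 ^ m)"
      and nn: "0 \<le> k (t * (1 - v)) * (r (t * v) / t ^ m)"
      using K by (blast intro: mult_mono mult_nonneg_nonneg)+
    moreover have "?g t v = k (t * (1 - v)) * (r (t * v) / t ^ m)" using True by simp
    ultimately show ?thesis unfolding real_norm_def using True abs_of_nonneg[OF nn] by (metis indicator_eq_1_iff mult_1)
  qed simp
  have "((\<lambda>t. \<integral>v. ?g t v \<partial>lborel) \<longlongrightarrow> (\<integral>v. indicator {0..1} v * (L * (R * v ^ m)) \<partial>lborel)) at_top"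
  proof (rule integral_dominated_convergence_at_top)
    show "integrable lborel (\<lambda>v :: real. indicator {0..1} v * (K * (C * 2 ^ m)) :: real)"
      by (intro integrable_mult_left integrable_real_indicator) auto
    show "\<forall>\<^sub>F t in at_top. AE v in lborel. norm (?g t v) \<le> indicator {0..1} v * (K * (C * 2 ^ m))"
      using eventually_ge_at_top[of 1] by eventually_elim (intro AE_I2 bound)
    have "AE v in lborel. v \<noteq> (0::real)" "AE v in lborel. v \<noteq> (1::real)"
      by (rule AE_lborel_singleton)+
    then show "AE v in lborel. ((\<lambda>t. ?g t v) \<longlongrightarrow> indicator {0..1} v * (L * (R * v ^ m))) at_top"
    proof eventually_elim
      case (elim v)
      show "((\<lambda>t. ?g t v) \<longlongrightarrow> indicator {0..1} v * (L * (R * v ^ m))) at_top"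
      proof (cases "v \<in> {0..1}")
        case True
        then have v: "0 < v" "0 < 1 - v" using elim by auto
        have scale: "filterlim (\<lambda>t. t * c) at_top at_top" if "0 < c" for c :: real
          using filterlim_tendsto_pos_mult_at_top[OF tendsto_const that filterlim_ident] by (simp add: mult.commute)
        have "((\<lambda>t. r (t * v) / (t * v) ^ m * v ^ m) \<longlongrightarrow> R * v ^ m) at_top"
          by (intro tendsto_mult tendsto_const filterlim_compose[OF r_lim scale[OF v(1)]])
        moreover have "r (t * v) / (t * v) ^ m * v ^ m = r (t * v) / t ^ m" for t
          using v by (simp add: power_mult_distrib)
        ultimately have "((\<lambda>t. r (t * v) / t ^ m) \<longlongrightarrow> R * v ^ m) at_top" by simp
        then show ?thesis
          by (intro tendsto_mult tendsto_const filterlim_compose[OF k_lim scale[OF v(2)]])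
      qed simp
    qed
  qed auto
  moreover have "(\<integral>v. indicator {0..1} v * (L * (R * v ^ m)) \<partial>lborel) = L * R / real (m + 1)"
  proof -
    have "(\<integral>v. v ^ m * indicator {0..1} v \<partial>lborel) = 1 ^ Suc m / Suc m - 0 ^ Suc m / real (Suc m)"
    proof (rule integral_FTC_Icc_real)
      show "((\<lambda>v. v ^ Suc m / real (Suc m)) has_real_derivative v ^ m) (at v)" for v :: real
        by (rule DERIV_cong[OF DERIV_cdivide[OF DERIV_pow]]) (simp del: of_nat_Suc)
    qed auto
    moreover have "(\<integral>v. indicator {0..1} v * (L * (R * v ^ m)) \<partial>lborel) = (\<integral>v. (L * R) * (v ^ m * indicator {0..1} v) \<partial>lborel)"
      by (intro Bochner_Integration.integral_cong) (auto simp: ac_simps)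
    ultimately show ?thesis by simp
  qed
  moreover have "\<forall>\<^sub>F t in at_top. (\<integral>v. ?g t v \<partial>lborel) =
      enn2real (\<integral>\<^sup>+u\<in>{0..t}. ennreal (k (t - u)) * ennreal (r u) \<partial>lborel) / t ^ (m + 1)"
    using eventually_ge_at_top[of 1]
  proof eventually_elim
    fix t :: real assume t: "1 \<le> t"
    have g_nonneg: "0 \<le> ?g t v" for v
      using k(1)[of "t * (1 - v)"] r(1)[of "t * v"] t by (auto simp: indicator_def)
    have int: "integrable lborel (?g t)"
    proof (rule Bochner_Integration.integrable_bound)
      show "integrable lborel (\<lambda>v :: real. indicator {0..1} v * (K * (C * 2 ^ m)) :: real)"
        by (intro integrable_mult_left integrable_real_indicator) auto
      show "AE v in lborel. norm (?g t v) \<le> norm (indicator {0..1} v * (K * (C * 2 ^ m)))"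
        by (intro AE_I2 order_trans[OF bound[OF t]]) (simp only: real_norm_def abs_ge_self)
    qed measurable
    have "(\<integral>\<^sup>+u\<in>{0..t}. ennreal (k (t - u)) * ennreal (r u) \<partial>lborel) =
      ennreal t * (\<integral>\<^sup>+v. ennreal (k (t - t * v)) * ennreal (r (t * v)) * indicator {0..t} (t * v) \<partial>lborel)"
    proof -
      have [measurable]: "(\<lambda>u. ennreal (k (t - u)) * ennreal (r u) * indicator {0..t} u) \<in> borel_measurable borel"
        by measurable
      show ?thesis
        using nn_integral_real_affine[of "\<lambda>u. ennreal (k (t - u)) * ennreal (r u) * indicator {0..t} u" t 0] t
        by simp
    qed
    also have "\<dots> = ennreal t * (\<integral>\<^sup>+v. ennreal (t ^ m) * ennreal (?g t v) \<partial>lborel)"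
    proof (rule arg_cong2[where f = "(*)", OF refl], rule nn_integral_cong)
      fix v
      show "ennreal (k (t - t * v)) * ennreal (r (t * v)) * indicator {0..t} (t * v) = ennreal (t ^ m) * ennreal (?g t v)"
      proof (cases "v \<in> {0..1}")
        case True
        then have "t * v \<in> {0..t}" using t by (auto simp: mult_left_le)
        then show ?thesis using True t k(1)[of "t * (1 - v)"] r(1)[of "t * v"]
          by (simp add: ennreal_mult[symmetric] right_diff_distrib)
      next
        case False
        then have "t * v \<notin> {0..t}" using t by (auto simp: zero_le_mult_iff mult_le_cancel_left1)
        then show ?thesis using False by simp
      qed
    qed
    also have "(\<integral>\<^sup>+v. ennreal (t ^ m) * ennreal (?g t v) \<partial>lborel) = ennreal (t ^ m) * (\<integral>\<^sup>+v. ennreal (?g t v) \<partial>lborel)"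
      by (rule nn_integral_cmult) measurable
    also have "(\<integral>\<^sup>+v. ennreal (?g t v) \<partial>lborel) = ennreal (\<integral>v. ?g t v \<partial>lborel)"
      by (rule nn_integral_eq_integral[OF int]) (use g_nonneg in auto)
    finally have I: "(\<integral>\<^sup>+u\<in>{0..t}. ennreal (k (t - u)) * ennreal (r u) \<partial>lborel) =
      ennreal t * (ennreal (t ^ m) * ennreal (\<integral>v. ?g t v \<partial>lborel))" .
    have I0: "0 \<le> (\<integral>v. ?g t v \<partial>lborel)" by (rule integral_nonneg_AE) (use g_nonneg in auto)
    have "z = enn2real (ennreal t * (ennreal (t ^ m) * ennreal z)) / t ^ (m + 1)" if "0 \<le> z" for z
      using t that by (simp add: enn2real_mult)
    from this[OF I0] show "(\<integral>v. ?g t v \<partial>lborel) =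
      enn2real (\<integral>\<^sup>+u\<in>{0..t}. ennreal (k (t - u)) * ennreal (r u) \<partial>lborel) / t ^ (m + 1)"
      unfolding I .
  qed
  ultimately show ?thesis by (auto elim: Lim_transform_eventually)
qed

section \<open>Growth of the moments\<close>

context additive_statistic
begin

lemma source_1: "source 1 t = 0"
proof -
  have "{0<..<1 :: nat} = {}" by auto
  then show ?thesis by (simp only: source_def cross_moment_def sum.empty sum.neutral_const mult_zero_right suminf_zero)
qed

lemma power_split_square: "2 \<le> n \<Longrightarrow> (x :: real) ^ n = x ^ (n - 2) * x\<^sup>2"
  by (metis le_add_diff_inverse2 power_add)

lemma rescaled_bound:
  fixes y :: real
  assumes "y \<le> A * (1 + t) ^ (j - 1)" and A: "1 \<le> A" and t: "0 \<le> t" and j: "1 \<le> j"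
  shows "y * (1 + t) \<le> (A * (1 + t)) ^ j"
proof -
  have "y * (1 + t) \<le> (A * (1 + t) ^ (j - 1)) * (1 + t)"
    using assms(1) t by (intro mult_right_mono) auto
  also have "\<dots> = A * (1 + t) ^ j"
    using j by (cases j) auto
  also have "\<dots> \<le> A ^ j * (1 + t) ^ j"
    using A j t by (intro mult_right_mono self_le_power) auto
  finally show ?thesis by (simp add: power_mult_distrib)
qed

lemma real_source_eq:
  assumes n: "2 \<le> n" and t: "0 \<le> t" and A: "1 \<le> A"
    and bound: "\<And>j. 1 \<le> j \<Longrightarrow> j < n \<Longrightarrow> real_moment j t 0 \<le> A * (1 + t) ^ (j - 1)"
  shows "source n t = ennreal (real_source n t)"
    and "real_source n t \<le> A ^ n * (\<Sum>k. b (k + 2) * real (k + 3) ^ (n + 1)) * (1 + t) ^ (n - 2)"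
    and "0 \<le> real_source n t"
proof -
  have le: "real_moment j t 0 * (1 + t) \<le> (A * (1 + t)) ^ j" if j: "1 \<le> j" "j < n" for j
    by (rule rescaled_bound[OF bound[OF j] A t j(1)])
  note eq = source_eq_real[of n t "\<lambda>j. real_moment j t 0" "1 + t" "A * (1 + t)",
      OF moment_eq_real[OF t] real_moment_nonneg real_moment_0 le]
  show "source n t = ennreal (real_source n t)"
    using eq(2) t A by (simp add: real_source_def)
  have "summable (\<lambda>k. b (k + 2) * cross_moment (\<lambda>j. real_moment j t 0) (k + 2) n)"
    using eq(1) t A by simp
  then show "0 \<le> real_source n t"
    unfolding real_source_def
    by (rule suminf_nonneg) (intro mult_nonneg_nonneg b_nonneg cross_moment_nonneg real_moment_nonneg, simp)
  let ?S = "\<Sum>k. b (k + 2) * real (k + 3) ^ (n + 1)"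
  have "real_source n t * (1 + t)\<^sup>2 \<le> (A * (1 + t)) ^ n * ?S"
    using eq(3) t A by (simp add: real_source_def)
  also have "(A * (1 + t)) ^ n = A ^ n * (1 + t) ^ (n - 2) * (1 + t)\<^sup>2"
    unfolding power_mult_distrib power_split_square[OF n, of "1 + t"] by (simp only: mult.assoc)
  finally have "real_source n t * (1 + t)\<^sup>2 \<le> (A ^ n * ?S * (1 + t) ^ (n - 2)) * (1 + t)\<^sup>2"
    by (simp only: ac_simps)
  then show "real_source n t \<le> A ^ n * ?S * (1 + t) ^ (n - 2)"
    by (rule mult_right_le_imp_le) (use t in simp)
qed

text \<open>
  Tannery's theorem, with a moment of the branching mechanism as majorant. The limit is positive
  since \<open>beta_star b > 0\<close> provides some \<open>k \<ge> 2\<close> with \<open>b k > 0\<close>.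
\<close>

lemma real_source_tendsto:
  assumes n: "2 \<le> n" and A: "1 \<le> A"
    and bound: "\<And>j t. 1 \<le> j \<Longrightarrow> j < n \<Longrightarrow> 0 \<le> t \<Longrightarrow> real_moment j t 0 \<le> A * (1 + t) ^ (j - 1)"
    and lim: "\<And>j. 1 \<le> j \<Longrightarrow> j < n \<Longrightarrow> ((\<lambda>t. real_moment j t 0 / t ^ (j - 1)) \<longlongrightarrow> J j) at_top"
    and J: "\<And>j. 1 \<le> j \<Longrightarrow> j < n \<Longrightarrow> 0 < J j"
  shows "\<exists>R>0. ((\<lambda>t. real_source n t / t ^ (n - 2)) \<longlongrightarrow> R) at_top"
proof -
  let ?c = "\<lambda>k t. cross_moment (\<lambda>j. real_moment j t 0) (k + 2) n"
  let ?M = "\<lambda>k. (A ^ n * 2 ^ (n - 2)) * (b (k + 2) * real (k + 3) ^ (n + 1))"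
  have cross_bound: "\<bar>?c k t / t ^ (n - 2)\<bar> \<le> (A ^ n * 2 ^ (n - 2)) * real (k + 3) ^ (n + 1)" if t: "1 \<le> t" for k t
  proof -
    have "real_moment j t 0 * (1 + t) \<le> (A * (1 + t)) ^ j" if j: "1 \<le> j" "j < n" for j
      using rescaled_bound[OF bound[OF j] A _ j(1), of t] t by simp
    then have "?c k t * (1 + t)\<^sup>2 \<le> real (k + 2 + 1) ^ (n + 1) * (A * (1 + t)) ^ n"
      using t A by (intro cross_moment_le) (auto simp: real_moment_nonneg)
    also have "(A * (1 + t)) ^ n = A ^ n * (1 + t) ^ (n - 2) * (1 + t)\<^sup>2"
      unfolding power_mult_distrib power_split_square[OF n, of "1 + t"] by (simp only: mult.assoc)
    finally have "?c k t * (1 + t)\<^sup>2 \<le> (real (k + 2 + 1) ^ (n + 1) * (A ^ n * (1 + t) ^ (n - 2))) * (1 + t)\<^sup>2"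
      by (simp only: mult.assoc)
    then have "?c k t \<le> real (k + 2 + 1) ^ (n + 1) * (A ^ n * (1 + t) ^ (n - 2))"
      by (rule mult_right_le_imp_le) (use t in simp)
    also have "\<dots> \<le> real (k + 2 + 1) ^ (n + 1) * (A ^ n * (2 * t) ^ (n - 2))"
      using t A by (intro mult_left_mono power_mono) auto
    finally have "?c k t \<le> ((A ^ n * 2 ^ (n - 2)) * real (k + 3) ^ (n + 1)) * t ^ (n - 2)"
      by (simp add: power_mult_distrib ac_simps)
    then have "?c k t / t ^ (n - 2) \<le> (A ^ n * 2 ^ (n - 2)) * real (k + 3) ^ (n + 1)"
      using t by (subst pos_divide_le_eq) auto
    moreover have "0 \<le> ?c k t / t ^ (n - 2)"
      using t cross_moment_nonneg[of "\<lambda>j. real_moment j t 0"] real_moment_nonneg by auto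
    ultimately show ?thesis by simp
  qed
  have tann: "((\<lambda>t. \<Sum>k. b (k + 2) * (?c k t / t ^ (n - 2))) \<longlongrightarrow> (\<Sum>k. b (k + 2) * cross_limit J (k + 2) n)) at_top
     \<and> summable (\<lambda>k. norm (b (k + 2) * cross_limit J (k + 2) n))"
  proof -
    have "((\<lambda>t. b (k + 2) * (?c k t / t ^ (n - 2))) \<longlongrightarrow> b (k + 2) * cross_limit J (k + 2) n) at_top" for k
      by (intro tendsto_mult tendsto_const cross_moment_tendsto lim) auto
    moreover have "\<forall>\<^sub>F (k, t) in at_top \<times>\<^sub>F at_top. norm (b (k + 2) * (?c k t / t ^ (n - 2))) \<le> ?M k"
    proof -
      have bd: "norm (b (k + 2) * (?c k t / t ^ (n - 2))) \<le> ?M k" if "1 \<le> t" for k t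
      proof -
      have "norm (b (k + 2) * (?c k t / t ^ (n - 2))) = b (k + 2) * \<bar>?c k t / t ^ (n - 2)\<bar>"
        using b_nonneg[of "k + 2"] by (simp add: abs_mult)
      also have "\<dots> \<le> b (k + 2) * ((A ^ n * 2 ^ (n - 2)) * real (k + 3) ^ (n + 1))"
        using b_nonneg[of "k + 2"] by (intro mult_left_mono cross_bound \<open>1 \<le> t\<close>) auto
      finally show ?thesis by (simp only: ac_simps)
      qed
      show ?thesis unfolding eventually_prod_filter
        by (rule exI[of _ "\<lambda>_. True"], rule exI[of _ "\<lambda>t. 1 \<le> t"])
          (use bd in \<open>auto simp: eventually_ge_at_top\<close>)
    qed
    moreover have "summable ?M" by (rule summable_mult[OF summable_offspring])
    ultimately show ?thesis
      using tannerys_theorem[of "\<lambda>k t. b (k + 2) * (?c k t / t ^ (n - 2))" _ at_top ?M] by simp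
  qed
  have "(\<Sum>k. b (k + 2) * (?c k t / t ^ (n - 2))) = real_source n t / t ^ (n - 2)" if "1 \<le> t" for t
  proof -
    have "summable (\<lambda>k. b (k + 2) * (?c k t / t ^ (n - 2)))"
      by (rule summable_offspring_le[OF cross_bound[OF that]])
    from summable_mult2[OF this, of "t ^ (n - 2)"] have "summable (\<lambda>k. b (k + 2) * ?c k t)"
      using that by simp
    then show ?thesis unfolding real_source_def by (simp add: suminf_divide)
  qed
  then have "\<forall>\<^sub>F t in at_top. (\<Sum>k. b (k + 2) * (?c k t / t ^ (n - 2))) = real_source n t / t ^ (n - 2)"
    by (intro eventually_mono[OF eventually_ge_at_top[of 1]])
  with tann have "((\<lambda>t. real_source n t / t ^ (n - 2)) \<longlongrightarrow> (\<Sum>k. b (k + 2) * cross_limit J (k + 2) n)) at_top"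
    by (blast intro: Lim_transform_eventually)
  moreover have "0 < (\<Sum>k. b (k + 2) * cross_limit J (k + 2) n)"
  proof -
    \<comment> \<open>Otherwise no branching would ever take place.\<close>
    have "\<exists>k. 0 < b (k + 2)"
    proof (rule ccontr)
      assume "\<not> (\<exists>k. 0 < b (k + 2))"
      then have "b (k + 2) = 0" for k using b_nonneg[of "k + 2"] by (metis One_nat_def add_2_eq_Suc' nat.inject old.nat.distinct(2) order_le_less)
      then have z: "b n = 0" if "1 < n" for n using that by (metis Suc_1 Suc_leI le_add_diff_inverse2)
      have "beta_star b = 0"
        unfolding beta_star_def by (rule infsum_0) (simp add: z)
      then show False using supercritical by simp
    qed
    then obtain k where "0 < b (k + 2)" by blast
    moreover have "0 < cross_limit J (k + 2) n" for k by (rule cross_limit_pos(2)[OF J n]) auto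
    ultimately show ?thesis
      using tann b_nonneg less_imp_le[OF \<open>\<And>k. 0 < cross_limit J (k + 2) n\<close>]
      by (intro suminf_pos2[of _ k] summable_norm_cancel[of "\<lambda>k. b (k + 2) * cross_limit J (k + 2) n"]) auto
  qed
  ultimately show ?thesis by blast
qed

text \<open>
  Convergence controls large times and local boundedness the others.
\<close>

lemma real_moment_polynomial_bound:
  assumes lim: "\<And>j. 1 \<le> j \<Longrightarrow> j < n \<Longrightarrow> ((\<lambda>t. real_moment j t 0 / t ^ (j - 1)) \<longlongrightarrow> J j) at_top"
  shows "\<exists>A\<ge>1. \<forall>j t. 1 \<le> j \<longrightarrow> j < n \<longrightarrow> 0 \<le> t \<longrightarrow> real_moment j t 0 \<le> A * (1 + t) ^ (j - 1)"
proof -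
  have ratio: "((\<lambda>t :: real. t / (1 + t)) \<longlongrightarrow> 1) at_top"
  proof -
    have "((\<lambda>t :: real. 1 - inverse (1 + t)) \<longlongrightarrow> 1 - 0) at_top"
      by (intro tendsto_diff tendsto_const tendsto_inverse_0_at_top
          filterlim_tendsto_add_at_top[OF tendsto_const] filterlim_ident)
    moreover have "\<forall>\<^sub>F t :: real in at_top. 1 - inverse (1 + t) = t / (1 + t)"
      using eventually_ge_at_top[of 0] by eventually_elim (simp add: field_simps)
    ultimately show ?thesis by (auto elim: Lim_transform_eventually)
  qed
  have "\<exists>C\<ge>0. \<forall>t\<ge>0. real_moment j t 0 / (1 + t) ^ (j - 1) \<le> C" if j: "1 \<le> j" "j < n" for j
  proof (rule bounded_if_tendsto_at_top)
    have "((\<lambda>t. real_moment j t 0 / t ^ (j - 1) * (t / (1 + t)) ^ (j - 1)) \<longlongrightarrow> J j * 1 ^ (j - 1)) at_top"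
      by (intro tendsto_mult tendsto_power ratio lim j)
    moreover have "\<forall>\<^sub>F t in at_top. real_moment j t 0 / t ^ (j - 1) * (t / (1 + t)) ^ (j - 1) = real_moment j t 0 / (1 + t) ^ (j - 1)"
      using eventually_gt_at_top[of 0] by eventually_elim (simp add: power_divide)
    ultimately show "((\<lambda>t. real_moment j t 0 / (1 + t) ^ (j - 1)) \<longlongrightarrow> J j * 1 ^ (j - 1)) at_top"
      by (rule Lim_transform_eventually)
    fix T
    obtain C where C: "\<And>t. t \<in> {0..T} \<Longrightarrow> moment j t {#0#} \<le> ennreal C"
      using moment_bounded[of T j] by blast
    have "real_moment j t 0 / (1 + t) ^ (j - 1) \<le> max 0 C" if t: "t \<in> {0..T}" for t
    proof -
      have "real_moment j t 0 \<le> max 0 C"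
        unfolding real_moment_def using C[OF t] by (intro enn2real_leI) (auto simp: max_def ennreal_neg)
      moreover have "real_moment j t 0 / (1 + t) ^ (j - 1) \<le> real_moment j t 0 / 1"
        using t by (intro divide_left_mono real_moment_nonneg) (auto intro: one_le_power)
      ultimately show ?thesis by simp
    qed
    then show "\<exists>C. \<forall>t\<in>{0..T}. real_moment j t 0 / (1 + t) ^ (j - 1) \<le> C" by blast
  qed
  then have "\<forall>j\<in>{1..<n}. \<exists>C\<ge>0. \<forall>t\<ge>0. real_moment j t 0 / (1 + t) ^ (j - 1) \<le> C" by auto
  from bchoice[OF this] obtain C where C: "\<And>j. j \<in> {1..<n} \<Longrightarrow> 0 \<le> C j"
    "\<And>j t. j \<in> {1..<n} \<Longrightarrow> 0 \<le> t \<Longrightarrow> real_moment j t 0 / (1 + t) ^ (j - 1) \<le> C j"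
    by blast
  define A where "A = 1 + (\<Sum>j\<in>{1..<n}. C j)"
  have A: "1 \<le> A" unfolding A_def using sum_nonneg[of "{1..<n}" C] C(1) by simp
  have bound: "real_moment j t 0 \<le> A * (1 + t) ^ (j - 1)" if j: "1 \<le> j" "j < n" and t: "0 \<le> t" for j t
  proof -
    have "C j \<le> (\<Sum>j\<in>{1..<n}. C j)" using j C(1) by (intro member_le_sum) auto
    then have "C j \<le> A" by (simp add: A_def)
    then have "real_moment j t 0 / (1 + t) ^ (j - 1) \<le> A" using C(2)[of j t] j t by auto
    then show ?thesis using t by (subst (asm) pos_divide_le_eq) auto
  qed
  with A show ?thesis by blast
qed

text \<open>
  Induction over the order. In the Duhamel formula the transported initial value stays bounded, so for
  \<open>n \<ge> 2\<close> it is negligible, and the source of order \<open>t ^ (n - 2)\<close> is convolved with a kernel that has a positive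
  limit.
\<close>

theorem real_moment_tendsto:
  assumes ker: "\<And>x. ((\<lambda>t. enn2real (K.kernel t x 0)) \<longlongrightarrow> L x) at_top" "\<And>x. 0 < L x"
    and first: "\<And>x. ((\<lambda>t. enn2real (K.flow t start x)) \<longlongrightarrow> J1 x) at_top" "\<And>x. 0 < J1 x"
    and n: "1 \<le> n"
  shows "\<exists>J. \<forall>x. 0 < J x \<and> ((\<lambda>t. real_moment n t x / t ^ (n - 1)) \<longlongrightarrow> J x) at_top"
  using n
proof (induction n rule: less_induct)
  case (less n)
  show ?case
  proof (cases "n = 1")
    case True
    have "real_moment 1 t x = enn2real (K.flow t start x)" if "0 \<le> t" for t x
      using moment_eq_duhamel[of 1 t x] that by (simp add: real_moment_def K.duhamel_def source_1[unfolded One_nat_def])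
    then have "\<forall>\<^sub>F t in at_top. enn2real (K.flow t start x) = real_moment 1 t x / t ^ (1 - 1)" for x
      by (intro eventually_mono[OF eventually_ge_at_top[of 0]]) simp
    from Lim_transform_eventually[OF first(1) this] show ?thesis
      using first(2) True by blast
  next
    case False
    then have n2: "2 \<le> n" using less.prems by simp
    have "\<forall>j\<in>{1..<n}. \<exists>J. \<forall>x. 0 < J x \<and> ((\<lambda>t. real_moment j t x / t ^ (j - 1)) \<longlongrightarrow> J x) at_top"
      using less.IH by auto
    from bchoice[OF this] obtain J where J':
      "\<forall>j\<in>{1..<n}. \<forall>x. 0 < J j x \<and> ((\<lambda>t. real_moment j t x / t ^ (j - 1)) \<longlongrightarrow> J j x) at_top"
      by blast
    have J: "0 < J j 0" "((\<lambda>t. real_moment j t 0 / t ^ (j - 1)) \<longlongrightarrow> J j 0) at_top" if "1 \<le> j" "j < n" for j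
      using J' that by (simp_all only: atLeastLessThan_iff ball_simps)
    obtain A where A: "1 \<le> A" and bound: "\<And>j t. 1 \<le> j \<Longrightarrow> j < n \<Longrightarrow> 0 \<le> t \<Longrightarrow> real_moment j t 0 \<le> A * (1 + t) ^ (j - 1)"
      using real_moment_polynomial_bound[of n "\<lambda>j. J j 0"] J(2) by blast
    obtain R where R: "0 < R" "((\<lambda>t. real_source n t / t ^ (n - 2)) \<longlongrightarrow> R) at_top"
      using real_source_tendsto[OF n2 A bound J(2) J(1)] by blast
    let ?r = "\<lambda>t. enn2real (source n t)"
    let ?S = "\<Sum>k. b (k + 2) * real (k + 3) ^ (n + 1)"
    have r_eq: "?r t = real_source n t" "source n t = ennreal (?r t)" if "0 \<le> t" for t
    proof -
      note eq = real_source_eq[OF n2 that A bound[OF _ _ that]]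
      show "?r t = real_source n t" "source n t = ennreal (?r t)" using eq(1,3) by simp_all
    qed
    have "\<exists>J. 0 < J \<and> ((\<lambda>t. real_moment n t x / t ^ (n - 1)) \<longlongrightarrow> J) at_top" for x
    proof -
      let ?k = "\<lambda>t. enn2real (K.kernel t x 0)"
      have "\<exists>C\<ge>0. \<forall>t\<ge>0. ?k t \<le> C"
      proof (rule bounded_if_tendsto_at_top[OF ker(1)])
        fix T
        have "?k t \<le> exp ((- a 0 0 + beta_star b + split_rate) * T)" if t: "t \<in> {0..T}" for t
        proof -
          have "K.kernel t x 0 \<le> ennreal (exp ((- a 0 0 + beta_star b + split_rate) * t))"
            using K.kernel_bounded t by simp
          also have "\<dots> \<le> ennreal (exp ((- a 0 0 + beta_star b + split_rate) * T))"
            using t K.M_nonneg by (intro ennreal_leI) (simp add: mult_left_mono)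
          finally show ?thesis by (intro enn2real_leI) auto
        qed
        then show "\<exists>C. \<forall>t\<in>{0..T}. ?k t \<le> C" by blast
      qed
      then obtain Kb where Kb: "\<And>t. 0 \<le> t \<Longrightarrow> ?k t \<le> Kb" by blast
      have conv: "((\<lambda>t. enn2real (\<integral>\<^sup>+u\<in>{0..t}. ennreal (?k (t - u)) * ennreal (?r u) \<partial>lborel) / t ^ (n - 2 + 1))
        \<longlongrightarrow> L x * R / real (n - 2 + 1)) at_top"
      proof (rule convolution_tendsto[where k = ?k and r = ?r and m = "n - 2" and K = Kb and C = "A ^ n * ?S"])
        show "(?k \<longlongrightarrow> L x) at_top" by (rule ker(1))
        show "?k t \<le> Kb" if "0 \<le> t" for t by (rule Kb[OF that])
        show "((\<lambda>t. ?r t / t ^ (n - 2)) \<longlongrightarrow> R) at_top"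
        proof (rule Lim_transform_eventually[OF R(2)])
          show "\<forall>\<^sub>F t in at_top. real_source n t / t ^ (n - 2) = ?r t / t ^ (n - 2)"
            using eventually_ge_at_top[of 0] by eventually_elim (simp only: r_eq(1))
        qed
        show "?r t \<le> A ^ n * ?S * (1 + t) ^ (n - 2)" if "0 \<le> t" for t
          unfolding r_eq(1)[OF that] by (rule real_source_eq(2)[OF n2 that A bound]) (use that in auto)
      qed auto
      have "((\<lambda>t. enn2real (K.flow t start x) * inverse (t ^ (n - 1)) +
          enn2real (\<integral>\<^sup>+u\<in>{0..t}. ennreal (?k (t - u)) * ennreal (?r u) \<partial>lborel) / t ^ (n - 2 + 1))
          \<longlongrightarrow> J1 x * 0 + L x * R / real (n - 2 + 1)) at_top"
        using n2 by (intro tendsto_add tendsto_mult first(1) conv tendsto_inverse_0_at_top filterlim_pow_at_top filterlim_ident) auto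
      moreover have "\<forall>\<^sub>F t in at_top. enn2real (K.flow t start x) * inverse (t ^ (n - 1)) +
          enn2real (\<integral>\<^sup>+u\<in>{0..t}. ennreal (?k (t - u)) * ennreal (?r u) \<partial>lborel) / t ^ (n - 2 + 1) =
          real_moment n t x / t ^ (n - 1)"
        using eventually_ge_at_top[of 0]
      proof eventually_elim
        fix t :: real assume t: "0 \<le> t"
        have "(\<integral>\<^sup>+u\<in>{0..t}. K.kernel (t - u) x 0 * source n u \<partial>lborel) =
          (\<integral>\<^sup>+u\<in>{0..t}. ennreal (?k (t - u)) * ennreal (?r u) \<partial>lborel)"
        proof (rule nn_integral_cong)
          fix u
          show "K.kernel (t - u) x 0 * source n u * indicator {0..t} u =
            ennreal (?k (t - u)) * ennreal (?r u) * indicator {0..t} u"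
          proof (cases "u \<in> {0..t}")
            case True
            then have "K.kernel (t - u) x 0 = ennreal (?k (t - u))" by simp
            moreover have "source n u = ennreal (?r u)" using True by (intro r_eq(2)) auto
            ultimately show ?thesis by (simp only:)
          qed simp
        qed
        then have eq: "ennreal (real_moment n t x) = K.flow t start x + (\<integral>\<^sup>+u\<in>{0..t}. ennreal (?k (t - u)) * ennreal (?r u) \<partial>lborel)"
          using moment_eq_duhamel[of n t x] moment_eq_real[OF t, of n x] t n2 by (simp add: K.duhamel_def)
        have "K.flow t start x + (\<integral>\<^sup>+u\<in>{0..t}. ennreal (?k (t - u)) * ennreal (?r u) \<partial>lborel) < top"
          by (subst eq[symmetric]) simp
        then have "enn2real (K.flow t start x + (\<integral>\<^sup>+u\<in>{0..t}. ennreal (?k (t - u)) * ennreal (?r u) \<partial>lborel)) =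
          enn2real (K.flow t start x) + enn2real (\<integral>\<^sup>+u\<in>{0..t}. ennreal (?k (t - u)) * ennreal (?r u) \<partial>lborel)"
          by (intro enn2real_plus) auto
        then have "real_moment n t x = enn2real (K.flow t start x) + enn2real (\<integral>\<^sup>+u\<in>{0..t}. ennreal (?k (t - u)) * ennreal (?r u) \<partial>lborel)"
          by (subst (asm) eq[symmetric]) (simp add: real_moment_nonneg)
        moreover have "n - 2 + 1 = n - 1" using n2 by simp
        ultimately show "enn2real (K.flow t start x) * inverse (t ^ (n - 1)) +
          enn2real (\<integral>\<^sup>+u\<in>{0..t}. ennreal (?k (t - u)) * ennreal (?r u) \<partial>lborel) / t ^ (n - 2 + 1) =
          real_moment n t x / t ^ (n - 1)"
          by (simp only: distrib_right divide_inverse)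
      qed
      ultimately have "((\<lambda>t. real_moment n t x / t ^ (n - 1)) \<longlongrightarrow> J1 x * 0 + L x * R / real (n - 2 + 1)) at_top"
        by (rule Lim_transform_eventually)
      moreover have "0 < J1 x * 0 + L x * R / real (n - 2 + 1)"
        using ker(2)[of x] R(1) by simp
      ultimately show ?thesis by blast
    qed
    then show ?thesis by metis
  qed
qed

end

section \<open>The ground state of the evolution kernel\<close>

context moment_walk
begin

lemma evolution_alt:
  "evolution x y = a x y + (if y = x then split_rate - a 0 0 + (if x = 0 then beta_star b else 0) else 0)"
  using a_diag[of x] by (auto simp: evolution_def jump_def)

lemma evolution_sym: "evolution x y = evolution y x"
  unfolding evolution_alt using a_sym[of x y] by auto

lemma evolution_irreducible: "(\<lambda>x y. 0 < evolution x y)\<^sup>*\<^sup>* x y"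
proof -
  have "0 < evolution x y" if "0 < a x y" for x y
  proof -
    have "x \<noteq> y" using that a_diag_neg[of x] by auto
    then show ?thesis using that by (simp add: evolution_alt)
  qed
  then show ?thesis
    using a_irreducible[of x y] mono_rtranclp[of "\<lambda>x y. 0 < a x y" "\<lambda>x y. 0 < evolution x y"] by blast
qed

lemma evolution_eigenfunction_has_sum:
  assumes bounded: "\<And>x. \<bar>\<phi> x\<bar> \<le> C"
    and eigen: "walk_op a \<phi> x + beta_star b * Delta0 \<phi> x = b 0 * \<phi> x"
  shows "((\<lambda>y. evolution x y * \<phi> y) has_sum (uniform_rate * \<phi> x)) UNIV"
proof -
  have "(\<lambda>y. \<bar>a x y\<bar>) summable_on UNIV"
    using a_sum[of x] summable_on_iff_abs_summable_on_real[of "a x" UNIV] by (auto simp: summable_on_def)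
  then have "(\<lambda>y. C * \<bar>a x y\<bar>) summable_on UNIV" by (rule summable_on_cmult_right)
  then have "(\<lambda>y. norm (a x y * \<phi> y)) summable_on UNIV"
  proof (rule summable_on_comparison_test)
    show "norm (a x y * \<phi> y) \<le> C * \<bar>a x y\<bar>" for y
    proof -
      have "\<bar>\<phi> y\<bar> * \<bar>a x y\<bar> \<le> C * \<bar>a x y\<bar>" by (rule mult_right_mono[OF bounded]) simp
      then show ?thesis by (simp only: real_norm_def abs_mult mult.commute[of "\<bar>a x y\<bar>"])
    qed
  qed simp
  then have "(\<lambda>y. a x y * \<phi> y) summable_on UNIV"
    by (rule iffD2[OF summable_on_iff_abs_summable_on_real])
  then have "((\<lambda>y. a x y * \<phi> y) has_sum (\<Sum>\<^sub>\<infinity>y. a x y * \<phi> y)) UNIV" by (rule has_sum_infsum)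
  moreover have "a 0 (x - y) = a x y" for y
    using a_shift[of y x] a_sym[of x y] by simp
  ultimately have sum: "((\<lambda>y. a x y * \<phi> y) has_sum walk_op a \<phi> x) UNIV"
    by (simp only: walk_op_def)
  have diag: "((\<lambda>y. if y = x then (split_rate - a 0 0 + (if x = 0 then beta_star b else 0)) * \<phi> x else 0) has_sum
      (split_rate - a 0 0 + (if x = 0 then beta_star b else 0)) * \<phi> x) UNIV"
    by (rule has_sum_finite_neutralI[of "{x}"]) auto
  have "((\<lambda>y. a x y * \<phi> y + (if y = x then (split_rate - a 0 0 + (if x = 0 then beta_star b else 0)) * \<phi> x else 0))
    has_sum (walk_op a \<phi> x + (split_rate - a 0 0 + (if x = 0 then beta_star b else 0)) * \<phi> x)) UNIV"
    by (rule has_sum_add[OF sum diag])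
  moreover have "walk_op a \<phi> x + (split_rate - a 0 0 + (if x = 0 then beta_star b else 0)) * \<phi> x = uniform_rate * \<phi> x"
    using eigen by (auto simp: Delta0_def uniform_rate_def algebra_simps)
  moreover have "(\<lambda>y. a x y * \<phi> y + (if y = x then (split_rate - a 0 0 + (if x = 0 then beta_star b else 0)) * \<phi> x else 0)) =
    (\<lambda>y. evolution x y * \<phi> y)"
    by (auto simp: evolution_alt distrib_right fun_eq_iff)
  ultimately show ?thesis by (simp only:)
qed

lemma evolution_row_has_sum:
  "((\<lambda>y. evolution x y) has_sum (split_rate - a 0 0 + (if x = 0 then beta_star b else 0))) UNIV"
proof -
  have "((\<lambda>y. if y = x then split_rate - a 0 0 + (if x = 0 then beta_star b else 0) else 0) has_sum
      (split_rate - a 0 0 + (if x = 0 then beta_star b else 0))) UNIV"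
    by (rule has_sum_finite_neutralI[of "{x}"]) auto
  from has_sum_add[OF a_sum[of x] this] show ?thesis by (simp add: evolution_alt[abs_def])
qed

text \<open>
  Let \<open>i < 0\<close> be the infimum of \<open>\<phi>\<close>. Replacing \<open>\<phi>\<close> by \<open>i\<close> in the eigenvalue equation, except for the
  nonnegative contribution of \<open>\<beta>\<^sup>* \<phi> 0\<close>, leaves a lower bound for \<open>uniform_rate * \<phi>\<close> at every point. Taking the
  infimum gives \<open>b 0 * i \<ge> 0\<close>, which is impossible as \<open>b 0 > 0\<close>.
\<close>

lemma minimum_principle:
  assumes b0: "0 < b 0" and bounded: "\<And>x. \<bar>\<phi> x\<bar> \<le> C"
    and eigen: "\<And>x. ((\<lambda>y. evolution x y * \<phi> y) has_sum (uniform_rate * \<phi> x)) UNIV"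
    and zero: "0 \<le> \<phi> 0"
  shows "0 \<le> \<phi> x"
proof (rule ccontr)
  assume "\<not> 0 \<le> \<phi> x"
  define i where "i = (INF x. \<phi> x)"
  have bdd: "bdd_below (range \<phi>)"
    using bounded by (intro bdd_belowI2[of _ "- C"]) (simp add: abs_le_iff minus_le_iff)
  have i_le: "i \<le> \<phi> y" for y unfolding i_def by (rule cINF_lower[OF bdd]) simp
  have "i < 0" using i_le[of x] \<open>\<not> 0 \<le> \<phi> x\<close> by linarith
  have c: "0 < uniform_rate"
    using b0 split_rate_nonneg a_diag_neg[of 0] by (simp add: uniform_rate_def)
  \<comment> \<open>The row sums of the evolution kernel equal \<open>split_rate - a 0 0\<close>, apart from \<open>\<beta>\<^sup>*\<close> at the origin.\<close>
  have low: "(split_rate - a 0 0) * i \<le> uniform_rate * \<phi> y" for y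
  proof -
    have "((\<lambda>z. evolution y z * i) has_sum ((split_rate - a 0 0 + (if y = 0 then beta_star b else 0)) * i)) UNIV"
      by (rule has_sum_cmult_left[OF evolution_row_has_sum])
    moreover have "((\<lambda>z. if z = 0 \<and> y = 0 then beta_star b * (\<phi> 0 - i) else 0) has_sum (if y = 0 then beta_star b * (\<phi> 0 - i) else 0)) UNIV"
      by (rule has_sum_finite_neutralI[of "{0}"]) auto
    ultimately have "((\<lambda>z. evolution y z * i + (if z = 0 \<and> y = 0 then beta_star b * (\<phi> 0 - i) else 0)) has_sum
      ((split_rate - a 0 0 + (if y = 0 then beta_star b else 0)) * i + (if y = 0 then beta_star b * (\<phi> 0 - i) else 0))) UNIV"
      by (rule has_sum_add)
    moreover have "evolution y z * i + (if z = 0 \<and> y = 0 then beta_star b * (\<phi> 0 - i) else 0) \<le> evolution y z * \<phi> z" for z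
    proof (cases "z = 0 \<and> y = 0")
      case True
      have "beta_star b * (\<phi> 0 - i) \<le> evolution 0 0 * (\<phi> 0 - i)"
        using i_le[of 0] split_rate_nonneg by (intro mult_right_mono) (auto simp: evolution_def jump_def)
      then show ?thesis using True by (simp add: algebra_simps)
    next
      case False
      then show ?thesis using i_le[of z] evolution_nonneg by (auto intro: mult_left_mono)
    qed
    ultimately have "(split_rate - a 0 0 + (if y = 0 then beta_star b else 0)) * i + (if y = 0 then beta_star b * (\<phi> 0 - i) else 0)
        \<le> uniform_rate * \<phi> y"
      by (intro has_sum_mono[OF _ eigen[of y]]) auto
    moreover have "(split_rate - a 0 0) * i \<le> (split_rate - a 0 0 + (if y = 0 then beta_star b else 0)) * i + (if y = 0 then beta_star b * (\<phi> 0 - i) else 0)"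
      using zero supercritical by (auto simp: algebra_simps)
    ultimately show ?thesis by linarith
  qed
  have "(split_rate - a 0 0) * i / uniform_rate \<le> i"
    unfolding i_def
  proof (rule cINF_greatest)
    show "(split_rate - a 0 0) * (INF x. \<phi> x) / uniform_rate \<le> \<phi> y" for y
      using low[of y] c by (simp add: pos_divide_le_eq mult.commute i_def)
  qed simp
  then have "(split_rate - a 0 0) * i \<le> i * uniform_rate"
    using c by (simp add: pos_divide_le_eq)
  then have "0 \<le> b 0 * i" by (simp add: uniform_rate_def algebra_simps)
  then show False using b0 \<open>i < 0\<close> by (simp add: zero_le_mult_iff)
qed

text \<open>
  The sign of the eigenvector is chosen such that its value at the origin is nonnegative; then the minimum
  principle applies. If that value were \<open>0\<close>, it would apply to both signs and the eigenvector would
  vanish. A zero elsewhere would spread to the origin by irreducibility.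
\<close>

theorem ground_state_exists:
  assumes "isolated_positive_eigenvalue (\<lambda>\<phi> x. walk_op a \<phi> x + beta_star b * Delta0 \<phi> x) (b 0)"
  shows "0 < b 0 \<and> (\<exists>\<phi>. symmetric_ground_state_kernel evolution uniform_rate (- a 0 0 + beta_star b + split_rate) \<phi>)"
proof -
  let ?T = "\<lambda>\<phi> x. walk_op a \<phi> x + beta_star b * Delta0 \<phi> x"
  have b0: "0 < b 0" and "l2_eigenvalue ?T (b 0)"
    using assms by (auto simp: isolated_positive_eigenvalue_def)
  then obtain \<psi> where \<psi>: "\<psi> \<in> l2" "\<psi> \<noteq> (\<lambda>x. 0)" "?T \<psi> = (\<lambda>x. b 0 * \<psi> x)"
    unfolding l2_eigenvalue_def by blast
  define S where "S = (\<Sum>\<^sub>\<infinity>x. (\<psi> x)\<^sup>2)"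
  have sq: "((\<lambda>x. (\<psi> x)\<^sup>2) has_sum S) UNIV"
    using \<psi>(1) unfolding l2_def S_def by (auto intro: has_sum_infsum)
  have bounded: "\<bar>\<psi> x\<bar> \<le> sqrt S" for x
  proof -
    have "((\<lambda>y. if y = x then (\<psi> x)\<^sup>2 else 0) has_sum (\<psi> x)\<^sup>2) UNIV"
      by (rule has_sum_finite_neutralI[of "{x}"]) auto
    from has_sum_mono[OF this sq] have "(\<psi> x)\<^sup>2 \<le> S" by auto
    then show ?thesis by (metis real_sqrt_abs real_sqrt_le_mono)
  qed
  have eigen: "((\<lambda>y. evolution x y * \<psi> y) has_sum (uniform_rate * \<psi> x)) UNIV" for x
    by (rule evolution_eigenfunction_has_sum[OF bounded]) (use \<psi>(3) in meson)
  have minus_eigen: "((\<lambda>y. evolution x y * - \<psi> y) has_sum (uniform_rate * - \<psi> x)) UNIV" for x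
    using has_sum_uminusI[OF eigen[of x]] by simp
  have minus_bounded: "\<bar>- \<psi> x\<bar> \<le> sqrt S" for x using bounded by simp
  \<comment> \<open>Normalise the sign at the origin.\<close>
  define \<phi> where "\<phi> = (if 0 \<le> \<psi> 0 then \<psi> else (\<lambda>x. - \<psi> x))"
  have \<phi>_bounded: "\<bar>\<phi> x\<bar> \<le> sqrt S" and \<phi>_zero: "0 \<le> \<phi> 0"
    and \<phi>_sq: "((\<lambda>x. (\<phi> x)\<^sup>2) has_sum S) UNIV"
    and \<phi>_eigen: "((\<lambda>y. evolution x y * \<phi> y) has_sum (uniform_rate * \<phi> x)) UNIV" for x
    using bounded sq eigen minus_eigen by (auto simp: \<phi>_def)
  have nonneg: "0 \<le> \<phi> x" for x
    by (rule minimum_principle[OF b0 \<phi>_bounded \<phi>_eigen \<phi>_zero])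
  have "\<phi> 0 \<noteq> 0"
  proof
    assume "\<phi> 0 = 0"
    then have "\<psi> 0 = 0" by (auto simp: \<phi>_def split: if_splits)
    have "0 \<le> \<psi> x" for x by (rule minimum_principle[OF b0 bounded eigen]) (simp add: \<open>\<psi> 0 = 0\<close>)
    moreover have "0 \<le> - \<psi> x" for x by (rule minimum_principle[OF b0 minus_bounded minus_eigen]) (simp add: \<open>\<psi> 0 = 0\<close>)
    ultimately have "\<psi> x = 0" for x by (metis antisym neg_0_le_iff_le)
    then show False using \<psi>(2) by auto
  qed
  have pos: "0 < \<phi> x" for x
  proof (rule ccontr)
    assume "\<not> 0 < \<phi> x"
    then have "\<phi> x = 0" using nonneg[of x] by simp
    have "\<phi> y = 0" if "(\<lambda>x y. 0 < evolution x y)\<^sup>*\<^sup>* x y" for y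
      using that
    proof (induction rule: rtranclp_induct)
      case base
      show ?case by fact
    next
      case (step y z)
      have "((\<lambda>w. if w = z then evolution y z * \<phi> z else 0) has_sum evolution y z * \<phi> z) UNIV"
        by (rule has_sum_finite_neutralI[of "{z}"]) auto
      from has_sum_mono[OF this \<phi>_eigen[of y]] have "evolution y z * \<phi> z \<le> uniform_rate * \<phi> y"
        using nonneg evolution_nonneg by auto
      then show ?case using step nonneg[of z] by (simp add: mult_le_0_iff)
    qed
    from this[OF evolution_irreducible, of 0] show False using \<open>\<phi> 0 \<noteq> 0\<close> by simp
  qed
  have "symmetric_ground_state_kernel evolution uniform_rate (- a 0 0 + beta_star b + split_rate) \<phi>"
  proof (intro symmetric_ground_state_kernel.intro K.bounded_kernel_axioms symmetric_ground_state_kernel_axioms.intro)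
    show "evolution x y = evolution y x" for x y by (rule evolution_sym)
    show "0 < \<phi> x" for x by (rule pos)
    show "(\<Sum>\<^sup>+y. ennreal (evolution x y) * ennreal (\<phi> y)) = ennreal (uniform_rate * \<phi> x)" for x
      using has_sum_imp_nn_integral_count_space[OF \<phi>_eigen[of x]] nonneg evolution_nonneg by (simp add: ennreal_mult)
    show "(\<Sum>\<^sup>+y. ennreal ((\<phi> y)\<^sup>2)) < top"
      using has_sum_imp_nn_integral_count_space[OF \<phi>_sq] by simp
    show "(\<lambda>x y. 0 < evolution x y)\<^sup>*\<^sup>* x y" for x y by (rule evolution_irreducible)
  qed
  then show ?thesis using b0 by blast
qed

end

context additive_statistic
begin

lemma integral_moment:
  assumes "0 \<le> t"
  shows "(\<integral>\<omega>. real (h (X t \<omega>)) ^ n \<partial>Pr {#x#}) = real_moment n t x"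
proof -
  have "(\<lambda>\<omega>. real (h (X t \<omega>)) ^ n) \<in> borel_measurable (Pr {#x#})"
    by (rule measurable_compose[OF X_measurable[OF assms]]) simp
  then show ?thesis
    unfolding real_moment_def moment_def nn_integral_law[OF assms]
    by (subst integral_eq_nn_integral) auto
qed

end

section \<open>Asymptotics of all moments\<close>

theorem theorem6p1:
  fixes a :: "int ^ 'd \<Rightarrow> int ^ 'd \<Rightarrow> real"
    and p :: "real \<Rightarrow> int ^ 'd \<Rightarrow> int ^ 'd \<Rightarrow> real"
    and b :: "nat \<Rightarrow> real"
    and Pr :: "(int ^ 'd) multiset \<Rightarrow> 'w measure"
    and X :: "real \<Rightarrow> 'w \<Rightarrow> (int ^ 'd) multiset"
    and lambda0 :: real
  assumes "walk_intensity a"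
    and "walk_transition a p"
    and "branching_intensity b"
    and "all_derivatives_finite (branching_gf b)"
    and "branching_random_walk a b Pr X"
    and "beta_star b > 0"
    and "beta_star b > beta_c p"
    and "isolated_positive_eigenvalue (\<lambda>\<phi> x. walk_op a \<phi> x + beta_star b * Delta0 \<phi> x) lambda0"
    and "lambda0 - b 0 = 0"
  shows "\<exists>(J :: nat \<Rightarrow> int ^ 'd \<Rightarrow> int ^ 'd \<Rightarrow> real) (J' :: nat \<Rightarrow> int ^ 'd \<Rightarrow> real).
    \<forall>n\<ge>1. \<forall>x y.
      (\<lambda>t. local_moment Pr X n t x y) \<sim>[at_top] (\<lambda>t. J n x y * t ^ (n - 1)) \<and>
      (\<lambda>t. total_moment Pr X n t x) \<sim>[at_top] (\<lambda>t. J' n x * t ^ (n - 1))"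
proof -
  interpret W: moment_walk a b Pr X
    by unfold_locales (use assms in auto)
  have b0: "0 < b 0" and "\<exists>\<phi>. symmetric_ground_state_kernel W.evolution W.uniform_rate (- a 0 0 + beta_star b + W.split_rate) \<phi>"
    using W.ground_state_exists assms by auto
  then obtain \<phi> where "symmetric_ground_state_kernel W.evolution W.uniform_rate (- a 0 0 + beta_star b + W.split_rate) \<phi>"
    by blast
  then interpret G: symmetric_ground_state_kernel W.evolution W.uniform_rate "- a 0 0 + beta_star b + W.split_rate" \<phi> .
  have equiv: "f \<sim>[at_top] (\<lambda>t. J * t ^ m)"
    if "((\<lambda>t. g t / t ^ m) \<longlongrightarrow> J) at_top" "0 < J" "\<And>t. 0 \<le> t \<Longrightarrow> f t = g t" for f g :: "real \<Rightarrow> real" and J m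
  proof (rule asymp_equivI')
    have "((\<lambda>t. g t / t ^ m / J) \<longlongrightarrow> J / J) at_top"
      using that by (intro tendsto_divide tendsto_const) auto
    moreover have "\<forall>\<^sub>F t in at_top. g t / t ^ m / J = f t / (J * t ^ m)"
      using eventually_ge_at_top[of 0] by eventually_elim (simp add: that(3) mult.commute)
    ultimately show "((\<lambda>t. f t / (J * t ^ m)) \<longlongrightarrow> 1) at_top"
      using that(2) by (auto dest: Lim_transform_eventually)
  qed
  have loc: "\<exists>J. \<forall>x. (\<lambda>t. local_moment Pr X n t x y) \<sim>[at_top] (\<lambda>t. J x * t ^ (n - 1))" if n: "1 \<le> n" for n y
  proof -
    interpret C: additive_statistic a b Pr X "\<lambda>\<zeta>. count \<zeta> y"
      by unfold_locales auto
    \<comment> \<open>For the local number the first moment is the kernel itself.\<close>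
    have start: "C.start = indicator {y}"
      by (auto simp: C.start_def indicator_def fun_eq_iff)
    have "\<exists>J. \<forall>x. 0 < J x \<and> ((\<lambda>t. C.real_moment n t x / t ^ (n - 1)) \<longlongrightarrow> J x) at_top"
    proof (rule C.real_moment_tendsto[OF G.kernel_tendsto G.kernel_limit_pos _ _ n])
      show "((\<lambda>t. enn2real (W.K.flow t C.start x)) \<longlongrightarrow> G.kernel_limit x y) at_top" for x
        using G.kernel_tendsto[of x y] by (simp add: start W.K.kernel_def)
      show "0 < G.kernel_limit x y" for x by (rule G.kernel_limit_pos)
    qed
    then obtain J where J: "\<And>x. 0 < J x" "\<And>x. ((\<lambda>t. C.real_moment n t x / t ^ (n - 1)) \<longlongrightarrow> J x) at_top"
      by blast
    have "(\<lambda>t. local_moment Pr X n t x y) \<sim>[at_top] (\<lambda>t. J x * t ^ (n - 1))" for x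
      by (rule equiv[OF J(2) J(1)]) (simp add: local_moment_def C.integral_moment)
    then show ?thesis by blast
  qed
  have tot: "\<exists>J. \<forall>x. (\<lambda>t. total_moment Pr X n t x) \<sim>[at_top] (\<lambda>t. J x * t ^ (n - 1))" if n: "1 \<le> n" for n
  proof -
    interpret C: additive_statistic a b Pr X size
      by unfold_locales auto
    \<comment> \<open>For the total number the first moment is the flow of the constant function.\<close>
    have start: "C.start = (\<lambda>_. 1)"
      by (auto simp: C.start_def fun_eq_iff)
    let ?g = "W.split_rate - a 0 0"
    have g: "0 \<le> ?g" "?g < W.uniform_rate"
      using b0 W.split_rate_nonneg W.a_diag_neg[of 0] by (auto simp: W.uniform_rate_def)
    have row: "W.K.app (\<lambda>_. 1) x = ennreal ?g + ennreal (beta_star b) * indicator {0} x" for x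
      using has_sum_imp_nn_integral_count_space[OF W.evolution_row_has_sum[of x]] W.evolution_nonneg g assms(6)
      by (auto simp: W.K.app_def ennreal_plus[symmetric] simp del: ennreal_plus)
    have "\<exists>J. \<forall>x. 0 < J x \<and> ((\<lambda>t. C.real_moment n t x / t ^ (n - 1)) \<longlongrightarrow> J x) at_top"
    proof (rule C.real_moment_tendsto[OF G.kernel_tendsto G.kernel_limit_pos _ _ n])
      show "((\<lambda>t. enn2real (W.K.flow t C.start x)) \<longlongrightarrow> beta_star b * G.kernel_limit x 0 / (W.uniform_rate - ?g)) at_top" for x
        unfolding start by (rule G.flow_one_tendsto[OF row g]) (use assms(6) in simp)
      show "0 < beta_star b * G.kernel_limit x 0 / (W.uniform_rate - ?g)" for x
        using g assms(6) G.kernel_limit_pos[of x 0] by simp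
    qed
    then obtain J where J: "\<And>x. 0 < J x" "\<And>x. ((\<lambda>t. C.real_moment n t x / t ^ (n - 1)) \<longlongrightarrow> J x) at_top"
      by blast
    have "(\<lambda>t. total_moment Pr X n t x) \<sim>[at_top] (\<lambda>t. J x * t ^ (n - 1))" for x
      by (rule equiv[OF J(2) J(1)]) (simp add: total_moment_def C.integral_moment)
    then show ?thesis by blast
  qed
  have "\<forall>n y. \<exists>J. 1 \<le> n \<longrightarrow> (\<forall>x. (\<lambda>t. local_moment Pr X n t x y) \<sim>[at_top] (\<lambda>t. J x * t ^ (n - 1)))"
    using loc by blast
  then obtain J where "\<And>n y x. 1 \<le> n \<Longrightarrow> (\<lambda>t. local_moment Pr X n t x y) \<sim>[at_top] (\<lambda>t. J n y x * t ^ (n - 1))"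
    by metis
  moreover have "\<forall>n. \<exists>J. 1 \<le> n \<longrightarrow> (\<forall>x. (\<lambda>t. total_moment Pr X n t x) \<sim>[at_top] (\<lambda>t. J x * t ^ (n - 1)))"
    using tot by blast
  then obtain J' where "\<And>n x. 1 \<le> n \<Longrightarrow> (\<lambda>t. total_moment Pr X n t x) \<sim>[at_top] (\<lambda>t. J' n x * t ^ (n - 1))"
    by metis
  ultimately show ?thesis
    by (intro exI[of _ "\<lambda>n x y. J n y x"] exI[of _ J']) blast
qed

end
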